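(* Let $\mathbf{L}$ be a complete subfield of $\mathbf{C}_\infty$ containing $\mathbb{K}_\infty$, and $n\ge1$. The set $\mathcal{D}_{\mathbb{K},n}^{\mathbf{L}}$ of commensurability classes of $n$-pointed Drinfeld $\mathbf{A}$-modules over $\mathbf{L}$ can be identified with a generalized moduli space of Drinfeld modules with possibly degenerate level structure, namely with the moduli space of isogeny classes of data $(\Phi,\rho)$, with $\Phi$ a Drinfeld $\mathbf{A}$-module of rank $n$ over $\mathbf{L}$ and $\rho:(\mathbb{K}/\mathbf{A})^n\to\Phi(\mathbf{L})$ a homomorphism of $\mathbf{A}$-modules.
   Context: $\mathbb{K}$ is the function field of a smooth projective geometrically connected curve over $\mathbb{F}_q$, $\infty$ a fixed place, $\mathbf{A}\subset\mathbb{K}$ the ring of functions regular outside $\infty$, $\mathbb{K}_\infty$ the completion at $\infty$, $\mathbf{C}_\infty$ the completion of an algebraic closure of $\mathbb{K}_\infty$, $R=\prod_{v\ne\infty}\mathbf{A}_v$. $\mathbf{L}$ is an $\mathbf{A}$-field of generic characteristic via $\mathbf{A}\subset\mathbb{K}_\infty\subset\mathbf{L}$, and $\mathbf{L}\{\tau\}$ is the ring of polynomials in the $q$-power map $\tau$, $\tau a=a^q\tau$. A Drinfeld $\mathbf{A}$-module of rank $n$ over $\mathbf{L}$ is an $\mathbb{F}_q$-algebra homomorphism $\Phi:\mathbf{A}\to\mathbf{L}\{\tau\}$, $a\mapsto\Phi_a$, nontrivial, with constant coefficient of $\Phi_a$ equal to $a$ and $\deg\Phi_a(\tau)=n\deg(a)$.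 $\Phi(\mathbf{L})$ denotes $\mathbf{L}$ viewed as an $\mathbf{A}$-module through $\Phi$. For a nonzero ideal $I\subset\mathbf{A}$, $\Phi[I]$ is the finite group of roots, in an algebraic closure of $\mathbf{L}$, of the monic generator of the left ideal of $\mathbf{L}\{\tau\}$ generated by the $\Phi_a$, $a\in I$. An isogeny connecting $\Phi$ and $\Psi$ is a nonzero $P\in\mathbf{L}\{\tau\}$ with $P\Phi_a=\Psi_aP$ for all $a\in\mathbf{A}$. $T\Phi=\prod_{v\ne\infty}T_v\Phi$, $T_v\Phi=\mathrm{Hom}_{\mathbf{A}}(\mathbb{K}_v/\mathbf{A}_v,\Phi[v^\infty])$ with $\Phi[v^\infty]=\bigcup_m\Phi[v^m]$, is the adelic Tate module, a free $R$-module of rank $n$; $P$ induces maps $T_v(P):T_v\Phi\to T_v\Psi$. An $n$-pointed Drinfeld $\mathbf{A}$-module over $\mathbf{L}$ is a datum $(\Phi,\zeta_1,\dots,\zeta_n)$ with $\Phi$ of rank $n$ over $\mathbf{L}$ and $\zeta_i\in T\Phi$. Data $(\Phi,\zeta_1,\dots,\zeta_n)$ and $(\Psi,\eta_1,\dots,\eta_n)$ are commensurable if there exists an isogeny $P$ connecting $\Phi$ and $\Psi$ such that $(\eta_i)_v=T_v(P)(\zeta_i)_v$ for all $i$ and all $v\ne\infty$. Isogeny classes of data $(\Phi,\rho)$ are taken with respect to isogenies of Drinfeld modules and the induced maps. A datum $(\Phi,\zeta_1,\dots,\zeta_n)$ is the same as $(\Phi,\zeta)$ with $\zeta:R^n\to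 T\Phi$ the $R$-module homomorphism $\zeta(e_i)=\zeta_i$, $e_i$ the standard basis; $\zeta$ determines homomorphisms $\zeta_I:(I^{-1}\mathbf{A}/\mathbf{A})^n\to\Phi[I]$ for nonzero ideals $I\subset\mathbf{A}$, and $(\Phi,\zeta)$ corresponds to $(\Phi,\rho)$ when the homomorphisms $\rho_I$ induced by $\rho$ on $(I^{-1}\mathbf{A}/\mathbf{A})^n$ satisfy $\rho_I=\zeta_I$.
   Formalization: Torsion points of Φ need not lie in L, so the claim is proved in two forms: all n-pointed modules against ρ with values in Φ of the algebraic closure of L, and those whose ζ_i take values in L against ρ into Φ(L); the forms agree with the text when L contains the torsion. *)

theory Defs
  imports
    "HOL-Analysis.Abstract_Metric_Spaces"
    "HOL-Library.FuncSet"
    "HOL-Algebra.Algebraic_Closure_Type"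
    "HOL-Algebra.Generated_Fields"
    "HOL-Algebra.Ideal_Product"
begin

hide_const (open) Polynomials.degree Polynomials.lead_coeff Polynomial.smult

text \<open>
  All fields of the setting (the constants, the function field, its completion at infinity, the
  coefficient field of the Drinfeld modules) are subfields of a single ambient field, the
  type \<^typ>\<open>'c\<close>, which is the completion of an algebraic closure of the completion at infinity.
\<close>

abbreviation ambient :: "'c::field ring"
  where "ambient \<equiv> ring_of_type_algebra"

abbreviation subring_of :: "'c::field set \<Rightarrow> 'c ring"
  where "subring_of S \<equiv> ambient\<lparr>carrier := S\<rparr>"


section \<open>Modules\<close>

text \<open>
  The record type \<^typ>\<open>('a, 'b) module\<close> extends rings; the fields \<^const>\<open>monoid.mult\<close> and \<^const>\<open>one\<close>
  play no role for a module and are left undefined.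
\<close>

definition ring_module :: "('a \<Rightarrow> 'b) \<Rightarrow> 'b ring \<Rightarrow> ('a, 'b) module"
  where "ring_module h R =
    \<lparr>carrier = carrier R, monoid.mult = undefined, one = undefined, zero = \<zero>\<^bsub>R\<^esub>, add = add R,
     smult = (\<lambda>a x. h a \<otimes>\<^bsub>R\<^esub> x)\<rparr>"

definition quotient_module :: "('a, 'b) module \<Rightarrow> 'b set \<Rightarrow> ('a, 'b set) module"
  where "quotient_module M N =
    \<lparr>carrier = a_rcosets\<^bsub>M\<^esub> N, monoid.mult = undefined, one = undefined, zero = N, add = set_add M,
     smult = (\<lambda>a Y. \<Union>x\<in>Y. N +>\<^bsub>M\<^esub> (a \<odot>\<^bsub>M\<^esub> x))\<rparr>"

definition power_module :: "nat \<Rightarrow> ('a, 'b) module \<Rightarrow> ('a, nat \<Rightarrow> 'b) module"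
  where "power_module n M =
    \<lparr>carrier = {..<n} \<rightarrow>\<^sub>E carrier M, monoid.mult = undefined, one = undefined,
     zero = (\<lambda>i\<in>{..<n}. \<zero>\<^bsub>M\<^esub>), add = (\<lambda>x y. \<lambda>i\<in>{..<n}. x i \<oplus>\<^bsub>M\<^esub> y i),
     smult = (\<lambda>a x. \<lambda>i\<in>{..<n}. a \<odot>\<^bsub>M\<^esub> x i)\<rparr>"

definition module_hom :: "'a ring \<Rightarrow> ('a, 'b) module \<Rightarrow> ('a, 'd) module \<Rightarrow> ('b \<Rightarrow> 'd) set"
  where "module_hom R M N =
    {f \<in> carrier M \<rightarrow>\<^sub>E carrier N.
       (\<forall>x\<in>carrier M. \<forall>y\<in>carrier M. f (x \<oplus>\<^bsub>M\<^esub> y) = f x \<oplus>\<^bsub>N\<^esub> f y) \<and>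
       (\<forall>a\<in>carrier R. \<forall>x\<in>carrier M. f (a \<odot>\<^bsub>M\<^esub> x) = a \<odot>\<^bsub>N\<^esub> f x)}"


section \<open>Function fields and their places\<close>

text \<open>
  The curve is given by its function field \<open>K\<close> with field of constants \<open>k\<close>. Since \<open>k\<close> is perfect,
  smooth projective geometrically connected curves over \<open>k\<close> correspond to algebraic function
  fields of one variable in which \<open>k\<close> is algebraically closed, and closed points correspond to
  places. A place is represented by its valuation ring.
\<close>

definition function_field_over :: "'c::field set \<Rightarrow> 'c set \<Rightarrow> bool"
  where "function_field_over k K \<longleftrightarrow>
    subfield k ambient \<and> subfield K ambient \<and> k \<subseteq> K \<and>
    (\<exists>x\<in>K. ring.transcendental ambient k x \<and>
       ring.finite_dimension ambient (generate_field ambient (insert x k)) K) \<and>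
    (\<forall>x\<in>K. ring.algebraic ambient k x \<longrightarrow> x \<in> k)"

definition places :: "'c::field set \<Rightarrow> 'c set \<Rightarrow> 'c set set"
  where "places k K =
    {v. subring v ambient \<and> k \<subseteq> v \<and> v \<subset> K \<and> (\<forall>x\<in>K. x \<in> v \<or> inverse x \<in> v)}"

definition max_ideal :: "'c::field set \<Rightarrow> 'c set"
  where "max_ideal v = v - Units (subring_of v)"

text \<open>The normalised discrete valuation of a place; meaningful for \<open>x \<noteq> 0\<close> only.\<close>

definition ord_at :: "'c::field set \<Rightarrow> 'c \<Rightarrow> int"
  where "ord_at v x =
    (THE i. \<exists>t u. max_ideal v = (\<lambda>y. t * y) ` v \<and> u \<in> Units (subring_of v) \<and> x = u * t powi i)"

definition place_degree :: "'c::field set \<Rightarrow> 'c set \<Rightarrow> nat"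
  where "place_degree k v =
    (let F = subring_of v Quot max_ideal v
     in ring.dim F ((\<lambda>c. max_ideal v +>\<^bsub>subring_of v\<^esub> c) ` k) (carrier F))"

text \<open>The completion of \<open>K\<close> at a place: Cauchy sequences in \<open>K\<close> modulo null sequences.\<close>

definition null_seq :: "'c::field set \<Rightarrow> (nat \<Rightarrow> 'c) \<Rightarrow> bool"
  where "null_seq v s \<longleftrightarrow> (\<forall>N. \<exists>m. \<forall>i\<ge>m. s i = 0 \<or> ord_at v (s i) \<ge> N)"

definition cauchy_seq :: "'c::field set \<Rightarrow> (nat \<Rightarrow> 'c) \<Rightarrow> bool"
  where "cauchy_seq v s \<longleftrightarrow>
    (\<forall>N. \<exists>m. \<forall>i\<ge>m. \<forall>j\<ge>m. s i = s j \<or> ord_at v (s i - s j) \<ge> N)"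

definition cauchy_ring :: "'c::field set \<Rightarrow> 'c set \<Rightarrow> (nat \<Rightarrow> 'c) ring"
  where "cauchy_ring K v =
    \<lparr>carrier = {s. range s \<subseteq> K \<and> cauchy_seq v s}, monoid.mult = (\<lambda>s t i. s i * t i), one = (\<lambda>i. 1),
     zero = (\<lambda>i. 0), add = (\<lambda>s t i. s i + t i)\<rparr>"

definition null_seqs :: "'c::field set \<Rightarrow> 'c set \<Rightarrow> (nat \<Rightarrow> 'c) set"
  where "null_seqs K v = {s. range s \<subseteq> K \<and> null_seq v s}"

definition completion :: "'c::field set \<Rightarrow> 'c set \<Rightarrow> (nat \<Rightarrow> 'c) set ring"
  where "completion K v = cauchy_ring K v Quot null_seqs K v"

definition completion_emb :: "'c::field set \<Rightarrow> 'c set \<Rightarrow> 'c \<Rightarrow> (nat \<Rightarrow> 'c) set"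
  where "completion_emb K v x = null_seqs K v +>\<^bsub>cauchy_ring K v\<^esub> (\<lambda>i. x)"

text \<open>The valuation ring of the completion consists of the limits of sequences in \<open>v\<close>.\<close>

definition completion_ring :: "'c::field set \<Rightarrow> 'c set \<Rightarrow> (nat \<Rightarrow> 'c) set set"
  where "completion_ring K v = {Y \<in> carrier (completion K v). \<exists>s\<in>Y. range s \<subseteq> v}"


section \<open>Twisted polynomials\<close>

text \<open>
  The polynomial with coefficients \<open>a\<^sub>0, a\<^sub>1, \<dots>\<close> stands for \<open>a\<^sub>0 + a\<^sub>1 \<tau> + \<dots>\<close>, where \<open>\<tau>\<close> is the
  \<open>q\<close>-power map.
\<close>

definition twisted_mult :: "nat \<Rightarrow> 'c::field poly \<Rightarrow> 'c poly \<Rightarrow> 'c poly"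
  where "twisted_mult q P Q =
    (\<Sum>i\<le>degree P. \<Sum>j\<le>degree Q.
       Polynomial.monom (poly.coeff P i * poly.coeff Q j ^ (q ^ i)) (i + j))"

definition twisted_eval :: "nat \<Rightarrow> 'c::field poly \<Rightarrow> 'c \<Rightarrow> 'c"
  where "twisted_eval q P x = (\<Sum>i\<le>degree P. poly.coeff P i * x ^ (q ^ i))"

definition twisted_ring :: "nat \<Rightarrow> 'c::field set \<Rightarrow> 'c poly ring"
  where "twisted_ring q L =
    \<lparr>carrier = {P. range (poly.coeff P) \<subseteq> L}, monoid.mult = twisted_mult q, one = 1, zero = 0,
     add = (+)\<rparr>"

definition left_ideal :: "'a set \<Rightarrow> 'a ring \<Rightarrow> bool"
  where "left_ideal J R \<longleftrightarrow>
    additive_subgroup J R \<and> (\<forall>r\<in>carrier R. \<forall>x\<in>J. r \<otimes>\<^bsub>R\<^esub> x \<in> J)"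

definition gen_left_ideal :: "'a ring \<Rightarrow> 'a set \<Rightarrow> 'a set"
  where "gen_left_ideal R S = \<Inter>{J. left_ideal J R \<and> S \<subseteq> J}"


section \<open>Classes under a not necessarily symmetric relation\<close>

text \<open>
  The existence of an isogeny carrying one datum to another is reflexive and transitive but not
  symmetric (the dual isogeny gives back a multiple of the first datum). Classes are therefore
  those of the equivalence relation it generates.
\<close>

definition equiv_classes :: "'a set \<Rightarrow> ('a \<Rightarrow> 'a \<Rightarrow> bool) \<Rightarrow> 'a set set"
  where "equiv_classes D r =
    D // {(x, y). x \<in> D \<and> y \<in> D \<and> equivclp (\<lambda>a b. a \<in> D \<and> b \<in> D \<and> r a b) x y}"

definition identified_via :: "('a \<Rightarrow> 'b \<Rightarrow> bool) \<Rightarrow> 'a set set \<Rightarrow> 'b set set \<Rightarrow> bool"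
  where "identified_via r \<C> \<D> \<longleftrightarrow>
    (\<exists>f. bij_betw f \<C> \<D> \<and> (\<forall>C\<in>\<C>. \<forall>D\<in>\<D>. f C = D \<longleftrightarrow> (\<exists>x\<in>C. \<exists>y\<in>D. r x y)))"


section \<open>Drinfeld modules\<close>

locale function_field =
  fixes k K Oinf :: "'c::field set"
  assumes finite_constants: "finite k"
    and function_field: "function_field_over k K"
    and infinite_place: "Oinf \<in> places k K"
begin

definition q :: nat
  where "q = card k"

definition finite_places :: "'c set set"
  where "finite_places = places k K - {Oinf}"

definition A :: "'c set"
  where "A = {x \<in> K. \<forall>v\<in>finite_places. x \<in> v}"

text \<open>The degree of \<open>x \<noteq> 0\<close> is the order of its pole at infinity, weighted by the degree of the place.\<close>

definition deg_inf :: "'c \<Rightarrow> int"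
  where "deg_inf x = - (int (place_degree k Oinf) * ord_at Oinf x)"

end

text \<open>
  The ambient field with its absolute value \<open>nrm\<close>. Its subset \<open>Kinf\<close>, the closure of \<open>K\<close>, is the
  completion of \<open>K\<close> at infinity because the ambient field is complete.
\<close>

locale function_field_Cinf = function_field k K Oinf for k K Oinf :: "'c::field set" +
  fixes nrm :: "'c \<Rightarrow> real"
  assumes nrm_nonneg: "nrm x \<ge> 0"
    and nrm_eq_0_iff: "nrm x = 0 \<longleftrightarrow> x = 0"
    and nrm_mult: "nrm (x * y) = nrm x * nrm y"
    and nrm_add: "nrm (x + y) \<le> max (nrm x) (nrm y)"
    and nrm_K: "x \<in> K \<Longrightarrow> x \<noteq> 0 \<Longrightarrow> nrm x = real q powi deg_inf x"
    and complete: "Metric_space.mcomplete UNIV (\<lambda>x y. nrm (x - y))"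
begin

abbreviation topology_inf :: "'c topology"
  where "topology_inf \<equiv> Metric_space.mtopology UNIV (\<lambda>x y. nrm (x - y))"

definition Kinf :: "'c set"
  where "Kinf = Abstract_Topology.closure_of topology_inf K"

end

locale drinfeld_setting = function_field_Cinf k K Oinf nrm
  for k K Oinf :: "'c::field set" and nrm :: "'c \<Rightarrow> real" +
  fixes L :: "'c set"
  assumes dense_algebraic_closure:
      "\<exists>E. algebraic_closure (subring_of E) Kinf \<and> Abstract_Topology.closure_of topology_inf E = UNIV"
    and L_subfield: "subfield L ambient"
    and Kinf_subset_L: "Kinf \<subseteq> L"
    and L_complete: "Metric_space.mcomplete L (\<lambda>x y. nrm (x - y))"
begin

text \<open>As the ambient field is algebraically closed, this is an algebraic closure of \<open>L\<close>.\<close>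

definition Lbar :: "'c set"
  where "Lbar = {x. ring.algebraic ambient L x}"

definition drinfeld_module :: "nat \<Rightarrow> ('c \<Rightarrow> 'c poly) \<Rightarrow> bool"
  where "drinfeld_module n \<Phi> \<longleftrightarrow>
    \<Phi> \<in> extensional A \<and>
    \<Phi> \<in> ring_hom (subring_of A) (twisted_ring q L) \<and>
    (\<forall>c\<in>k. \<Phi> c = [:c:]) \<and>
    (\<exists>a\<in>A. \<Phi> a \<noteq> [:a:]) \<and>
    (\<forall>a\<in>A. poly.coeff (\<Phi> a) 0 = a) \<and>
    (\<forall>a\<in>A. a \<noteq> 0 \<longrightarrow> int (degree (\<Phi> a)) = int n * deg_inf a)"

text \<open>
  The additive group \<open>S\<close>, viewed as a module through \<open>\<Phi>\<close>: for \<open>S = L\<close> and \<open>S = Lbar\<close> these are the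
  modules of \<open>L\<close>-rational and of geometric points.
\<close>

definition points :: "('c \<Rightarrow> 'c poly) \<Rightarrow> 'c set \<Rightarrow> ('c, 'c) module"
  where "points \<Phi> S =
    \<lparr>carrier = S, monoid.mult = undefined, one = undefined, zero = 0, add = (+),
     smult = (\<lambda>a x. twisted_eval q (\<Phi> a) x)\<rparr>"

definition ideal_generator :: "('c \<Rightarrow> 'c poly) \<Rightarrow> 'c set \<Rightarrow> 'c poly"
  where "ideal_generator \<Phi> I =
    (THE P. P \<in> carrier (twisted_ring q L) \<and> Polynomial.lead_coeff P = 1 \<and>
       gen_left_ideal (twisted_ring q L) (\<Phi> ` I) =
         (\<lambda>Q. twisted_mult q Q P) ` carrier (twisted_ring q L))"

definition torsion :: "('c \<Rightarrow> 'c poly) \<Rightarrow> 'c set \<Rightarrow> 'c set"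
  where "torsion \<Phi> I = {x \<in> Lbar. twisted_eval q (ideal_generator \<Phi> I) x = 0}"

definition place_ideal_power :: "'c set \<Rightarrow> nat \<Rightarrow> 'c set"
  where "place_ideal_power v m = ((\<lambda>J. ideal_prod (subring_of A) (max_ideal v \<inter> A) J) ^^ m) A"

definition place_torsion :: "('c \<Rightarrow> 'c poly) \<Rightarrow> 'c set \<Rightarrow> 'c set"
  where "place_torsion \<Phi> v = (\<Union>m. torsion \<Phi> (place_ideal_power v m))"

definition local_quotient :: "'c set \<Rightarrow> ('c, (nat \<Rightarrow> 'c) set set) module"
  where "local_quotient v =
    quotient_module (ring_module (completion_emb K v) (completion K v)) (completion_ring K v)"

definition local_tate_module :: "('c \<Rightarrow> 'c poly) \<Rightarrow> 'c set \<Rightarrow> ((nat \<Rightarrow> 'c) set set \<Rightarrow> 'c) set"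
  where "local_tate_module \<Phi> v =
    module_hom (subring_of A) (local_quotient v) (points \<Phi> (place_torsion \<Phi> v))"

definition tate_module :: "('c \<Rightarrow> 'c poly) \<Rightarrow> ('c set \<Rightarrow> (nat \<Rightarrow> 'c) set set \<Rightarrow> 'c) set"
  where "tate_module \<Phi> = (\<Pi>\<^sub>E v\<in>finite_places. local_tate_module \<Phi> v)"

definition isogeny :: "('c \<Rightarrow> 'c poly) \<Rightarrow> ('c \<Rightarrow> 'c poly) \<Rightarrow> 'c poly \<Rightarrow> bool"
  where "isogeny \<Phi> \<Psi> P \<longleftrightarrow>
    P \<in> carrier (twisted_ring q L) \<and> P \<noteq> 0 \<and>
    (\<forall>a\<in>A. twisted_mult q P (\<Phi> a) = twisted_mult q (\<Psi> a) P)"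

definition tate_map :: "'c poly \<Rightarrow> 'c set \<Rightarrow> ((nat \<Rightarrow> 'c) set set \<Rightarrow> 'c) \<Rightarrow> (nat \<Rightarrow> 'c) set set \<Rightarrow> 'c"
  where "tate_map P v h = (\<lambda>x\<in>carrier (local_quotient v). twisted_eval q P (h x))"


subsection \<open>Pointed Drinfeld modules\<close>

type_synonym 'a pointed_datum =
  "('a \<Rightarrow> 'a poly) \<times> (nat \<Rightarrow> 'a set \<Rightarrow> (nat \<Rightarrow> 'a) set set \<Rightarrow> 'a)"

definition pointed :: "nat \<Rightarrow> 'c pointed_datum set"
  where "pointed n =
    {(\<Phi>, \<zeta>). drinfeld_module n \<Phi> \<and> \<zeta> \<in> {..<n} \<rightarrow>\<^sub>E tate_module \<Phi>}"

text \<open>The data all of whose torsion points (the values of the components of \<open>\<zeta>\<close>) lie in \<open>L\<close>.\<close>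

definition rational_pointed :: "nat \<Rightarrow> 'c pointed_datum set"
  where "rational_pointed n =
    {(\<Phi>, \<zeta>) \<in> pointed n.
       \<forall>i<n. \<forall>v\<in>finite_places. \<forall>x\<in>carrier (local_quotient v). \<zeta> i v x \<in> L}"

definition commensurable :: "nat \<Rightarrow> 'c pointed_datum \<Rightarrow> 'c pointed_datum \<Rightarrow> bool"
  where "commensurable n = (\<lambda>(\<Phi>, \<zeta>) (\<Psi>, \<eta>).
    \<exists>P. isogeny \<Phi> \<Psi> P \<and> (\<forall>i<n. \<forall>v\<in>finite_places. \<eta> i v = tate_map P v (\<zeta> i v)))"


subsection \<open>Degenerate level structures\<close>

type_synonym 'a level_datum = "('a \<Rightarrow> 'a poly) \<times> ((nat \<Rightarrow> 'a set) \<Rightarrow> 'a)"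

definition global_quotient_power :: "nat \<Rightarrow> ('c, nat \<Rightarrow> 'c set) module"
  where "global_quotient_power n =
    power_module n (quotient_module (ring_module (\<lambda>a. a) (subring_of K)) A)"

text \<open>
  The Tate module is built from torsion points over the algebraic closure of \<open>L\<close>. Accordingly
  \<open>S = Lbar\<close> gives the level structures matching all pointed Drinfeld modules, and \<open>S = L\<close> those
  matching the pointed Drinfeld modules with \<open>L\<close>-rational torsion points.
\<close>

definition level_data :: "nat \<Rightarrow> 'c set \<Rightarrow> 'c level_datum set"
  where "level_data n S =
    {(\<Phi>, \<rho>). drinfeld_module n \<Phi> \<and>
       \<rho> \<in> module_hom (subring_of A) (global_quotient_power n) (points \<Phi> S)}"

definition level_isogenous :: "nat \<Rightarrow> 'c level_datum \<Rightarrow> 'c level_datum \<Rightarrow> bool"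
  where "level_isogenous n = (\<lambda>(\<Phi>, \<rho>) (\<Psi>, \<sigma>).
    \<exists>P. isogeny \<Phi> \<Psi> P \<and>
      (\<forall>x\<in>carrier (global_quotient_power n). \<sigma> x = twisted_eval q P (\<rho> x)))"


subsection \<open>The correspondence\<close>

definition ideal_quotient_power :: "nat \<Rightarrow> 'c set \<Rightarrow> (nat \<Rightarrow> 'c set) set"
  where "ideal_quotient_power n I =
    {..<n} \<rightarrow>\<^sub>E a_rcosets\<^bsub>subring_of {x \<in> K. \<forall>a\<in>I. x * a \<in> A}\<^esub> A"

definition localize :: "'c set \<Rightarrow> 'c set \<Rightarrow> (nat \<Rightarrow> 'c) set set"
  where "localize v Y =
    (\<Union>x\<in>Y. completion_ring K v +>\<^bsub>completion K v\<^esub> completion_emb K v x)"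

text \<open>
  Let \<open>\<zeta>\<close> be the \<open>R\<close>-linear map from \<open>R\<^sup>n\<close> to the Tate module sending the \<open>i\<close>-th basis vector to
  \<open>\<zeta> i\<close>. Since \<open>K / A\<close> is the direct sum of the \<open>K\<^sub>v / A\<^sub>v\<close>, tensoring with \<open>I\<^sup>-\<^sup>1 A / A\<close> and evaluating
  the homomorphisms \<open>\<zeta> i v\<close> yields the map below. The sum over the places is finite, as an
  element of \<open>K\<close> has only finitely many poles.
\<close>

definition level_of :: "nat \<Rightarrow> (nat \<Rightarrow> 'c set \<Rightarrow> (nat \<Rightarrow> 'c) set set \<Rightarrow> 'c) \<Rightarrow>
    'c set \<Rightarrow> (nat \<Rightarrow> 'c set) \<Rightarrow> 'c"
  where "level_of n \<zeta> I = (\<lambda>x\<in>ideal_quotient_power n I.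
    \<Sum>i<n. \<Sum>v\<in>{v \<in> finite_places. localize v (x i) \<noteq> completion_ring K v}.
      \<zeta> i v (localize v (x i)))"

definition corresponds :: "nat \<Rightarrow> 'c pointed_datum \<Rightarrow> 'c level_datum \<Rightarrow> bool"
  where "corresponds n = (\<lambda>(\<Phi>, \<zeta>) (\<Psi>, \<rho>).
    \<Phi> = \<Psi> \<and>
    (\<forall>I. ideal I (subring_of A) \<and> I \<noteq> {0} \<longrightarrow>
       restrict \<rho> (ideal_quotient_power n I) = level_of n \<zeta> I))"

end

end

theory Submission
  imports Defs
begin

text \<open>
  The partial fraction decomposition \<open>K / A = \<Oplus>\<^sub>v K\<^sub>v / A\<^sub>v\<close> turns a tuple of elements
  of the Tate module into a single homomorphism from \<open>(K / A)\<^sup>n\<close> and back. Isogenies act by additive polynomials, hence commute with this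
  bijection, which therefore passes to classes.

  The decomposition needs that the finite places are discrete, that an element of \<open>K\<close> has finitely many
  poles, and strong approximation. All this rests on one counting argument: as \<open>K\<close> is finite over
  \<open>k(x)\<close> and \<open>k\<close> is finite, the quotient \<open>R / a R\<close> is finite for every subring \<open>R\<close> of \<open>K\<close> and nonzero \<open>a\<close> in \<open>R\<close>.
  A Drinfeld module provides a nonconstant element of \<open>A\<close>, so \<open>A\<close> has fraction field \<open>K\<close>, and the usual
  argument shows that the localisations of \<open>A\<close> at its nonzero primes are valuation rings.
\<close>

section \<open>Subrings and subfields of the ambient field\<close>

text \<open>Places are given as bare valuation rings and \<open>A\<close> as an intersection of
  them, so neither discreteness nor the Dedekind property comes with the definitions; both are
  extracted from the finiteness of quotients. The counting has a second use: applied to expansions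
  in a \<open>t\<close> transcendental over \<open>k\<close>, a collision yields an algebraic
  equation over \<open>A\<close> for any element of \<open>K\<close>. Two facts make the two kinds
  of data match exactly. \<open>K / A\<close> is a torsion module, so a homomorphism from it to
  points algebraic over \<open>L\<close> has torsion values, and the condition built into the Tate
  module is automatic. And every class at a finite place \<open>v\<close> has a representative in
  \<open>K\<close> regular at all other finite places; evaluating there isolates a single
  homomorphism \<open>\<zeta> i v\<close>. Hence one and the same \<open>P\<close> witnesses both
  relations on data, before the generated equivalences are formed. The set \<open>S\<close> of
  admissible values stays a parameter, which makes the geometric and the rational statement two
  instances of one.\<close>

lemma ambient_simps [simp]:
  "carrier ambient = UNIV" "x \<otimes>\<^bsub>ambient\<^esub> y = x * y" "\<one>\<^bsub>ambient\<^esub> = 1"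
  "\<zero>\<^bsub>ambient\<^esub> = 0" "x \<oplus>\<^bsub>ambient\<^esub> y = x + y"
  by (simp_all add: ring_of_type_algebra_def)

lemma field_ambient: "field (ambient :: 'c::field ring)"
  by (rule field_from_type_algebra)

lemma ring_ambient: "ring (ambient :: 'c::field ring)"
  by (rule ring_from_type_algebra)

lemma a_inv_ambient [simp]: "\<ominus>\<^bsub>ambient\<^esub> x = - (x :: 'c::field)"
proof -
  interpret ring "ambient :: 'c ring" by (rule ring_ambient)
  show ?thesis by (rule minus_equality) auto
qed

lemma m_inv_ambient: "x \<noteq> 0 \<Longrightarrow> inv\<^bsub>ambient\<^esub> x = inverse (x :: 'c::field)"
proof -
  interpret field "ambient :: 'c ring" by (rule field_ambient)
  show "x \<noteq> 0 \<Longrightarrow> ?thesis" by (rule comm_inv_char) auto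
qed

lemma subring_closed:
  assumes "subring S (ambient :: 'c::field ring)"
  shows "0 \<in> S" "1 \<in> S" "x \<in> S \<Longrightarrow> y \<in> S \<Longrightarrow> x + y \<in> S" "x \<in> S \<Longrightarrow> - x \<in> S"
    "x \<in> S \<Longrightarrow> y \<in> S \<Longrightarrow> x - y \<in> S" "x \<in> S \<Longrightarrow> y \<in> S \<Longrightarrow> x * y \<in> S" "x \<in> S \<Longrightarrow> x ^ i \<in> S"
proof -
  have 1: "0 \<in> S" "1 \<in> S" "\<And>x y. x \<in> S \<Longrightarrow> y \<in> S \<Longrightarrow> x + y \<in> S" "\<And>x. x \<in> S \<Longrightarrow> - x \<in> S"
    "\<And>x y. x \<in> S \<Longrightarrow> y \<in> S \<Longrightarrow> x * y \<in> S"
    using subringE(2,3,5,6,7)[OF assms] by auto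
  then show "0 \<in> S" "1 \<in> S" "x \<in> S \<Longrightarrow> y \<in> S \<Longrightarrow> x + y \<in> S" "x \<in> S \<Longrightarrow> - x \<in> S"
    "x \<in> S \<Longrightarrow> y \<in> S \<Longrightarrow> x * y \<in> S" by auto
  show "x \<in> S \<Longrightarrow> y \<in> S \<Longrightarrow> x - y \<in> S" using 1(3)[of x "- y"] 1(4)[of y] by simp
  show "x \<in> S \<Longrightarrow> x ^ i \<in> S" using 1 by (induction i) auto
qed

lemma subring_sum:
  assumes "subring S (ambient :: 'c::field ring)" "\<And>i. i \<in> I \<Longrightarrow> f i \<in> S"
  shows "sum f I \<in> S"
  using assms(2) by (induction I rule: infinite_finite_induct) (auto simp: subring_closed[OF assms(1)])

lemma subring_prod:
  assumes "subring S (ambient :: 'c::field ring)" "\<And>i. i \<in> I \<Longrightarrow> f i \<in> S"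
  shows "prod f I \<in> S"
  using assms(2) by (induction I rule: infinite_finite_induct) (auto simp: subring_closed[OF assms(1)])

lemma subring_ambientI:
  assumes "1 \<in> S" "\<And>x y. x \<in> S \<Longrightarrow> y \<in> S \<Longrightarrow> x - y \<in> S" "\<And>x y. x \<in> S \<Longrightarrow> y \<in> S \<Longrightarrow> x * y \<in> S"
  shows "subring S (ambient :: 'c::field ring)"
proof -
  interpret ring "ambient :: 'c ring" by (rule ring_ambient)
  have 0: "0 \<in> S" using assms(2)[OF assms(1) assms(1)] by simp
  have m: "- x \<in> S" if "x \<in> S" for x using assms(2)[OF 0 that] by simp
  show ?thesis
  proof (rule subringI)
    show "x \<oplus>\<^bsub>ambient\<^esub> y \<in> S" if "x \<in> S" "y \<in> S" for x y
      using assms(2)[OF that(1) m[OF that(2)]] by simp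
  qed (use assms m in auto)
qed

lemma subfield_closed:
  assumes "subfield S (ambient :: 'c::field ring)"
  shows "subring S ambient" "x \<in> S \<Longrightarrow> inverse x \<in> S" "x \<in> S \<Longrightarrow> y \<in> S \<Longrightarrow> x / y \<in> S"
proof -
  interpret ring "ambient :: 'c ring" by (rule ring_ambient)
  show sr: "subring S ambient" by (rule subfieldE(1)[OF assms])
  have i: "inverse x \<in> S" if "x \<in> S" for x
  proof (cases "x = 0")
    case True
    then show ?thesis using that by simp
  next
    case False
    then show ?thesis using subfield_m_inv(1)[OF assms, of x] that m_inv_ambient[of x] by auto
  qed
  show "x \<in> S \<Longrightarrow> inverse x \<in> S" by (rule i)
  show "x \<in> S \<Longrightarrow> y \<in> S \<Longrightarrow> x / y \<in> S"
    using subring_closed(6)[OF sr, of x "inverse y"] i[of y] by (simp add: divide_inverse)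
qed


section \<open>Polynomials over the constant field\<close>

definition polys_over :: "'c::field set \<Rightarrow> 'c poly set"
  where "polys_over k = {f. range (poly.coeff f) \<subseteq> k}"

lemma polys_over_iff: "f \<in> polys_over k \<longleftrightarrow> (\<forall>i. poly.coeff f i \<in> k)"
  by (auto simp: polys_over_def)

lemma polys_over_closed:
  assumes "subring k (ambient :: 'c::field ring)"
  shows "0 \<in> polys_over k" "1 \<in> polys_over k" "f \<in> polys_over k \<Longrightarrow> - f \<in> polys_over k"
    "f \<in> polys_over k \<Longrightarrow> g \<in> polys_over k \<Longrightarrow> f + g \<in> polys_over k"
    "f \<in> polys_over k \<Longrightarrow> g \<in> polys_over k \<Longrightarrow> f * g \<in> polys_over k"
    "c \<in> k \<Longrightarrow> Polynomial.monom c i \<in> polys_over k"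
  using subring_closed[OF assms]
  by (auto simp: polys_over_iff coeff_mult coeff_pCons split: nat.split intro!: subring_sum[OF assms])

lemma poly_in_subring:
  assumes "subring S (ambient :: 'c::field ring)" "f \<in> polys_over S" "x \<in> S"
  shows "poly f x \<in> S"
  using assms(2,3) by (auto simp: poly_altdef polys_over_iff subring_closed[OF assms(1)] intro!: subring_sum[OF assms(1)])

lemma polys_over_mono: "k \<subseteq> S \<Longrightarrow> f \<in> polys_over k \<Longrightarrow> f \<in> polys_over S"
  by (auto simp: polys_over_iff)

text \<open>The list representation puts the leading coefficient first, \<open>Poly\<close> the
  constant one; hence \<open>rev\<close>.\<close>

lemma eval_ambient:
  "ring.eval (ambient :: 'c::field ring) p x = poly (Poly (rev p)) x"
proof -
  interpret ring "ambient :: 'c ring" by (rule ring_ambient)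
  have pow: "x [^]\<^bsub>ambient\<^esub> i = x ^ i" for i :: nat
    by (induction i) (auto simp: nat_pow_def)
  show ?thesis
    by (induction p) (auto simp: Poly_append poly_monom pow)
qed

text \<open>Induction over the generation of the field: fractions with denominators not vanishing at
  \<open>x\<close> are stable under each generating operation. This makes denominators available for
  clearing.\<close>

lemma generate_field_fraction:
  assumes k: "subring k (ambient :: 'c::field ring)"
    and "y \<in> generate_field ambient (insert x k)"
  shows "\<exists>f\<in>polys_over k. \<exists>g\<in>polys_over k. poly g x \<noteq> 0 \<and> y = poly f x / poly g x"
  using assms(2)
proof (induction y rule: generate_field.induct)
  case one
  then show ?case by (intro bexI[of _ 1]) (auto simp: polys_over_closed[OF k])
next
  case (incl h)
  have "poly.coeff [:0, 1:] i \<in> k" for i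
    by (auto simp: coeff_pCons subring_closed[OF k] split: nat.split)
  then have "[:0, 1:] \<in> polys_over k" "c \<in> k \<Longrightarrow> [:c:] \<in> polys_over k" for c
    using polys_over_closed(6)[OF k, of c 0] by (auto simp: polys_over_iff monom_0)
  with incl show ?case
    apply (elim insertE)
     apply (rule bexI[of _ "[:0, 1:]"], rule bexI[of _ 1])
       apply (auto simp: polys_over_closed[OF k])[3]
    apply (rule bexI[of _ "[:h:]"], rule bexI[of _ 1])
      apply (auto simp: polys_over_closed[OF k])[3]
    done
next
  case (a_inv h)
  then obtain f g where "f \<in> polys_over k" "g \<in> polys_over k" "poly g x \<noteq> 0" "h = poly f x / poly g x"
    by blast
  then show ?case
    by (intro bexI[of _ "- f"] bexI[of _ g]) (auto simp: polys_over_closed[OF k])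
next
  case (m_inv h)
  then obtain f g where "f \<in> polys_over k" "g \<in> polys_over k" "poly g x \<noteq> 0" "h = poly f x / poly g x"
    by blast
  with m_inv(2) show ?case
    by (intro bexI[of _ g] bexI[of _ f]) (auto simp: m_inv_ambient)
next
  case (eng_add h1 h2)
  then obtain f g f' g' where "f \<in> polys_over k" "g \<in> polys_over k" "poly g x \<noteq> 0" "h1 = poly f x / poly g x"
    "f' \<in> polys_over k" "g' \<in> polys_over k" "poly g' x \<noteq> 0" "h2 = poly f' x / poly g' x"
    by blast
  then show ?case
    by (intro bexI[of _ "f * g' + f' * g"] bexI[of _ "g * g'"])
       (auto simp: polys_over_closed[OF k] add_frac_eq)
next
  case (eng_mult h1 h2)
  then obtain f g f' g' where "f \<in> polys_over k" "g \<in> polys_over k" "poly g x \<noteq> 0" "h1 = poly f x / poly g x"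
    "f' \<in> polys_over k" "g' \<in> polys_over k" "poly g' x \<noteq> 0" "h2 = poly f' x / poly g' x"
    by blast
  then show ?case
    by (intro bexI[of _ "f * f'"] bexI[of _ "g * g'"]) (auto simp: polys_over_closed[OF k])
qed


section \<open>Finiteness of quotients\<close>

text \<open>
  The cardinality of \<open>poly_span k x us d\<close> grows like \<open>q\<^bsup>d |us|\<^esup>\<close>, which bounds the size of every
  quotient \<open>R / a R\<close>: the \<open>a\<close>-adic expansions of length \<open>M\<close> would otherwise be too numerous.
\<close>

fun poly_span :: "'c::field set \<Rightarrow> 'c \<Rightarrow> 'c list \<Rightarrow> nat \<Rightarrow> 'c set" where
  "poly_span k x [] d = {0}"
| "poly_span k x (u # us) d =
    (\<lambda>(f, v). poly f x * u + v) ` ({f \<in> polys_over k. degree f \<le> d} \<times> poly_span k x us d)"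

lemma poly_span_add:
  assumes "subring k (ambient :: 'c::field ring)"
  shows "v \<in> poly_span k x us d \<Longrightarrow> w \<in> poly_span k x us d \<Longrightarrow> v + w \<in> poly_span k x us d"
proof (induction us arbitrary: v w)
  case (Cons u us)
  then obtain f v' g w' where
    "f \<in> polys_over k" "degree f \<le> d" "v' \<in> poly_span k x us d" "v = poly f x * u + v'"
    "g \<in> polys_over k" "degree g \<le> d" "w' \<in> poly_span k x us d" "w = poly g x * u + w'"
    by auto
  with Cons.IH[of v' w'] show ?case
    by (auto intro!: image_eqI[of _ _ "(f + g, v' + w')"] polys_over_closed[OF assms] degree_add_le
        simp: algebra_simps)
qed auto

lemma poly_span_mult:
  assumes "subring k (ambient :: 'c::field ring)" "g \<in> polys_over k" "degree g \<le> e"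
  shows "v \<in> poly_span k x us d \<Longrightarrow> poly g x * v \<in> poly_span k x us (d + e)"
proof (induction us arbitrary: v)
  case (Cons u us)
  then obtain f v' where
    "f \<in> polys_over k" "degree f \<le> d" "v' \<in> poly_span k x us d" "v = poly f x * u + v'"
    by auto
  with Cons.IH[of v'] degree_mult_le[of g f] assms show ?case
    by (auto intro!: image_eqI[of _ _ "(g * f, poly g x * v')"] polys_over_closed[OF assms(1)]
        simp: algebra_simps)
qed auto

lemma poly_span_mono:
  assumes "subring k (ambient :: 'c::field ring)" "d \<le> d'"
  shows "poly_span k x us d \<subseteq> poly_span k x us d'"
  \<comment> \<open>Multiplication by \<open>1\<close>, regarded as a polynomial of degree at most
    \<open>d' - d\<close>, raises the bound.\<close>
  using poly_span_mult[OF assms(1) polys_over_closed(2)[OF assms(1)], of "d' - d" _ x us d] assms(2)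
  by auto

lemma poly_span_zero:
  assumes "subring k (ambient :: 'c::field ring)"
  shows "0 \<in> poly_span k x us d"
  using polys_over_closed(1)[OF assms] by (induction us) (force intro: image_eqI[of _ _ "(0, 0)"])+

text \<open>Such a polynomial comes from a list of \<open>d + 1\<close> coefficients, which accounts
  for the exponent.\<close>

lemma finite_bounded_polys:
  assumes "finite k"
  shows "finite {f \<in> polys_over k. degree f \<le> d}"
    "card {f \<in> polys_over k. degree f \<le> d} \<le> card k ^ (d + 1)"
proof -
  let ?W = "{w. set w \<subseteq> k \<and> length w = d + 1}"
  have sub: "{f \<in> polys_over k. degree f \<le> d} \<subseteq> Poly ` ?W"
  proof
    fix f assume f: "f \<in> {f \<in> polys_over k. degree f \<le> d}"
    have "f = Poly (map (poly.coeff f) [0..<d + 1])"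
      using f by (intro poly_eqI) (auto simp: coeff_Poly_eq nth_default_def coeff_eq_0 simp del: upt_Suc)
    with f show "f \<in> Poly ` ?W"
      by (intro image_eqI[of _ _ "map (poly.coeff f) [0..<d + 1]"]) (auto simp: polys_over_iff)
  qed
  have fin: "finite ?W" by (rule finite_lists_length_eq[OF assms])
  show "finite {f \<in> polys_over k. degree f \<le> d}"
    by (rule finite_subset[OF sub]) (use fin in auto)
  have "card {f \<in> polys_over k. degree f \<le> d} \<le> card (Poly ` ?W)"
    by (rule card_mono[OF _ sub]) (use fin in auto)
  also have "\<dots> \<le> card ?W" by (rule card_image_le[OF fin])
  also have "\<dots> = card k ^ (d + 1)" by (rule card_lists_length_eq[OF assms])
  finally show "card {f \<in> polys_over k. degree f \<le> d} \<le> card k ^ (d + 1)" .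
qed

lemma card_poly_span:
  assumes "finite k"
  shows "finite (poly_span k x us d) \<and> card (poly_span k x us d) \<le> card k ^ (length us * (d + 1))"
proof (induction us)
  case (Cons u us)
  let ?P = "{f \<in> polys_over k. degree f \<le> d} \<times> poly_span k x us d"
  have fin: "finite ?P" using Cons finite_bounded_polys(1)[OF assms] by auto
  have "card (poly_span k x (u # us) d) \<le> card ?P"
    unfolding poly_span.simps by (rule card_image_le[OF fin])
  also have "\<dots> \<le> card k ^ (d + 1) * card k ^ (length us * (d + 1))"
    unfolding card_cartesian_product using Cons finite_bounded_polys(2)[OF assms] by (intro mult_mono) auto
  finally show ?case using fin by (simp add: power_add algebra_simps)
qed auto

text \<open>Common denominators, by induction on the spanning list: if \<open>g\<close> clears the
  coefficient of \<open>u\<close> and \<open>D\<close> clears the rest, then \<open>g * D\<close>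
  clears both.\<close>

lemma poly_span_Span:
  assumes k: "subring k (ambient :: 'c::field ring)"
    and "y \<in> ring.Span ambient (generate_field ambient (insert x k)) us"
  shows "\<exists>D\<in>polys_over k. poly D x \<noteq> 0 \<and> (\<exists>d. poly D x * y \<in> poly_span k x us d)"
proof -
  interpret ring "ambient :: 'c ring" by (rule ring_ambient)
  show ?thesis using assms(2)
  proof (induction us arbitrary: y)
    case Nil
    then show ?case by (intro bexI[of _ 1]) (auto simp: polys_over_closed[OF k])
  next
    case (Cons u us)
    then obtain c e where c: "c \<in> generate_field ambient (insert x k)"
      and e: "e \<in> Span (generate_field ambient (insert x k)) us" and y: "y = c * u + e"
      by (auto simp: line_extension_mem_iff)
    obtain f g where fg: "f \<in> polys_over k" "g \<in> polys_over k" "poly g x \<noteq> 0" "c = poly f x / poly g x"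
      using generate_field_fraction[OF k c] by blast
    obtain D d where D: "D \<in> polys_over k" "poly D x \<noteq> 0" "poly D x * e \<in> poly_span k x us d"
      using Cons.IH[OF e] by blast
    define d' where "d' = degree (f * D) + (d + degree g)"
    have 1: "poly g x * (poly D x * e) \<in> poly_span k x us d'"
      using poly_span_mult[OF k fg(2) order_refl D(3)] poly_span_mono[OF k, of "d + degree g" d' x us]
      unfolding d'_def by auto
    have "poly (g * D) x * y = poly (f * D) x * u + poly g x * (poly D x * e)"
      using fg(3) by (simp add: y fg(4) field_simps)
    then have "poly (g * D) x * y \<in> poly_span k x (u # us) d'"
      using 1 fg D by (auto intro!: image_eqI[of _ _ "(f * D, poly g x * (poly D x * e))"]
          polys_over_closed[OF k] simp: d'_def)
    then show ?case
      using fg(2,3) D(1,2)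
      by (intro bexI[of _ "g * D"] conjI exI[of _ d']) (simp_all add: polys_over_closed[OF k] del: poly_span.simps)
  qed
qed


section \<open>Counting in the function field\<close>

context function_field
begin

lemma k_subfield: "subfield k ambient" and K_subfield: "subfield K ambient" and k_subset_K: "k \<subseteq> K"
  and algebraic_imp_k: "x \<in> K \<Longrightarrow> ring.algebraic ambient k x \<Longrightarrow> x \<in> k"
  using function_field by (auto simp: function_field_over_def)

lemmas k_subring = subfield_closed(1)[OF k_subfield]
lemmas K_subring = subfield_closed(1)[OF K_subfield]
lemmas K_closed = subring_closed[OF K_subring] subfield_closed(2,3)[OF K_subfield]

lemma q_ge_2: "q \<ge> 2"
proof -
  have "{0, 1} \<subseteq> k" using subring_closed[OF k_subring] by auto
  then have "card {0, 1 :: 'c} \<le> card k" using finite_constants by (intro card_mono)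
  then show ?thesis by (simp add: q_def)
qed

text \<open>Here \<open>K\<close> is finite over \<open>k(x)\<close> with base \<open>us\<close>.
  All later counting takes place in these coordinates.\<close>

lemma K_spanned:
  "\<exists>x us. x \<in> K \<and> set us \<subseteq> K \<and>
     (\<forall>y\<in>K. \<exists>D\<in>polys_over k. poly D x \<noteq> 0 \<and> (\<exists>d. poly D x * y \<in> poly_span k x us d))"
proof -
  interpret field "ambient :: 'c ring" by (rule field_ambient)
  obtain x where x: "x \<in> K" "finite_dimension (generate_field ambient (insert x k)) K"
    using function_field by (auto simp: function_field_over_def)
  have sf: "subfield (generate_field ambient (insert x k)) ambient"
    by (rule generate_field_is_subfield) auto
  obtain us where us: "set us \<subseteq> carrier ambient" "Span (generate_field ambient (insert x k)) us = K"
    using exists_base[OF sf finite_dimensionE[OF sf x(2)]] by blast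
  have "set us \<subseteq> K" using Span_base_incl[OF sf us(1)] us(2) by simp
  then show ?thesis using x(1) poly_span_Span[OF k_subring] us(2) by metis
qed

text \<open>Pigeonhole on words of length \<open>M\<close>. Up to a fixed denominator,
  multiplication by \<open>a\<close> raises the degree bound by a constant \<open>C\<close>, so the
  Horner sums of these words, after clearing denominators, lie in a set of at most
  \<open>B * Q ^ M\<close> elements, against \<open>card I ^ M\<close> words. Only \<open>a\<close>
  determines \<open>Q\<close>; the values \<open>y\<close> affect merely \<open>B\<close>, which a
  large \<open>M\<close> outweighs. Indices are lists so that they can also serve as coefficient
  lists of polynomials.\<close>

lemma horner_collision:
  assumes a: "a \<in> K"
  shows "\<exists>Q. \<forall>(I :: 'c list set) y. finite I \<and> y ` I \<subseteq> K \<and> card I > Q \<longrightarrow>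
    (\<exists>w w'. w \<noteq> w' \<and> length w = length w' \<and> set w \<subseteq> I \<and> set w' \<subseteq> I \<and>
       horner_sum y a w = horner_sum y a w')"
proof -
  obtain x us where x: "x \<in> K" and us: "set us \<subseteq> K" and span:
    "\<And>y. y \<in> K \<Longrightarrow> \<exists>D\<in>polys_over k. poly D x \<noteq> 0 \<and> (\<exists>d. poly D x * y \<in> poly_span k x us d)"
    using K_spanned by blast
  let ?V = "poly_span k x us"
  \<comment> \<open>One \<open>D\<close> serves every degree bound because only the finitely many
    products of \<open>a\<close> with base elements need clearing.\<close>
  have "\<exists>D\<in>polys_over k. poly D x \<noteq> 0 \<and> (\<exists>C. \<forall>d. \<forall>v\<in>poly_span k x us' d. poly D x * (a * v) \<in> ?V (d + C))"
    if "set us' \<subseteq> K" for us'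
    using that
  proof (induction us')
    case Nil
    then show ?case by (intro bexI[of _ 1]) (auto simp: polys_over_closed[OF k_subring] poly_span_zero[OF k_subring])
  next
    case (Cons u us')
    obtain D C where D: "D \<in> polys_over k" "poly D x \<noteq> 0"
      "\<And>d v. v \<in> poly_span k x us' d \<Longrightarrow> poly D x * (a * v) \<in> ?V (d + C)"
      using Cons.IH Cons.prems by (metis insert_subset list.simps(15))
    obtain D' C' where D': "D' \<in> polys_over k" "poly D' x \<noteq> 0" "poly D' x * (a * u) \<in> ?V C'"
      using span[of "a * u"] Cons.prems a by (auto simp: K_closed)
    define E where "E = C + C' + degree D + degree D'"
    have "poly (D * D') x * (a * v) \<in> ?V (d + E)" if v: "v \<in> poly_span k x (u # us') d" for d v
    proof -
      obtain f v' where f: "f \<in> polys_over k" "degree f \<le> d" and v': "v' \<in> poly_span k x us' d"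
        and veq: "v = poly f x * u + v'" using v by auto
      have "poly (f * D) x * (poly D' x * (a * u)) \<in> ?V (C' + (d + degree D))"
        by (rule poly_span_mult[OF k_subring _ _ D'(3)])
          (use f D in \<open>auto intro!: polys_over_closed[OF k_subring] order.trans[OF degree_mult_le]\<close>)
      then have 1: "poly (f * D) x * (poly D' x * (a * u)) \<in> ?V (d + E)"
        using poly_span_mono[OF k_subring, of "C' + (d + degree D)" "d + E" x us] by (auto simp: E_def)
      have "poly D' x * (poly D x * (a * v')) \<in> ?V (d + C + degree D')"
        by (rule poly_span_mult[OF k_subring D'(1) order_refl D(3)[OF v']])
      then have 2: "poly D' x * (poly D x * (a * v')) \<in> ?V (d + E)"
        using poly_span_mono[OF k_subring, of "d + C + degree D'" "d + E" x us] by (auto simp: E_def)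
      have "poly (D * D') x * (a * v) = poly (f * D) x * (poly D' x * (a * u)) + poly D' x * (poly D x * (a * v'))"
        by (simp add: veq algebra_simps)
      then show ?thesis using poly_span_add[OF k_subring 1 2] by simp
    qed
    then show ?case using D D' by (intro bexI[of _ "D * D'"]) (auto intro!: polys_over_closed[OF k_subring])
  qed
  from this[OF us] obtain D C0 where D: "D \<in> polys_over k" "poly D x \<noteq> 0"
    "\<And>d v. v \<in> ?V d \<Longrightarrow> poly D x * (a * v) \<in> ?V (d + C0)"
    by blast
  \<comment> \<open>Enlarged so that multiplication by \<open>D\<close> alone also costs at most
    \<open>C\<close>; terms without the factor \<open>a\<close> must keep pace.\<close>
  define C where "C = C0 + degree D"
  have Da: "poly D x * (a * v) \<in> ?V (d + C)" if "v \<in> ?V d" for d v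
    using D(3)[OF that] poly_span_mono[OF k_subring, of "d + C0" "d + C" x us] by (auto simp: C_def)
  have Dv: "poly D x * v \<in> ?V (d + C)" if "v \<in> ?V d" for d v
    using poly_span_mult[OF k_subring D(1) order_refl that] poly_span_mono[OF k_subring, of "d + degree D" "d + C" x us]
    by (auto simp: C_def)
  \<comment> \<open>The factor by which the bound of \<open>card_poly_span\<close> grows when the
    degree bound rises by \<open>C\<close>.\<close>
  define Q where "Q = q ^ (length us * C)"
  have Q: "Q \<ge> 1" using q_ge_2 by (simp add: Q_def)
  show ?thesis
  proof (intro exI[of _ Q] allI impI)
    fix I :: "'c list set" and y assume H: "finite I \<and> y ` I \<subseteq> K \<and> Q < card I"
    \<comment> \<open>A common denominator and degree bound for the finitely many digits.\<close>
    have "\<exists>E\<in>polys_over k. poly E x \<noteq> 0 \<and> (\<exists>C. \<forall>i\<in>I. poly E x * y i \<in> ?V C)"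
      using H[THEN conjunct1] H[THEN conjunct2, THEN conjunct1]
    proof (induction I rule: finite_induct)
      case empty
      then show ?case by (intro bexI[of _ 1]) (auto simp: polys_over_closed[OF k_subring])
    next
      case (insert i I)
      obtain E C where E: "E \<in> polys_over k" "poly E x \<noteq> 0" "\<And>i. i \<in> I \<Longrightarrow> poly E x * y i \<in> ?V C"
        using insert by auto
      obtain E' C' where E': "E' \<in> polys_over k" "poly E' x \<noteq> 0" "poly E' x * y i \<in> ?V C'"
        using span[of "y i"] insert.prems by auto
      define B where "B = C + C' + degree E + degree E'"
      have "poly (E * E') x * y j \<in> ?V B" if "j \<in> insert i I" for j
      proof (cases "j = i")
        case True
        have "poly E x * (poly E' x * y i) \<in> ?V (C' + degree E)"
          by (rule poly_span_mult[OF k_subring E(1) order_refl E'(3)])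
        then show ?thesis using True poly_span_mono[OF k_subring, of "C' + degree E" B x us]
          by (auto simp: B_def mult.assoc)
      next
        case False
        have "poly E' x * (poly E x * y j) \<in> ?V (C + degree E')"
          by (rule poly_span_mult[OF k_subring E'(1) order_refl E(3)]) (use that False in auto)
        then show ?thesis using poly_span_mono[OF k_subring, of "C + degree E'" B x us]
          by (auto simp: B_def algebra_simps)
      qed
      then show ?case using E E' by (intro bexI[of _ "E * E'"]) (auto intro!: polys_over_closed[OF k_subring])
    qed
    then obtain E C' where E: "poly E x \<noteq> 0" "\<And>i. i \<in> I \<Longrightarrow> poly E x * y i \<in> ?V C'" by blast
    \<comment> \<open>Each Horner step uses up one factor \<open>poly D x\<close> and raises the
      bound by \<open>C\<close>.\<close>
    have sums: "poly D x ^ length w * (poly E x * horner_sum y a w) \<in> ?V (C' + length w * C)"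
      if "set w \<subseteq> I" for w
      using that
    proof (induction w)
      case Nil
      then show ?case by (simp add: poly_span_zero[OF k_subring])
    next
      case (Cons i w)
      let ?M = "length w"
      have "poly D x ^ n * (poly E x * y i) \<in> ?V (C' + n * C)" for n
      proof (induction n)
        case 0
        then show ?case using E(2) Cons.prems by simp
      next
        case (Suc n)
        from Dv[OF this] show ?case by (simp add: algebra_simps)
      qed
      from this[of "Suc ?M"] have 1: "poly D x ^ Suc ?M * (poly E x * y i) \<in> ?V (C' + Suc ?M * C)" .
      from Cons Da[of "poly D x ^ ?M * (poly E x * horner_sum y a w)" "C' + ?M * C"]
      have 2: "poly D x * (a * (poly D x ^ ?M * (poly E x * horner_sum y a w))) \<in> ?V (C' + Suc ?M * C)"
        by (simp add: algebra_simps)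
      from poly_span_add[OF k_subring 1 2] show ?case by (simp add: algebra_simps)
    qed
    define B where "B = q ^ (length us * (C' + 1))"
    \<comment> \<open>Exists because the ratio \<open>card I / Q\<close> exceeds 1.\<close>
    obtain M where M: "real B < (real (card I) / real Q) ^ M"
      using real_arch_pow[of "real (card I) / real Q" "real B"] H Q by (auto simp: field_simps)
    have "real B * real Q ^ M < real (card I) ^ M"
      using M Q by (simp add: power_divide field_simps)
    then have M: "B * Q ^ M < card I ^ M" by (metis of_nat_less_iff of_nat_mult of_nat_power)
    let ?W = "{w. set w \<subseteq> I \<and> length w = M}"
    let ?h = "\<lambda>w. poly D x ^ M * (poly E x * horner_sum y a w)"
    have "card (?h ` ?W) \<le> card (?V (C' + M * C))"
      using sums card_poly_span[OF finite_constants] by (intro card_mono) auto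
    also have "\<dots> \<le> q ^ (length us * (C' + M * C + 1))"
      using card_poly_span[OF finite_constants] by (simp add: q_def)
    also have "\<dots> = B * Q ^ M"
      by (simp add: B_def Q_def power_add power_mult[symmetric] algebra_simps)
    also have "\<dots> < card ?W" using M H by (simp add: card_lists_length_eq)
    finally have "\<not> inj_on ?h ?W" using card_image by fastforce
    then obtain w w' where "w \<in> ?W" "w' \<in> ?W" "?h w = ?h w'" "w \<noteq> w'"
      unfolding inj_on_def by blast
    then show "\<exists>w w'. w \<noteq> w' \<and> length w = length w' \<and> set w \<subseteq> I \<and> set w' \<subseteq> I \<and>
       horner_sum y a w = horner_sum y a w'"
      by (intro exI[of _ w] exI[of _ w']) (use D(2) E(1) in auto)
  qed
qed

text \<open>With digits pairwise incongruent modulo \<open>a R\<close>, expansions in powers of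
  \<open>a\<close> are unique, so more than \<open>Q\<close> digits would contradict the collision.
  The bound is uniform in \<open>R\<close>.\<close>

lemma card_incongruent_le:
  assumes a: "a \<in> K" "a \<noteq> 0"
  shows "\<exists>Q. \<forall>R Y. subring R ambient \<and> R \<subseteq> K \<and> a \<in> R \<and> finite Y \<and> Y \<subseteq> R \<and>
    (\<forall>y\<in>Y. \<forall>y'\<in>Y. y - y' \<in> (*) a ` R \<longrightarrow> y = y') \<longrightarrow> card Y \<le> Q"
proof -
  from horner_collision[OF a(1)] obtain Q where
    Q: "\<forall>(I :: 'c list set) y. finite I \<and> y ` I \<subseteq> K \<and> card I > Q \<longrightarrow>
    (\<exists>w w'. w \<noteq> w' \<and> length w = length w' \<and> set w \<subseteq> I \<and> set w' \<subseteq> I \<and>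
       horner_sum y a w = horner_sum y a w')"
    by (elim exE)
  show ?thesis
  proof (intro exI[of _ Q] allI impI, rule ccontr)
    fix R Y assume H: "subring R ambient \<and> R \<subseteq> K \<and> a \<in> R \<and> finite Y \<and> Y \<subseteq> R \<and>
      (\<forall>y\<in>Y. \<forall>y'\<in>Y. y - y' \<in> (*) a ` R \<longrightarrow> y = y')" and "\<not> card Y \<le> Q"
    \<comment> \<open>Digits become one-element lists to fit the index type of
      \<open>horner_collision\<close>; \<open>hd\<close> undoes this.\<close>
    let ?I = "(\<lambda>y. [y]) ` Y"
    have "card ?I > Q" using \<open>\<not> card Y \<le> Q\<close> by (simp add: card_image inj_on_def)
    then have "finite ?I \<and> hd ` ?I \<subseteq> K \<and> card ?I > Q" using H by (auto simp: image_image)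
    then obtain w w' where w: "w \<noteq> w'" "length w = length w'" "set w \<subseteq> ?I" "set w' \<subseteq> ?I"
      "horner_sum hd a w = horner_sum hd a w'"
      using Q[rule_format, of ?I hd] by blast
    have R: "subring R ambient" using H by auto
    have mem: "horner_sum hd a w \<in> R" if "set w \<subseteq> ?I" for w
      using that by (induction w) (use H in \<open>auto simp: subring_closed[OF R]\<close>)
    \<comment> \<open>Equal sums have first digits congruent modulo \<open>a R\<close>, hence equal;
      cancelling \<open>a\<close> leaves equal sums for the tails.\<close>
    have "w = w'" using w(2-5)
    proof (induction w w' rule: list_induct2)
      case (Cons i w i' w')
      have "hd i - hd i' = a * (horner_sum hd a w' - horner_sum hd a w)"
        using Cons.prems by (simp add: algebra_simps)
      moreover have "horner_sum hd a w' - horner_sum hd a w \<in> R"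
        using Cons.prems mem by (auto intro!: subring_closed[OF R])
      ultimately have "hd i - hd i' \<in> (*) a ` R" by blast
      moreover obtain y y' where y: "i = [y]" "i' = [y']" "y \<in> Y" "y' \<in> Y" using Cons.prems by auto
      ultimately have "i = i'" using H by auto
      then show ?case using Cons a(2) by auto
    qed auto
    with w(1) show False by simp
  qed
qed

text \<open>Incongruent sets have bounded size, so a largest one exists, and being maximal it
  represents every class.\<close>

lemma finite_quotient:
  assumes "a \<in> R" "a \<noteq> 0" "subring R ambient" "R \<subseteq> K"
  obtains T where "finite T" "T \<subseteq> R" "\<forall>x\<in>R. \<exists>y\<in>T. x - y \<in> (*) a ` R"
proof -
  obtain Q where Q: "\<And>Y. finite Y \<Longrightarrow> Y \<subseteq> R \<Longrightarrow>
      \<forall>y\<in>Y. \<forall>y'\<in>Y. y - y' \<in> (*) a ` R \<longrightarrow> y = y' \<Longrightarrow> card Y \<le> Q"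
    using card_incongruent_le[of a] assms by (metis subsetD)
  define P where "P Y \<longleftrightarrow> finite Y \<and> Y \<subseteq> R \<and> (\<forall>y\<in>Y. \<forall>y'\<in>Y. y - y' \<in> (*) a ` R \<longrightarrow> y = y')" for Y
  have "\<forall>Y. P Y \<longrightarrow> card Y < Q + 1" using Q by (simp add: P_def less_Suc_eq_le)
  moreover have "P {}" by (simp add: P_def)
  ultimately obtain T where T: "P T" "\<And>Y. P Y \<Longrightarrow> card Y \<le> card T"
    using ex_has_greatest_nat[of P "{}" card "Q + 1"] by blast
  have T1: "finite T" "T \<subseteq> R" using T(1) by (auto simp: P_def)
  have "\<exists>y\<in>T. x - y \<in> (*) a ` R" if x: "x \<in> R" for x
  proof (rule ccontr)
    assume H: "\<not> ?thesis"
    have sym: "y - x \<in> (*) a ` R \<Longrightarrow> x - y \<in> (*) a ` R" for y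
    proof -
      assume "y - x \<in> (*) a ` R"
      then obtain r where "r \<in> R" "y - x = a * r" by auto
      then have "x - y = a * (- r)" "- r \<in> R" by (auto simp: subring_closed[OF assms(3)] algebra_simps)
      then show ?thesis by blast
    qed
    have "x - x = a * 0" "0 \<in> R" by (auto simp: subring_closed[OF assms(3)])
    then have "x - x \<in> (*) a ` R" by blast
    then have "x \<notin> T" using H by blast
    moreover have "\<forall>y\<in>insert x T. \<forall>y'\<in>insert x T. y - y' \<in> (*) a ` R \<longrightarrow> y = y'"
      using T(1) H sym unfolding P_def by blast
    then have "P (insert x T)" using T1 x by (simp add: P_def)
    ultimately show False using T(2)[of "insert x T"] T1 by simp
  qed
  then show thesis using that T1 by blast
qed

text \<open>Such a \<open>J\<close> is a union of classes modulo \<open>a R\<close>, hence determined by its representatives.\<close>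

lemma finite_subgroups_above:
  assumes "a \<in> R" "a \<noteq> 0" "subring R ambient" "R \<subseteq> K"
  shows "finite {J. J \<subseteq> R \<and> (*) a ` R \<subseteq> J \<and> (\<forall>x\<in>J. \<forall>y\<in>J. x - y \<in> J)}" (is "finite ?\<J>")
proof -
  obtain T where T: "finite T" "T \<subseteq> R" "\<forall>x\<in>R. \<exists>y\<in>T. x - y \<in> (*) a ` R"
    by (rule finite_quotient[OF assms])
  have eq: "J = {x \<in> R. \<exists>y\<in>J \<inter> T. x - y \<in> (*) a ` R}" if J: "J \<in> ?\<J>" for J
  proof -
    have JR: "J \<subseteq> R" "(*) a ` R \<subseteq> J" and minus: "\<And>x y. x \<in> J \<Longrightarrow> y \<in> J \<Longrightarrow> x - y \<in> J"
      using J by auto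
    show ?thesis
    proof (intro equalityI subsetI)
      fix x assume x: "x \<in> J"
      then obtain y where y: "y \<in> T" "x - y \<in> (*) a ` R" using T(3) JR(1) by (meson subsetD)
      have "x - (x - y) \<in> J" by (rule minus[OF x subsetD[OF JR(2) y(2)]])
      then have "y \<in> J" by simp
      with x y JR show "x \<in> {x \<in> R. \<exists>y\<in>J \<inter> T. x - y \<in> (*) a ` R}"
        by (intro CollectI conjI bexI[of _ y]) auto
    next
      fix x assume "x \<in> {x \<in> R. \<exists>y\<in>J \<inter> T. x - y \<in> (*) a ` R}"
      then obtain y where y: "y \<in> J" "x - y \<in> (*) a ` R" by auto
      have d: "x - y \<in> J" by (rule subsetD[OF JR(2) y(2)])
      from minus[OF d minus[OF minus[OF y(1) y(1)] y(1)]] show "x \<in> J" by simp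
    qed
  qed
  have "inj_on (\<lambda>J. J \<inter> T) ?\<J>"
  proof (rule inj_onI)
    fix J J' assume "J \<in> ?\<J>" "J' \<in> ?\<J>" "J \<inter> T = J' \<inter> T"
    then show "J = J'" using eq[of J] eq[of J'] by simp
  qed
  moreover have "(\<lambda>J. J \<inter> T) ` ?\<J> \<subseteq> Pow T" by auto
  ultimately show ?thesis using T(1) by (meson finite_Pow_iff finite_imageD finite_subset)
qed

end


section \<open>Places are discrete valuations\<close>

context function_field
begin

text \<open>The fractional ideal given by the \<open>N\<close>-th power of the maximal ideal. Zero
  is listed separately because \<open>ord_at\<close> is meaningless there.\<close>

definition vball :: "'c set \<Rightarrow> int \<Rightarrow> 'c set"
  where "vball v N = {x \<in> K. x = 0 \<or> N \<le> ord_at v x}"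

context
  fixes v assumes v: "v \<in> places k K"
begin

lemma place_subring: "subring v ambient" and k_subset_place: "k \<subseteq> v" and place_subset_K: "v \<subseteq> K"
  and place_neq_K: "v \<noteq> K" and place_total: "x \<in> K \<Longrightarrow> x \<notin> v \<Longrightarrow> inverse x \<in> v"
  using v by (auto simp: places_def)

lemmas place_closed = subring_closed[OF place_subring]

lemma place_in_K: "x \<in> v \<Longrightarrow> x \<in> K"
  using place_subset_K by blast

lemma place_Units_iff: "x \<in> Units (subring_of v) \<longleftrightarrow> x \<in> v \<and> x \<noteq> 0 \<and> inverse x \<in> v"
proof -
  have "Units (subring_of v) = {x \<in> v. \<exists>y\<in>v. y * x = 1 \<and> x * y = 1}" by (simp add: Units_def)
  moreover have "y = inverse x" if "x * y = 1" for y
    using that by (metis inverse_unique)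
  ultimately show ?thesis by force
qed

lemma max_ideal_iff: "x \<in> max_ideal v \<longleftrightarrow> x \<in> v \<and> (x = 0 \<or> inverse x \<notin> v)"
  by (auto simp: max_ideal_def place_Units_iff)

lemma max_ideal_mult:
  assumes "x \<in> max_ideal v" "y \<in> v"
  shows "x * y \<in> max_ideal v"
proof -
  have "inverse (x * y) \<notin> v" if "x \<noteq> 0" "y \<noteq> 0"
  proof
    assume "inverse (x * y) \<in> v"
    then have "y * inverse (x * y) \<in> v" using assms by (auto intro: place_closed)
    also have "y * inverse (x * y) = inverse x" using that by (simp add: field_simps)
    finally show False using assms that by (simp add: max_ideal_iff)
  qed
  then show ?thesis using assms by (auto simp: max_ideal_iff place_closed)
qed

lemma place_comparable:
  assumes "x \<in> K" "y \<in> K" "y \<noteq> 0" "x / y \<notin> v"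
  shows "x \<noteq> 0" "y / x \<in> v"
  using assms place_total[of "x / y"] place_closed(1) by (auto simp: K_closed)

text \<open>Only finitely many principal ideals lie between \<open>a v\<close> and the maximal
  ideal. As principal ideals of a valuation ring are totally ordered by inclusion, a maximal one
  among these contains every nonunit.\<close>

lemma max_ideal_principal: "\<exists>p\<in>v. p \<noteq> 0 \<and> max_ideal v = (*) p ` v"
proof -
  obtain z where z: "z \<in> K" "z \<notin> v" using place_neq_K place_subset_K by blast
  define a where "a = inverse z"
  have a: "a \<in> max_ideal v" "a \<in> v" "a \<noteq> 0"
    using z place_total[of z] place_closed(1) by (auto simp: a_def max_ideal_iff)
  define \<I> where "\<I> = {J. \<exists>x. J = (*) x ` v \<and> x \<in> max_ideal v \<and> a \<in> (*) x ` v}"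
  have "\<I> \<subseteq> {J. J \<subseteq> v \<and> (*) a ` v \<subseteq> J \<and> (\<forall>x\<in>J. \<forall>y\<in>J. x - y \<in> J)}"
  proof
    fix J assume "J \<in> \<I>"
    then obtain x r where x: "J = (*) x ` v" "x \<in> max_ideal v" "r \<in> v" "a = x * r"
      by (auto simp: \<I>_def)
    have "x * y - x * z \<in> J" if "y \<in> v" "z \<in> v" for y z
      using that place_closed(5)[of y z] by (auto simp: x(1) right_diff_distrib[symmetric])
    moreover have "x * r * y \<in> J" if "y \<in> v" for y
      using that x(3) place_closed(6)[of r y] by (auto simp: x(1) mult.assoc)
    moreover have "J \<subseteq> v" using x(2) by (auto simp: x(1) max_ideal_iff place_closed)
    ultimately show "J \<in> {J. J \<subseteq> v \<and> (*) a ` v \<subseteq> J \<and> (\<forall>x\<in>J. \<forall>y\<in>J. x - y \<in> J)}"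
      by (auto simp: x(1,4))
  qed
  then have "finite \<I>"
    by (rule finite_subset) (rule finite_subgroups_above[OF a(2,3) place_subring place_subset_K])
  moreover have "(*) a ` v \<in> \<I>"
    using a place_closed(2) by (auto simp: \<I>_def intro!: exI[of _ a] image_eqI[of _ _ 1])
  ultimately obtain J where J: "J \<in> \<I>" "\<And>J'. J' \<in> \<I> \<Longrightarrow> J \<subseteq> J' \<Longrightarrow> J = J'"
    using finite_has_maximal[of \<I>] by blast
  then obtain p where p: "J = (*) p ` v" "p \<in> max_ideal v" "a \<in> (*) p ` v" by (auto simp: \<I>_def)
  have p0: "p \<noteq> 0" using p(3) a(3) by auto
  have pv: "p \<in> v" using p(2) by (simp add: max_ideal_iff)
  have "max_ideal v = (*) p ` v"
  proof (intro equalityI subsetI)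
    fix y assume y: "y \<in> max_ideal v"
    show "y \<in> (*) p ` v"
    proof (cases "y / p \<in> v")
      case True
      then show ?thesis using p0 by (auto intro!: image_eqI[of _ _ "y / p"])
    next
      case False
      then have y0: "y \<noteq> 0" "p / y \<in> v"
        using place_comparable[of y p] y p0 pv place_in_K by (auto simp: max_ideal_iff)
      have "J \<subseteq> (*) y ` v"
      proof
        fix x assume "x \<in> J"
        then obtain r where "r \<in> v" "x = p * r" by (auto simp: p(1))
        then show "x \<in> (*) y ` v"
          using y0 by (auto intro!: image_eqI[of _ _ "p / y * r"] place_closed)
      qed
      moreover from this have "a \<in> (*) y ` v" using p(1,3) by (meson subsetD)
      then have "(*) y ` v \<in> \<I>" using y by (auto simp only: \<I>_def)
      ultimately have "J = (*) y ` v" using J(2) by blast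
      moreover have "y * 1 \<in> (*) y ` v" using place_closed(2) by blast
      ultimately show ?thesis by (simp add: p(1))
    qed
  next
    fix y assume "y \<in> (*) p ` v"
    then show "y \<in> max_ideal v" using max_ideal_mult[OF p(2)] by auto
  qed
  then show ?thesis using p0 pv by blast
qed

lemma generator_in_max_ideal: "max_ideal v = (*) p ` v \<Longrightarrow> p \<in> max_ideal v"
  using place_closed(2) by (auto intro: image_eqI[of _ _ 1])

lemma power_not_unit:
  assumes "p \<in> max_ideal v" "n > 0" "p \<noteq> 0"
  shows "inverse (p ^ n) \<notin> v"
proof
  assume H: "inverse (p ^ n) \<in> v"
  have "p ^ (n - 1) * inverse (p ^ n) \<in> v"
    using H assms by (auto simp: max_ideal_iff intro: place_closed)
  also have "p ^ (n - 1) * inverse (p ^ n) = inverse p"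
    using assms by (cases n) (auto simp: field_simps)
  finally show False using assms by (auto simp: max_ideal_iff)
qed

text \<open>Otherwise all ideals \<open>p ^ i v\<close> would lie between \<open>x v\<close> and
  \<open>v\<close>; two of them would coincide by finiteness, making a positive power of
  \<open>p\<close> a unit.\<close>

lemma power_ideals_exhaust:
  assumes p: "p \<in> max_ideal v" "p \<noteq> 0" and x: "x \<in> v" "x \<noteq> 0"
  shows "\<exists>i. x / p ^ i \<notin> v"
proof (rule ccontr)
  assume "\<not> ?thesis"
  then have all: "x / p ^ i \<in> v" for i by blast
  have pv: "p \<in> v" using p by (simp add: max_ideal_iff)
  let ?J = "\<lambda>i. (*) (p ^ i) ` v"
  have "range ?J \<subseteq> {J. J \<subseteq> v \<and> (*) x ` v \<subseteq> J \<and> (\<forall>x\<in>J. \<forall>y\<in>J. x - y \<in> J)}"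
  proof
    fix J assume "J \<in> range ?J"
    then obtain i where J: "J = ?J i" by blast
    have "p ^ i * y - p ^ i * z \<in> J" if "y \<in> v" "z \<in> v" for y z
      using that place_closed(5)[of y z] by (auto simp: J right_diff_distrib[symmetric])
    moreover have "x * y \<in> J" if "y \<in> v" for y
      using that all[of i] p(2) by (auto simp: J intro!: image_eqI[of _ _ "x / p ^ i * y"] place_closed)
    moreover have "J \<subseteq> v" using pv by (auto simp: J intro!: place_closed)
    ultimately show "J \<in> {J. J \<subseteq> v \<and> (*) x ` v \<subseteq> J \<and> (\<forall>x\<in>J. \<forall>y\<in>J. x - y \<in> J)}"
      by (auto simp: J)
  qed
  then have "finite (range ?J)"
    by (rule finite_subset) (rule finite_subgroups_above[OF x place_subring place_subset_K])
  then have "\<not> inj ?J" using finite_imageD by blast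
  then obtain i j where ij: "i < j" "?J i = ?J j"
    unfolding inj_on_def by (metis nat_neq_iff UNIV_I)
  have "p ^ i * 1 \<in> ?J i" using place_closed(2) by blast
  then obtain r where r: "r \<in> v" "p ^ i = p ^ j * r" using ij(2) by auto
  have "p ^ j = p ^ i * p ^ (j - i)" using ij(1) by (simp add: power_add[symmetric])
  then have "r = inverse (p ^ (j - i))" using r(2) p(2) by (simp add: field_simps)
  then show False using power_not_unit[OF p(1) _ p(2), of "j - i"] ij(1) r(1) by simp
qed

lemma place_power_int_unit:
  assumes "u \<in> v" "inverse u \<in> v"
  shows "u powi i \<in> v"
  using assms by (auto simp: power_int_def place_closed power_inverse[symmetric])

context
  fixes p assumes p: "max_ideal v = (*) p ` v" and p0: "p \<noteq> 0"
begin

lemma uniformizer_in: "p \<in> v" "p \<in> K" "p \<in> max_ideal v" "inverse p \<notin> v"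
  using generator_in_max_ideal[OF p] p0 place_in_K by (auto simp: max_ideal_iff)

lemma unit_decomposition_place:
  assumes "x \<in> v" "x \<noteq> 0"
  shows "\<exists>i u. u \<in> Units (subring_of v) \<and> x = u * p ^ i"
proof -
  \<comment> \<open>The first exponent that leaves \<open>v\<close>. It is positive because
    \<open>x\<close> itself lies in \<open>v\<close>, so the exponent wanted is
    \<open>j - 1\<close>.\<close>
  define j where "j = (LEAST i. x / p ^ i \<notin> v)"
  have j: "x / p ^ j \<notin> v" "\<And>i. i < j \<Longrightarrow> x / p ^ i \<in> v"
    using LeastI_ex[OF power_ideals_exhaust[OF uniformizer_in(3) p0 assms]] not_less_Least
    unfolding j_def by auto
  then have "j \<noteq> 0" using assms by (metis div_by_1 power_0)
  then obtain i where i: "j = Suc i" by (cases j) auto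
  define u where "u = x / p ^ i"
  have "u \<in> v" using j(2) i by (simp add: u_def)
  moreover have "u \<notin> max_ideal v"
  proof
    assume "u \<in> max_ideal v"
    then obtain r where "r \<in> v" "u = p * r" using p by auto
    then have "r = x / p ^ j" using p0 by (simp add: u_def i field_simps)
    with \<open>r \<in> v\<close> j(1) show False by simp
  qed
  ultimately have "u \<in> Units (subring_of v)" by (simp add: max_ideal_def)
  then show ?thesis using p0 by (intro exI[of _ i] exI[of _ u]) (simp add: u_def)
qed

lemma unit_decomposition:
  assumes "x \<in> K" "x \<noteq> 0"
  shows "\<exists>i u. u \<in> Units (subring_of v) \<and> x = u * p powi i"
proof (cases "x \<in> v")
  case True
  then obtain i u where "u \<in> Units (subring_of v)" "x = u * p ^ i"
    using unit_decomposition_place assms by blast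
  then show ?thesis by (intro exI[of _ "int i"] exI[of _ u]) simp
next
  case False
  then have "inverse x \<in> v" using place_total assms by blast
  then obtain i u where u: "u \<in> Units (subring_of v)" "inverse x = u * p ^ i"
    using unit_decomposition_place[of "inverse x"] assms by auto
  have "x = inverse u * p powi (- int i)"
    using u(2) by (metis inverse_inverse_eq inverse_mult_distrib mult.commute power_int_minus power_int_of_nat)
  then show ?thesis using u(1) by (intro exI[of _ "- int i"] exI[of _ "inverse u"]) (auto simp: place_Units_iff)
qed

lemma unit_times_power_in_place_iff:
  assumes u: "u \<in> Units (subring_of v)"
  shows "u * p powi i \<in> v \<longleftrightarrow> i \<ge> 0"
proof
  assume "i \<ge> 0"
  then show "u * p powi i \<in> v"
    using u uniformizer_in(1) by (auto simp: power_int_def place_Units_iff intro!: place_closed)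
next
  assume H: "u * p powi i \<in> v"
  show "i \<ge> 0"
  proof (rule ccontr)
    assume "\<not> i \<ge> 0"
    define n where "n = nat (- i)"
    have n: "n > 0" "i = - int n" using \<open>\<not> i \<ge> 0\<close> by (auto simp: n_def)
    have "inverse u * (u * p powi i) \<in> v" using H u by (auto simp: place_Units_iff intro!: place_closed)
    also have "inverse u * (u * p powi i) = inverse (p ^ n)"
      using u by (simp add: n(2) power_int_minus place_Units_iff)
    finally show False using power_not_unit[OF uniformizer_in(3) n(1) p0] by simp
  qed
qed

text \<open>Uniqueness in the description defining \<open>ord_at\<close>: another generator
  \<open>t\<close> differs from \<open>p\<close> by a unit, so a second exponent \<open>j\<close>
  would make \<open>p powi (i - j)\<close> a unit.\<close>

lemma ord_at_unit_times_power:
  assumes u: "u \<in> Units (subring_of v)"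
  shows "ord_at v (u * p powi i) = i"
  unfolding ord_at_def
proof (rule the_equality)
  show "\<exists>t u'. max_ideal v = (*) t ` v \<and> u' \<in> Units (subring_of v) \<and> u * p powi i = u' * t powi i"
    using p u by blast
next
  fix j assume "\<exists>t u'. max_ideal v = (*) t ` v \<and> u' \<in> Units (subring_of v) \<and> u * p powi i = u' * t powi j"
  then obtain t u' where t: "max_ideal v = (*) t ` v" "u' \<in> Units (subring_of v)" "u * p powi i = u' * t powi j"
    by blast
  obtain r where r: "r \<in> v" "p = t * r" using uniformizer_in(3) t(1) by auto
  obtain s where s: "s \<in> v" "t = p * s" using generator_in_max_ideal[OF t(1)] p by auto
  have nz: "s \<noteq> 0" "r \<noteq> 0" "t \<noteq> 0" using r(2) s(2) p0 by auto
  have "p * (s * r) = p" using r(2) s(2) by (simp add: mult.assoc)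
  then have "s * r = 1" using p0 by simp
  then have inv: "inverse s = r" by (rule inverse_unique)
  define w where "w = u' * s powi j * inverse u"
  have "w \<in> v" "inverse w \<in> v" "w \<noteq> 0"
    using u t(2) nz r(1) s(1) inv place_power_int_unit[of s j] place_power_int_unit[of r j]
    by (auto simp: w_def place_Units_iff power_int_inverse[symmetric] intro!: place_closed)
  then have w: "w \<in> Units (subring_of v)" by (simp add: place_Units_iff)
  then have w': "inverse w \<in> Units (subring_of v)" by (simp add: place_Units_iff)
  have "p powi i = w * p powi j"
    using t(3) u by (simp add: w_def s(2) power_int_mult_distrib place_Units_iff field_simps)
  then have "w * p powi (j - i) = 1" "inverse w * p powi (i - j) = 1"
    using p0 \<open>w \<noteq> 0\<close> by (auto simp: power_int_diff field_simps)
  then have "j - i \<ge> 0" "i - j \<ge> 0"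
    using unit_times_power_in_place_iff[OF w, of "j - i"] unit_times_power_in_place_iff[OF w', of "i - j"] place_closed(2) by auto
  then show "j = i" by simp
qed

text \<open>Scaling by a power of the uniformizer turns conditions on the order into membership in
  \<open>v\<close>; the arithmetic of balls thereby reduces to \<open>v\<close> being a
  ring.\<close>

lemma vball_iff: "x \<in> vball v N \<longleftrightarrow> x \<in> K \<and> x * p powi (- N) \<in> v"
proof (cases "x \<in> K \<and> x \<noteq> 0")
  case True
  then obtain i u where u: "u \<in> Units (subring_of v)" "x = u * p powi i"
    using unit_decomposition by blast
  have eq: "x * p powi (- N) = u * p powi (i - N)"
    using p0 by (simp add: u(2) power_int_diff power_int_minus divide_inverse)
  have "ord_at v x = i" using ord_at_unit_times_power[OF u(1), of i] by (simp add: u(2))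
  then show ?thesis
    using True unit_times_power_in_place_iff[OF u(1), of "i - N"] by (simp add: vball_def eq)
next
  case False
  then show ?thesis using place_closed(1) K_closed(1) by (auto simp: vball_def)
qed

end

lemma vball_place: "vball v 0 = v"
  using max_ideal_principal vball_iff[of _ _ 0] place_in_K by auto

lemma vball_max_ideal: "vball v 1 = max_ideal v"
proof -
  obtain p where p: "max_ideal v = (*) p ` v" "p \<noteq> 0" using max_ideal_principal by blast
  show ?thesis
  proof (intro equalityI subsetI)
    fix x assume "x \<in> vball v 1"
    then have "x = p * (x * p powi (- 1))" "x * p powi (- 1) \<in> v" using vball_iff[OF p] p(2) by (auto simp: field_simps)
    then show "x \<in> max_ideal v" unfolding p(1) by (rule image_eqI)
  next
    fix x assume "x \<in> max_ideal v"
    then show "x \<in> vball v 1" using p place_in_K uniformizer_in[OF p]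
      by (auto simp: vball_iff[OF p] K_closed field_simps)
  qed
qed

lemma vball_closed:
  "0 \<in> vball v N" "x \<in> vball v N \<Longrightarrow> y \<in> vball v N \<Longrightarrow> x + y \<in> vball v N"
  "x \<in> vball v N \<Longrightarrow> - x \<in> vball v N"
  "x \<in> vball v N \<Longrightarrow> y \<in> vball v N \<Longrightarrow> x - y \<in> vball v N"
  "x \<in> vball v M \<Longrightarrow> y \<in> vball v N \<Longrightarrow> x * y \<in> vball v (M + N)"
proof -
  obtain p where p: "max_ideal v = (*) p ` v" "p \<noteq> 0" using max_ideal_principal by blast
  note iff = vball_iff[OF p]
  show "0 \<in> vball v N" by (simp add: vball_def K_closed)
  show "x \<in> vball v N \<Longrightarrow> y \<in> vball v N \<Longrightarrow> x + y \<in> vball v N"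
    using place_closed(3) by (auto simp: iff K_closed distrib_right)
  show "x \<in> vball v N \<Longrightarrow> - x \<in> vball v N"
    using place_closed(4) by (auto simp: iff K_closed)
  show "x \<in> vball v N \<Longrightarrow> y \<in> vball v N \<Longrightarrow> x - y \<in> vball v N"
    using place_closed(5) by (auto simp: iff K_closed left_diff_distrib)
  show "x \<in> vball v M \<Longrightarrow> y \<in> vball v N \<Longrightarrow> x * y \<in> vball v (M + N)"
    using place_closed(6)[of "x * p powi (- M)" "y * p powi (- N)"] p(2)
    by (auto simp: iff K_closed power_int_add power_int_minus power_int_diff field_simps)
qed

lemma vball_sub_K: "x \<in> vball v N \<Longrightarrow> x \<in> K"
  by (simp add: vball_def)

lemma vball_anti: "M \<le> N \<Longrightarrow> vball v N \<subseteq> vball v M"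
  by (auto simp: vball_def)

lemma vball_exhaust: "x \<in> K \<Longrightarrow> \<exists>n::nat. x \<in> vball v (- int n)"
  by (intro exI[of _ "nat (- ord_at v x)"]) (auto simp: vball_def)

lemma vball_separated: "x \<noteq> 0 \<Longrightarrow> \<exists>n::nat. x \<notin> vball v (int n)"
  by (intro exI[of _ "nat (ord_at v x + 1)"]) (auto simp: vball_def)

lemma vball_power: "x \<in> max_ideal v \<Longrightarrow> x ^ n \<in> vball v (int n)"
proof (induction n)
  case 0
  then show ?case by (simp add: vball_place place_closed)
next
  case (Suc n)
  then show ?case using vball_closed(5)[of x 1 "x ^ n" "int n"] by (simp add: vball_max_ideal)
qed

lemma vball_mult_place: "x \<in> vball v N \<Longrightarrow> y \<in> v \<Longrightarrow> x * y \<in> vball v N"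
  using vball_closed(5)[of x N y 0] by (simp add: vball_place)

lemma max_ideal_closed:
  "x \<in> max_ideal v \<Longrightarrow> y \<in> max_ideal v \<Longrightarrow> x + y \<in> max_ideal v"
  "x \<in> max_ideal v \<Longrightarrow> y \<in> max_ideal v \<Longrightarrow> x - y \<in> max_ideal v"
  "0 \<in> max_ideal v" "1 \<notin> max_ideal v" "x \<in> max_ideal v \<Longrightarrow> x \<in> v"
  using vball_closed(1,2,4)[where N = 1] vball_max_ideal place_closed(2) by (auto simp: max_ideal_iff)

text \<open>If the quotient were outside \<open>v\<close>, then \<open>d = h * (d / h)\<close> would
  be a multiple of \<open>h\<close> by an element of \<open>v\<close> and so lie in the
  ball.\<close>

lemma vball_quotient:
  assumes "h \<in> vball v N" "d \<in> K" "d \<notin> vball v N"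
  shows "h / d \<in> v"
proof (cases "h = 0")
  case True
  then show ?thesis by (simp add: place_closed)
next
  case False
  show ?thesis
  proof (rule ccontr)
    assume "h / d \<notin> v"
    moreover have "d \<noteq> 0" using assms(3) vball_closed(1) by auto
    ultimately have "d / h \<in> v" using place_comparable[of h d] vball_sub_K[OF assms(1)] assms(2) by blast
    then have "h * (d / h) \<in> vball v N" by (rule vball_mult_place[OF assms(1)])
    then show False using False assms(3) by simp
  qed
qed

text \<open>Valuation rings are integrally closed: dividing the equation by
  \<open>z ^ (n - 1)\<close> writes \<open>z\<close> as a polynomial in \<open>inverse z\<close>
  with coefficients in \<open>v\<close>.\<close>

lemma integral_in_place:
  assumes "z \<in> K" "n > 0" "z ^ n = (\<Sum>i<n. c i * z ^ i)" "\<And>i. i < n \<Longrightarrow> c i \<in> v"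
  shows "z \<in> v"
proof (rule ccontr)
  assume z: "z \<notin> v"
  then have z0: "z \<noteq> 0" and iz: "inverse z \<in> v" using place_closed(1) place_total assms(1) by auto
  have "c i * z ^ i / z ^ (n - 1) = c i * inverse z ^ (n - 1 - i)" if "i < n" for i
  proof -
    have "z ^ (n - 1) = z ^ i * z ^ (n - 1 - i)" using that by (simp add: power_add[symmetric])
    then show ?thesis using z0 by (simp add: field_simps)
  qed
  then have "(\<Sum>i<n. c i * z ^ i) / z ^ (n - 1) = (\<Sum>i<n. c i * inverse z ^ (n - 1 - i))"
    unfolding sum_divide_distrib by (intro sum.cong) auto
  moreover have "z ^ n / z ^ (n - 1) = z" using z0 assms(2) by (cases n) auto
  ultimately have "z = (\<Sum>i<n. c i * inverse z ^ (n - 1 - i))" using assms(3) by simp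
  moreover have "(\<Sum>i<n. c i * inverse z ^ (n - 1 - i)) \<in> v"
    using assms(4) iz by (intro subring_sum[OF place_subring] place_closed) auto
  ultimately show False using z by simp
qed

end

end


section \<open>The ring of functions regular outside infinity\<close>

context function_field
begin

lemma finite_place: "v \<in> finite_places \<Longrightarrow> v \<in> places k K"
  by (simp add: finite_places_def)

lemma A_in_K: "a \<in> A \<Longrightarrow> a \<in> K" and A_in_place: "a \<in> A \<Longrightarrow> v \<in> finite_places \<Longrightarrow> a \<in> v"
  and A_I: "a \<in> K \<Longrightarrow> (\<And>v. v \<in> finite_places \<Longrightarrow> a \<in> v) \<Longrightarrow> a \<in> A"
  by (auto simp: A_def)

lemma A_subring: "subring A ambient"
  by (rule subring_ambientI) (auto simp: A_def K_closed place_closed[OF finite_place])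

lemmas A_closed = subring_closed[OF A_subring]

lemma k_subset_A: "k \<subseteq> A"
  using k_subset_K k_subset_place[OF finite_place] by (auto simp: A_def)

lemma A_subset_K: "A \<subseteq> K"
  by (auto simp: A_def)

text \<open>As \<open>k\<close> is algebraically closed in \<open>K\<close>, elements of
  \<open>K\<close> outside \<open>k\<close> are transcendental; the rest translates between two
  representations of polynomials.\<close>

lemma poly_root_imp_constant:
  assumes "x \<in> K" "x \<notin> k" "f \<in> polys_over k" "poly f x = 0"
  shows "f = 0"
proof -
  interpret field "ambient :: 'c ring" by (rule field_ambient)
  have "transcendental k x" using algebraic_imp_k[OF assms(1)] assms(2) by (auto simp: over_def)
  then have tr: "(transcendental over k) x" by (simp add: over_def)
  have "rev (coeffs f) \<in> carrier (univ_poly ambient k)"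
  proof (cases "f = 0")
    case False
    then have "hd (rev (coeffs f)) \<noteq> 0" by (simp add: hd_rev last_coeffs_eq_coeff_degree)
    then show ?thesis using assms(3)
      by (auto simp: univ_poly_def polynomial_def polys_over_def range_coeff)
  qed (simp add: univ_poly_def polynomial_def)
  moreover have "eval (rev (coeffs f)) x = 0"
    using assms(4) by (simp add: eval_ambient)
  ultimately have "rev (coeffs f) = []" using eval_transcendental[OF tr] by (simp only: ambient_simps)
  then show "f = 0" by simp
qed

end

text \<open>Riemann-Roch would supply such a \<open>t\<close>; here it is assumed and later read off
  from a Drinfeld module in \<open>drinfeld_nonconstant\<close>.\<close>

locale nonconstant_function_field = function_field k K Oinf
  for k K Oinf :: "'c::field set" +
  fixes t :: 'c
  assumes t_in_A: "t \<in> A" and t_not_k: "t \<notin> k"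
begin

text \<open>The collision is applied to expansions in \<open>t\<close> whose digits are polynomials
  in \<open>x\<close> over \<open>k\<close>. The difference of two colliding words, sorted by powers
  of \<open>x\<close>, has coefficients in \<open>k[t]\<close>, hence in \<open>A\<close>.\<close>

lemma integral_equation:
  assumes x: "x \<in> K"
  shows "\<exists>d\<in>polys_over A. d \<noteq> 0 \<and> poly d x = 0"
proof -
  have tK: "t \<in> K" using t_in_A by (rule A_in_K)
  from horner_collision[OF tK] obtain Q where
    Q: "\<forall>(I :: 'c list set) y. finite I \<and> y ` I \<subseteq> K \<and> card I > Q \<longrightarrow>
    (\<exists>w w'. w \<noteq> w' \<and> length w = length w' \<and> set w \<subseteq> I \<and> set w' \<subseteq> I \<and>
       horner_sum y t w = horner_sum y t w')"
    by (elim exE)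
  \<comment> \<open>With the length fixed, a list is determined by its polynomial; since
    \<open>q\<close> is at least 2 there are at least \<open>2 ^ Suc Q\<close> of them, more than
    \<open>Q\<close>.\<close>
  define I where "I = {c. set c \<subseteq> k \<and> length c = Suc Q}"
  have "Q < 2 ^ Suc Q" by (induction Q) auto
  also have "\<dots> \<le> q ^ Suc Q" using q_ge_2 by (intro power_mono) auto
  also have "\<dots> = card I" unfolding I_def q_def using finite_constants by (simp add: card_lists_length_eq)
  finally have "Q < card I" .
  moreover have "finite I" unfolding I_def using finite_constants by (rule finite_lists_length_eq)
  moreover have PolyI: "Poly c \<in> polys_over k" if "c \<in> I" for c
    using that subring_closed(1)[OF k_subring]
    by (auto simp: I_def polys_over_iff coeff_Poly_eq nth_default_def)
  then have "poly (Poly c) x \<in> K" if "c \<in> I" for c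
    using that poly_in_subring[OF K_subring _ x] polys_over_mono[OF k_subset_K] by blast
  then have "(\<lambda>c. poly (Poly c) x) ` I \<subseteq> K" by blast
  ultimately obtain w w' where w: "w \<noteq> w'" "length w = length w'" "set w \<subseteq> I" "set w' \<subseteq> I"
    "horner_sum (\<lambda>c. poly (Poly c) x) t w = horner_sum (\<lambda>c. poly (Poly c) x) t w'"
    using Q[rule_format, of I "\<lambda>c. poly (Poly c) x"] by blast
  \<comment> \<open>\<open>g w\<close> is the Horner sum with an indeterminate in place of
    \<open>x\<close>; \<open>h i w\<close> is its \<open>i\<close>-th coefficient with an
    indeterminate in place of \<open>t\<close>.\<close>
  define g where "g = horner_sum Poly [:t:]"
  define h where "h i w = Poly (map (\<lambda>c. nth_default 0 c i) w)" for i and w :: "'c list list"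
  have eval_g: "poly (g w) x = horner_sum (\<lambda>c. poly (Poly c) x) t w" for w
    unfolding g_def by (induction w) auto
  have coeff_g: "poly.coeff (g w) i = poly (h i w) t" for w i
    unfolding g_def h_def by (induction w) (auto simp: coeff_Poly_eq)
  have h: "h i w \<in> polys_over k" if "set w \<subseteq> I" for i w
  proof -
    have "nth_default 0 c i \<in> k" if "c \<in> I" for c
      using that subring_closed(1)[OF k_subring] by (auto simp: I_def nth_default_def)
    moreover have "w ! j \<in> I" if "j < length w" for j using \<open>set w \<subseteq> I\<close> that by auto
    ultimately show ?thesis using subring_closed(1)[OF k_subring]
      by (auto simp: h_def polys_over_iff coeff_Poly_eq nth_default_def[of _ "map _ _"])
  qed
  have "g w - g w' \<noteq> 0"
  proof
    assume "g w - g w' = 0"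
    \<comment> \<open>\<open>t\<close> is transcendental over \<open>k\<close>, so coefficients that
      agree at \<open>t\<close> agree as polynomials, and the digits can be read off from
      them.\<close>
    have eq: "h i w = h i w'" for i
    proof -
      have "poly (h i w - h i w') t = 0"
        using \<open>g w - g w' = 0\<close> by (simp add: coeff_g[symmetric])
      moreover have "h i w - h i w' \<in> polys_over k"
        using polys_over_closed(3,4)[OF k_subring, of _] h[OF w(3), of i] h[OF w(4), of i]
        by (metis diff_conv_add_uminus)
      ultimately show ?thesis using poly_root_imp_constant[OF tK t_not_k] by fastforce
    qed
    have "w ! j = w' ! j" if j: "j < length w" for j
    proof (rule nth_equalityI)
      have m: "w ! j \<in> I" "w' ! j \<in> I" using j w by auto
      then show "length (w ! j) = length (w' ! j)" by (simp add: I_def)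
      fix i assume i: "i < length (w ! j)"
      have "poly.coeff (h i w) j = poly.coeff (h i w') j" using eq by simp
      then show "w ! j ! i = w' ! j ! i"
        using i j w(2) m by (simp add: h_def coeff_Poly_eq nth_default_def I_def)
    qed
    then show False using w(1,2) by (metis nth_equalityI)
  qed
  moreover have "poly (g w - g w') x = 0" by (simp add: eval_g w(5))
  moreover have "poly.coeff (g w) i \<in> A" if "set w \<subseteq> I" for w i
    unfolding coeff_g by (rule poly_in_subring[OF A_subring polys_over_mono[OF k_subset_A h[OF that]] t_in_A])
  then have "g w - g w' \<in> polys_over A" using w(3,4) by (auto simp: polys_over_iff A_closed)
  ultimately show ?thesis by blast
qed

text \<open>Multiplied by the leading coefficient \<open>c\<close> of an equation over
  \<open>A\<close>, \<open>x\<close> becomes integral over \<open>A\<close>, and an intersection of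
  valuation rings is integrally closed.\<close>

lemma fraction:
  assumes x: "x \<in> K"
  shows "\<exists>d\<in>A. d \<noteq> 0 \<and> d * x \<in> A"
proof -
  obtain f where f: "f \<in> polys_over A" "f \<noteq> 0" "poly f x = 0" using integral_equation[OF x] by blast
  define n where "n = degree f"
  define c where "c = poly.coeff f n"
  have c: "c \<in> A" "c \<noteq> 0" using f by (auto simp: c_def n_def polys_over_iff)
  have cxK: "c * x \<in> K" using c(1) x by (auto intro: K_closed A_in_K)
  have n: "n > 0"
  proof (rule ccontr)
    assume "\<not> n > 0"
    then have "poly f x = c" by (simp add: poly_altdef c_def n_def)
    with f(3) c show False by simp
  qed
  \<comment> \<open>Coefficients of the monic equation for \<open>c * x\<close>, obtained by
    multiplying the one for \<open>x\<close> by \<open>c ^ (n - 1)\<close>.\<close>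
  define b where "b i = - (poly.coeff f i * c ^ (n - 1 - i))" for i
  have "0 = (\<Sum>i\<le>n. poly.coeff f i * x ^ i)" using f(3) by (simp add: poly_altdef n_def)
  also have "\<dots> = (\<Sum>i<n. poly.coeff f i * x ^ i) + c * x ^ n"
    by (simp add: lessThan_Suc_atMost[symmetric] c_def)
  finally have "c * x ^ n = - (\<Sum>i<n. poly.coeff f i * x ^ i)" by (simp add: eq_neg_iff_add_eq_0 add.commute)
  then have "c ^ (n - 1) * (c * x ^ n) = (\<Sum>i<n. c ^ (n - 1) * - (poly.coeff f i * x ^ i))"
    by (simp add: sum_distrib_left[symmetric] sum_negf)
  also have "\<dots> = (\<Sum>i<n. b i * (c * x) ^ i)"
  proof (rule sum.cong)
    fix i assume "i \<in> {..<n}"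
    then have "c ^ (n - 1) = c ^ (n - 1 - i) * c ^ i" by (simp add: power_add[symmetric])
    then show "c ^ (n - 1) * - (poly.coeff f i * x ^ i) = b i * (c * x) ^ i"
      by (simp add: b_def power_mult_distrib)
  qed simp
  also have "c ^ (n - 1) * (c * x ^ n) = (c * x) ^ n"
    using n by (cases n) (simp_all add: power_mult_distrib)
  finally have eq: "(c * x) ^ n = (\<Sum>i<n. b i * (c * x) ^ i)" .
  have "b i \<in> A" for i using f(1) c by (auto simp: b_def polys_over_iff intro!: A_closed)
  then have "c * x \<in> v" if "v \<in> finite_places" for v
    using integral_in_place[OF finite_place[OF that] cxK n eq] A_in_place that by blast
  then show ?thesis using A_I[OF cxK] c by blast
qed

text \<open>Powers of \<open>s\<close> have finitely many residues modulo \<open>a\<close>, so two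
  of them agree.\<close>

lemma power_congruence:
  assumes "a \<in> A" "a \<noteq> 0" "s \<in> A"
  shows "\<exists>i l. l > 0 \<and> s ^ i * (1 - s ^ l) \<in> (*) a ` A"
proof -
  obtain T where T: "finite T" "T \<subseteq> A" "\<forall>x\<in>A. \<exists>y\<in>T. x - y \<in> (*) a ` A"
    by (rule finite_quotient[OF assms(1,2) A_subring A_subset_K])
  then obtain r where r: "\<And>x. x \<in> A \<Longrightarrow> r x \<in> T \<and> x - r x \<in> (*) a ` A" by metis
  have "range (\<lambda>i. r (s ^ i)) \<subseteq> T" using r assms(3) A_closed(7) by blast
  then have "\<not> inj (\<lambda>i::nat. r (s ^ i))" using T(1) finite_subset finite_imageD by blast
  then obtain i j where ij: "i < j" "r (s ^ i) = r (s ^ j)"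
    unfolding inj_on_def by (metis nat_neq_iff UNIV_I)
  obtain b where b: "b \<in> A" "s ^ i - r (s ^ i) = a * b" using r[of "s ^ i"] A_closed(7)[OF assms(3)] by auto
  obtain c where c: "c \<in> A" "s ^ j - r (s ^ i) = a * c" using r[of "s ^ j"] A_closed(7)[OF assms(3)] ij(2) by auto
  have "s ^ i * (1 - s ^ (j - i)) = s ^ i - s ^ j"
    using ij(1) by (simp add: right_diff_distrib power_add[symmetric])
  also have "\<dots> = a * (b - c)" using b(2) c(2) by (simp add: algebra_simps)
  finally show ?thesis using ij(1) A_closed(5)[OF b(1) c(1)] by (intro exI[of _ i] exI[of _ "j - i"]) auto
qed

section \<open>The prime of \<open>A\<close> at a finite place\<close>

context
  fixes v assumes v: "v \<in> finite_places"
begin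

lemmas is_place = finite_place[OF v]

lemma not_max_ideal_mult: "x \<in> v \<Longrightarrow> y \<in> v \<Longrightarrow> x \<notin> max_ideal v \<Longrightarrow> y \<notin> max_ideal v \<Longrightarrow> x * y \<notin> max_ideal v"
  by (auto simp: max_ideal_iff[OF is_place] place_closed[OF is_place])

lemma not_max_ideal_power: "x \<in> v \<Longrightarrow> x \<notin> max_ideal v \<Longrightarrow> x ^ n \<notin> max_ideal v"
  by (induction n) (simp_all add: max_ideal_closed[OF is_place] place_closed[OF is_place] not_max_ideal_mult)

text \<open>A denominator in \<open>A\<close> of an element with a pole at \<open>v\<close> must
  vanish at \<open>v\<close>.\<close>

lemma nonzero_in_prime: "\<exists>d\<in>A. d \<noteq> 0 \<and> d \<in> max_ideal v"
proof -
  obtain x where x: "x \<in> K" "x \<notin> v" using place_neq_K[OF is_place] place_subset_K[OF is_place] by blast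
  obtain d where d: "d \<in> A" "d \<noteq> 0" "d * x \<in> A" using fraction[OF x(1)] by blast
  have "inverse d \<notin> v"
  proof
    assume "inverse d \<in> v"
    then have "inverse d * (d * x) \<in> v" using A_in_place[OF d(3) v] by (rule place_closed[OF is_place])
    moreover have "inverse d * (d * x) = x" using d(2) by (simp add: field_simps)
    ultimately show False using x by simp
  qed
  then show ?thesis using d A_in_place[OF d(1) v] by (auto simp: max_ideal_iff[OF is_place])
qed

text \<open>The prime of \<open>v\<close> is maximal in \<open>A\<close>: a power congruence modulo
  a nonzero element of the prime allows \<open>s ^ i\<close> to be cancelled, leaving
  \<open>s ^ l\<close> congruent to 1.\<close>

lemma inverse_mod_prime:
  assumes s: "s \<in> A" "s \<notin> max_ideal v"
  shows "\<exists>r\<in>A. 1 - s * r \<in> max_ideal v"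
proof -
  obtain a where a: "a \<in> A" "a \<noteq> 0" "a \<in> max_ideal v" using nonzero_in_prime by blast
  obtain i l where l: "l > 0" "s ^ i * (1 - s ^ l) \<in> (*) a ` A" using power_congruence[OF a(1,2) s(1)] by blast
  have sv: "s \<in> v" using A_in_place[OF s(1) v] .
  from l(2) have "s ^ i * (1 - s ^ l) \<in> max_ideal v"
    using max_ideal_mult[OF is_place a(3)] A_in_place v by auto
  then have "1 - s ^ l \<in> max_ideal v"
    using not_max_ideal_mult[of "s ^ i" "1 - s ^ l"] not_max_ideal_power[OF sv s(2)] sv
    by (auto intro: place_closed[OF is_place])
  moreover have "s ^ l = s * s ^ (l - 1)" using l(1) by (cases l) auto
  ultimately show ?thesis using A_closed(7)[OF s(1)] by (intro bexI[of _ "s ^ (l - 1)"]) auto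
qed

text \<open>
  An annihilator \<open>(a A : c)\<close> which is maximal among those contained in the prime \<open>max_ideal v \<inter> A\<close>
  equals that prime.
\<close>

lemma prime_is_annihilator:
  assumes a: "a \<in> A" "a \<noteq> 0" "a \<in> max_ideal v"
  shows "\<exists>c\<in>A. c \<notin> (*) a ` A \<and> (\<forall>r\<in>A. r \<in> max_ideal v \<longrightarrow> r * c \<in> (*) a ` A)"
proof -
  have aA: "x - y \<in> (*) a ` A" "x * z \<in> (*) a ` A" if xyz: "x \<in> (*) a ` A" "y \<in> (*) a ` A" "z \<in> A" for x y z
  proof -
    obtain b c where "b \<in> A" "c \<in> A" "x = a * b" "y = a * c" using xyz(1,2) by blast
    then have "x - y = a * (b - c)" "x * z = a * (b * z)" "b - c \<in> A" "b * z \<in> A"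
      using xyz(3) by (auto simp: algebra_simps A_closed)
    then show "x - y \<in> (*) a ` A" "x * z \<in> (*) a ` A" by auto
  qed
  have a_sub: "(*) a ` A \<subseteq> max_ideal v" using max_ideal_mult[OF is_place a(3)] A_in_place v by auto
  have a_A: "x \<in> A" if "x \<in> (*) a ` A" for x using that a(1) A_closed(6) by auto
  define Ann where "Ann c = {r \<in> A. r * c \<in> (*) a ` A}" for c
  define \<J> where "\<J> = {Ann c | c. c \<in> A \<and> Ann c \<subseteq> max_ideal v}"
  have "\<J> \<subseteq> {J. J \<subseteq> A \<and> (*) a ` A \<subseteq> J \<and> (\<forall>x\<in>J. \<forall>y\<in>J. x - y \<in> J)}"
  proof
    fix J assume "J \<in> \<J>"
    then obtain c where c: "c \<in> A" "J = Ann c" by (auto simp: \<J>_def)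
    show "J \<in> {J. J \<subseteq> A \<and> (*) a ` A \<subseteq> J \<and> (\<forall>x\<in>J. \<forall>y\<in>J. x - y \<in> J)}"
    proof (intro CollectI conjI ballI subsetI)
      fix x y assume "x \<in> J" "y \<in> J"
      then show "x - y \<in> J" using aA(1)[of "x * c" "y * c", OF _ _ c(1)]
        by (auto simp only: c(2) Ann_def mem_Collect_eq left_diff_distrib intro: A_closed)
    next
      fix x assume "x \<in> (*) a ` A"
      then show "x \<in> J" using aA(2)[OF _ _ c(1)] a_A by (auto simp only: c(2) Ann_def mem_Collect_eq)
    qed (simp add: c(2) Ann_def)
  qed
  then have "finite \<J>"
    by (rule finite_subset) (rule finite_subgroups_above[OF a(1,2) A_subring A_subset_K])
  moreover have "Ann 1 \<subseteq> max_ideal v" using a_sub by (auto simp only: Ann_def mult_1_right)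
  then have "Ann 1 \<in> \<J>" using A_closed(2) by (auto simp only: \<J>_def mem_Collect_eq)
  ultimately obtain J where J: "J \<in> \<J>" "\<And>J'. J' \<in> \<J> \<Longrightarrow> J \<subseteq> J' \<Longrightarrow> J = J'"
    using finite_has_maximal[of \<J>] by blast
  then obtain c where c: "c \<in> A" "J = Ann c" "Ann c \<subseteq> max_ideal v" by (auto simp only: \<J>_def mem_Collect_eq)
  have max: "Ann c' \<subseteq> Ann c" if "c' \<in> A" "Ann c' \<subseteq> max_ideal v" "Ann c \<subseteq> Ann c'" for c'
    using J(2)[of "Ann c'"] that unfolding c(2) \<J>_def by blast
  have Ann_mult: "Ann c \<subseteq> Ann (f * c)" if "f \<in> A" for f
  proof
    fix r assume "r \<in> Ann c"
    then have "r \<in> A" "r * c * f \<in> (*) a ` A" using aA(2)[OF _ _ that] by (auto simp only: Ann_def mem_Collect_eq)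
    then show "r \<in> Ann (f * c)" by (simp add: Ann_def algebra_simps)
  qed
  have "f \<in> Ann c" if f: "f \<in> A" "f \<in> max_ideal v" for f
  proof (rule ccontr)
    assume nf: "f \<notin> Ann c"
    \<comment> \<open>If some \<open>g\<close> outside the prime annihilated
      \<open>f ^ Suc i * c\<close>, then \<open>Ann (g * f ^ i * c)\<close> would still lie in the
      prime but contain both \<open>Ann c\<close> and \<open>f\<close>, against maximality.\<close>
    have all: "Ann (f ^ i * c) \<subseteq> max_ideal v" for i
    proof (induction i)
      case 0
      then show ?case using c(3) by simp
    next
      case (Suc i)
      show ?case
      proof
        fix g assume g: "g \<in> Ann (f ^ Suc i * c)"
        show "g \<in> max_ideal v"
        proof (rule ccontr)
          assume ng: "g \<notin> max_ideal v"
          have gA: "g \<in> A" using g by (simp add: Ann_def)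
          have "Ann (g * f ^ i * c) \<subseteq> max_ideal v"
          proof
            fix r assume "r \<in> Ann (g * f ^ i * c)"
            then have r: "r \<in> A" "r * g \<in> Ann (f ^ i * c)" using gA by (auto simp: Ann_def A_closed algebra_simps)
            then have "r * g \<in> max_ideal v" using Suc by blast
            then show "r \<in> max_ideal v"
              using not_max_ideal_mult ng A_in_place[OF r(1) v] A_in_place[OF gA v] by blast
          qed
          then have "Ann (g * f ^ i * c) \<subseteq> Ann c"
            using gA f c(1) Ann_mult[of "g * f ^ i"] by (intro max) (auto simp: A_closed)
          moreover have "f \<in> Ann (g * f ^ i * c)" using g f by (simp add: Ann_def algebra_simps)
          ultimately show False using nf by blast
        qed
      qed
    qed
    \<comment> \<open>The congruence puts \<open>1 - f ^ l\<close> into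
      \<open>Ann (f ^ i * c)\<close>, hence into the prime. As \<open>f\<close> is there too, so
      would be 1.\<close>
    obtain i l where l: "l > 0" "f ^ i * (1 - f ^ l) \<in> (*) a ` A" using power_congruence[OF a(1,2) f(1)] by blast
    have "f ^ i * (1 - f ^ l) * c \<in> (*) a ` A" using aA(2)[OF l(2) l(2) c(1)] .
    then have "1 - f ^ l \<in> Ann (f ^ i * c)" using f by (simp add: Ann_def A_closed algebra_simps)
    then have m1: "1 - f ^ l \<in> max_ideal v" using all by blast
    have "f ^ l = f * f ^ (l - 1)" using l(1) by (cases l) auto
    then have "f ^ l \<in> max_ideal v"
      using max_ideal_mult[OF is_place f(2), of "f ^ (l - 1)"] A_in_place[OF f(1) v] by (simp add: place_closed[OF is_place])
    from max_ideal_closed(1)[OF is_place m1 this] max_ideal_closed(4)[OF is_place] show False by simp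
  qed
  moreover have "c \<notin> (*) a ` A"
  proof
    assume "c \<in> (*) a ` A"
    then have "1 \<in> Ann c" using A_closed(2) by (simp add: Ann_def)
    then show False using c(3) max_ideal_closed(4)[OF is_place] by blast
  qed
  ultimately show ?thesis using c(1) by (auto simp only: Ann_def mem_Collect_eq)
qed

text \<open>The localisation of \<open>A\<close> at the prime of \<open>v\<close> has a principal maximal ideal, as \<open>A\<close> is integrally closed.\<close>

lemma prime_locally_principal:
  "\<exists>y\<in>A. \<exists>u\<in>A. y \<in> max_ideal v \<and> u \<notin> max_ideal v \<and> (\<forall>r\<in>A. r \<in> max_ideal v \<longrightarrow> (\<exists>b\<in>A. u * r = y * b))"
proof -
  obtain a where a: "a \<in> A" "a \<noteq> 0" "a \<in> max_ideal v" using nonzero_in_prime by blast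
  obtain c where c: "c \<in> A" "c \<notin> (*) a ` A" "\<And>r. r \<in> A \<Longrightarrow> r \<in> max_ideal v \<Longrightarrow> r * c \<in> (*) a ` A"
    using prime_is_annihilator[OF a] by blast
  \<comment> \<open>An element of the inverse of the prime that is not in \<open>A\<close>: it
    carries the prime into \<open>A\<close>.\<close>
  define z where "z = c / a"
  have zK: "z \<in> K" using a c by (auto simp: z_def intro: K_closed A_in_K)
  have "z \<notin> A" using c(2) a(2) by (auto simp: z_def image_iff)
  have zr: "z * r \<in> A" if r: "r \<in> A" "r \<in> max_ideal v" for r
  proof -
    obtain b where "b \<in> A" "r * c = a * b" using c(3)[OF r] by auto
    then have "z * r = b" using a(2) by (simp add: z_def field_simps)
    then show ?thesis using \<open>b \<in> A\<close> by simp
  qed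
  \<comment> \<open>If \<open>z\<close> mapped the prime into itself, all \<open>a * z ^ i\<close>
    would lie in \<open>A\<close>. A pole of \<open>z\<close> would then force \<open>a\<close> to
    vanish there to every order, so \<open>z\<close> would lie in \<open>A\<close>.\<close>
  have "\<exists>y\<in>A. y \<in> max_ideal v \<and> z * y \<notin> max_ideal v"
  proof (rule ccontr)
    assume H: "\<not> ?thesis"
    have az: "a * z ^ i \<in> A \<and> a * z ^ i \<in> max_ideal v" for i
    proof (induction i)
      case (Suc i)
      then show ?case using zr[of "a * z ^ i"] H by (auto simp: algebra_simps)
    qed (use a in auto)
    have "z \<in> w" if w: "w \<in> finite_places" for w
    proof (rule ccontr)
      assume nz: "z \<notin> w"
      note pw = finite_place[OF w]
      have z0: "z \<noteq> 0" using nz place_closed(1)[OF pw] by auto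
      have "inverse z \<in> max_ideal w" using nz place_total[OF pw zK] z0 by (simp add: max_ideal_iff[OF pw])
      then have "inverse z ^ n \<in> vball w (int n)" for n by (rule vball_power[OF pw])
      then have "inverse z ^ n * (a * z ^ n) \<in> vball w (int n)" for n
        using az A_in_place[OF _ w] by (intro vball_mult_place[OF pw]) auto
      moreover have "inverse z ^ n * (a * z ^ n) = a" for n
        using z0 by (simp add: field_simps)
      ultimately show False using vball_separated[OF pw a(2)] by simp
    qed
    then show False using A_I[OF zK] \<open>z \<notin> A\<close> by blast
  qed
  then obtain y where y: "y \<in> A" "y \<in> max_ideal v" "z * y \<notin> max_ideal v" by blast
  \<comment> \<open>The required \<open>u\<close> is \<open>z * y\<close>, with cofactor
    \<open>b = z * r\<close>.\<close>
  have "\<exists>b\<in>A. z * y * r = y * b" if "r \<in> A" "r \<in> max_ideal v" for r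
    using zr[OF that] by (intro bexI[of _ "z * r"]) auto
  then show ?thesis using y zr[OF y(1,2)] by blast
qed

end

text \<open>While \<open>b\<close> lies in the prime, \<open>u * b = y * b1\<close> replaces it by
  \<open>b1\<close>. The order at \<open>v\<close> drops by at least one each time because
  \<open>y / u\<close> vanishes at \<open>v\<close>, so the process stops.\<close>

lemma local_factorization:
  assumes v: "v \<in> finite_places" and y: "y \<in> A" "y \<in> max_ideal v" and u: "u \<in> A" "u \<notin> max_ideal v"
    and gen: "\<And>r. r \<in> A \<Longrightarrow> r \<in> max_ideal v \<Longrightarrow> \<exists>b\<in>A. u * r = y * b"
    and b: "b \<in> A" "b \<noteq> 0"
  shows "\<exists>i. \<exists>b'\<in>A. b' \<notin> max_ideal v \<and> u ^ i * b = y ^ i * b'"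
proof -
  note is_place = finite_place[OF v]
  have u': "u \<noteq> 0" "inverse u \<in> v" using u A_in_place[OF u(1) v] max_ideal_iff[OF is_place] by auto
  have "\<exists>i. \<exists>b'\<in>A. b' \<notin> max_ideal v \<and> u ^ i * b = y ^ i * b'" if "b \<notin> vball v (int N)" "b \<in> A" for N b
    using that
  proof (induction N arbitrary: b)
    case 0
    then show ?case using A_in_place[OF _ v] by (simp add: vball_place[OF is_place])
  next
    case (Suc N)
    show ?case
    proof (cases "b \<in> max_ideal v")
      case False
      then show ?thesis using Suc.prems by (intro exI[of _ 0] bexI[of _ b]) auto
    next
      case True
      then obtain b1 where b1: "b1 \<in> A" "u * b = y * b1" using gen Suc.prems by blast
      then have b_eq: "b = y * inverse u * b1" using u' by (simp add: field_simps)
      have "y * inverse u \<in> vball v 1"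
        using max_ideal_mult[OF is_place y(2) u'(2)] by (simp add: vball_max_ideal[OF is_place])
      from vball_closed(5)[OF is_place this, of b1 "int N"] have "b1 \<notin> vball v (int N)"
        using Suc.prems(1) b_eq by auto
      then obtain i b' where "b' \<in> A" "b' \<notin> max_ideal v" "u ^ i * b1 = y ^ i * b'"
        using Suc.IH b1(1) by blast
      moreover have "u ^ Suc i * b = u ^ i * (u * b)" by simp
      then have "u ^ Suc i * b = y * (u ^ i * b1)" using b1(2) by (simp add: algebra_simps)
      ultimately show ?thesis by (intro exI[of _ "Suc i"] bexI[of _ b']) auto
    qed
  qed
  then show ?thesis using vball_separated[OF is_place b(2)] b(1) by blast
qed

text \<open>Numerator and denominator of \<open>x\<close> are factored as powers of
  \<open>y / u\<close> times elements outside the common prime. Those elements are units at both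
  places; a negative exponent of \<open>y / u\<close> would contradict membership of
  \<open>x\<close> in \<open>v\<close>.\<close>

lemma place_le_if_same_prime:
  assumes v: "v \<in> finite_places" and w: "w \<in> finite_places" and same: "max_ideal v \<inter> A = max_ideal w \<inter> A"
  shows "v \<subseteq> w"
proof
  note pv = finite_place[OF v] and pw = finite_place[OF w]
  fix x assume x: "x \<in> v"
  show "x \<in> w"
  proof (cases "x = 0")
    case True
    then show ?thesis using place_closed(1)[OF pw] by simp
  next
    case False
    obtain d where d: "d \<in> A" "d \<noteq> 0" "d * x \<in> A" using fraction place_in_K[OF pv x] by blast
    obtain y u where yu: "y \<in> A" "u \<in> A" "y \<in> max_ideal v" "u \<notin> max_ideal v"
      "\<And>r. r \<in> A \<Longrightarrow> r \<in> max_ideal v \<Longrightarrow> \<exists>b\<in>A. u * r = y * b"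
      using prime_locally_principal[OF v] by blast
    obtain i b' where b': "b' \<in> A" "b' \<notin> max_ideal v" "u ^ i * (d * x) = y ^ i * b'"
      using local_factorization[OF v yu(1,3,2,4,5) d(3)] d(2) False by auto
    obtain j d' where d': "d' \<in> A" "d' \<notin> max_ideal v" "u ^ j * d = y ^ j * d'"
      using local_factorization[OF v yu(1,3,2,4,5) d(1,2)] by auto
    have units: "u \<noteq> 0" "b' \<noteq> 0" "d' \<noteq> 0" "inverse u \<in> v" "inverse u \<in> w" "inverse b' \<in> v" "inverse d' \<in> w"
      using yu(2,4) b'(1,2) d'(1,2) A_in_place v w same
      by (auto simp: max_ideal_iff[OF pv] max_ideal_iff[OF pw] place_closed[OF pv])
    obtain r where "r \<in> A" "r \<noteq> 0" "r \<in> max_ideal v" using nonzero_in_prime[OF v] by blast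
    then have y0: "y \<noteq> 0" using yu(5)[of r] units(1) by auto
    have "u ^ i * y ^ j * d' * x = u ^ j * y ^ i * b'"
    proof -
      have "u ^ i * y ^ j * d' * x = u ^ i * (y ^ j * d') * x" by (simp add: mult.assoc)
      also have "\<dots> = u ^ j * (u ^ i * (d * x))" unfolding d'(3)[symmetric] by (simp add: algebra_simps)
      finally show ?thesis unfolding b'(3) by (simp add: algebra_simps)
    qed
    then have eq: "x = (u ^ j * y ^ i * b') / (u ^ i * y ^ j * d')" using units y0 by (simp add: field_simps)
    show ?thesis
    proof (cases "j \<le> i")
      case True
      then obtain n where n: "i = j + n" using le_Suc_ex by blast
      have "x = (y * inverse u) ^ n * (b' * inverse d')"
        unfolding eq n using units y0 by (simp add: power_add field_simps)
      then show ?thesis using yu(1) b'(1) units A_in_place[OF _ w] by (auto intro!: place_closed[OF pw])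
    next
      case False
      then obtain n where n: "j = i + Suc n" using less_imp_Suc_add by (metis not_le add_Suc_right)
      have "y * ((inverse u) ^ Suc n * y ^ n * (d' * inverse b')) \<in> max_ideal v"
        using yu(1,3) d'(1) units A_in_place[OF _ v] by (intro max_ideal_mult[OF pv] place_closed[OF pv]) auto
      then have "y * ((inverse u) ^ Suc n * y ^ n * (d' * inverse b')) * x \<in> max_ideal v"
        using x by (rule max_ideal_mult[OF pv])
      also have "y * ((inverse u) ^ Suc n * y ^ n * (d' * inverse b')) * x = 1"
        unfolding eq n using units y0 by (simp add: power_add field_simps)
      finally show ?thesis using max_ideal_closed(4)[OF pv] by simp
    qed
  qed
qed

lemma prime_determines_place:
  assumes "v \<in> finite_places" "w \<in> finite_places" "max_ideal v \<inter> A = max_ideal w \<inter> A"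
  shows "v = w"
  using place_le_if_same_prime[OF assms] place_le_if_same_prime[OF assms(2,1) assms(3)[symmetric]] by blast

text \<open>Primes of finite places are maximal, so an inclusion between two of them is an equality,
  and equal primes give equal places.\<close>

lemma separate_places:
  assumes v: "v \<in> finite_places" and w: "w \<in> finite_places" and "v \<noteq> w"
  shows "\<exists>s\<in>A. s \<in> max_ideal w \<and> s \<notin> max_ideal v"
proof (rule ccontr)
  assume H: "\<not> ?thesis"
  have "s \<in> max_ideal w" if s: "s \<in> A" "s \<in> max_ideal v" for s
  proof (rule ccontr)
    assume "s \<notin> max_ideal w"
    then obtain r where r: "r \<in> A" "1 - s * r \<in> max_ideal w" using inverse_mod_prime[OF w] s by blast
    then have 1: "1 - s * r \<in> max_ideal v" using H s by (auto simp: A_closed)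
    have 2: "s * r \<in> max_ideal v" using max_ideal_mult[OF finite_place[OF v] s(2)] A_in_place[OF r(1) v] by blast
    from max_ideal_closed(1)[OF finite_place[OF v] 1 2] max_ideal_closed(4)[OF finite_place[OF v]] show False by simp
  qed
  with H have "max_ideal v \<inter> A = max_ideal w \<inter> A" by blast
  with prime_determines_place[OF v w] \<open>v \<noteq> w\<close> show False by blast
qed

text \<open>Different zeros of \<open>d\<close> yield different subgroups between \<open>d A\<close>
  and \<open>A\<close>.\<close>

lemma finite_zeros:
  assumes d: "d \<in> A" "d \<noteq> 0"
  shows "finite {w \<in> finite_places. d \<in> max_ideal w}" (is "finite ?W")
proof -
  have "(\<lambda>w. max_ideal w \<inter> A) ` ?W \<subseteq> {J. J \<subseteq> A \<and> (*) d ` A \<subseteq> J \<and> (\<forall>x\<in>J. \<forall>y\<in>J. x - y \<in> J)}"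
  proof (rule image_subsetI)
    fix w assume w: "w \<in> ?W"
    then have p: "w \<in> places k K" "w \<in> finite_places" "d \<in> max_ideal w" by (auto simp: finite_place)
    show "max_ideal w \<inter> A \<in> {J. J \<subseteq> A \<and> (*) d ` A \<subseteq> J \<and> (\<forall>x\<in>J. \<forall>y\<in>J. x - y \<in> J)}"
      using max_ideal_closed(2)[OF p(1)] max_ideal_mult[OF p(1,3)] A_in_place[OF _ p(2)] d(1)
      by (auto simp: A_closed)
  qed
  then have "finite ((\<lambda>w. max_ideal w \<inter> A) ` ?W)"
    by (rule finite_subset) (rule finite_subgroups_above[OF d A_subring A_subset_K])
  moreover have "inj_on (\<lambda>w. max_ideal w \<inter> A) ?W"
    using prime_determines_place by (intro inj_onI) auto
  ultimately show ?thesis by (rule finite_imageD)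
qed

text \<open>Every pole of \<open>x\<close> is a zero of a denominator of \<open>x\<close>.\<close>

lemma finite_poles:
  assumes "x \<in> K"
  shows "finite {w \<in> finite_places. x \<notin> w}"
proof -
  obtain d where d: "d \<in> A" "d \<noteq> 0" "d * x \<in> A" using fraction[OF assms] by blast
  have "d \<in> max_ideal w" if w: "w \<in> finite_places" "x \<notin> w" for w
  proof (rule ccontr)
    note pw = finite_place[OF w(1)]
    assume "d \<notin> max_ideal w"
    then have "inverse d \<in> w" using A_in_place[OF d(1) w(1)] by (auto simp: max_ideal_iff[OF pw])
    then have "inverse d * (d * x) \<in> w" using A_in_place[OF d(3) w(1)] by (rule place_closed[OF pw])
    moreover have "inverse d * (d * x) = x" using d(2) by (simp add: field_simps)
    ultimately show False using w(2) by simp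
  qed
  then have "{w \<in> finite_places. x \<notin> w} \<subseteq> {w \<in> finite_places. d \<in> max_ideal w}" by blast
  then show ?thesis using finite_zeros[OF d(1,2)] finite_subset by blast
qed

text \<open>Strong approximation at a single place. With \<open>d * x\<close> in \<open>A\<close>,
  take \<open>y = x * S * r\<close>: the factor \<open>S\<close> cancels the zeros of
  \<open>d\<close> away from \<open>v\<close>, and \<open>r\<close> inverts \<open>S\<close> at
  \<open>v\<close> closely enough that \<open>y - x\<close> is regular there.\<close>

lemma approximation_at_place:
  assumes v: "v \<in> finite_places" and x: "x \<in> K"
  shows "\<exists>y\<in>K. y - x \<in> v \<and> (\<forall>w\<in>finite_places - {v}. y \<in> w)"
proof -
  note pv = finite_place[OF v]
  obtain d where d: "d \<in> A" "d \<noteq> 0" "d * x \<in> A" using fraction[OF x] by blast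
  have dK: "d \<in> K" using A_in_K[OF d(1)] .
  define W where "W = {w \<in> finite_places. d \<in> max_ideal w} - {v}"
  have finW: "finite W" using finite_zeros[OF d(1,2)] by (simp add: W_def)
  \<comment> \<open>The exponent \<open>e\<close> exceeds the order of \<open>d\<close> at
    \<open>w\<close>; a power of \<open>s\<close> then cancels \<open>d\<close> at \<open>w\<close>
    while staying a unit at \<open>v\<close>.\<close>
  have "\<forall>w. \<exists>s e. w \<in> W \<longrightarrow> s \<in> A \<and> s \<in> max_ideal w \<and> s \<notin> max_ideal v \<and> d \<notin> vball w (int e)"
  proof
    fix w
    show "\<exists>s e. w \<in> W \<longrightarrow> s \<in> A \<and> s \<in> max_ideal w \<and> s \<notin> max_ideal v \<and> d \<notin> vball w (int e)"
      using separate_places[OF v, of w] vball_separated[OF finite_place d(2), of w] by (auto simp: W_def)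
  qed
  then obtain s e where se: "\<And>w. w \<in> W \<Longrightarrow> s w \<in> A \<and> s w \<in> max_ideal w \<and> s w \<notin> max_ideal v \<and> d \<notin> vball w (int (e w))"
    by metis
  define S where "S = (\<Prod>w\<in>W. s w ^ e w)"
  have SA: "S \<in> A" unfolding S_def using se by (intro subring_prod[OF A_subring] A_closed) auto
  have Sv: "S \<notin> max_ideal v"
  proof -
    have "(\<Prod>w\<in>W'. s w ^ e w) \<notin> max_ideal v" if "W' \<subseteq> W" for W'
      using finite_subset[OF that finW] that
    proof (induction W' rule: finite_induct)
      case empty
      then show ?case using max_ideal_closed(4)[OF pv] by simp
    next
      case (insert w W')
      have mem: "s w' \<in> v" if "w' \<in> W" for w' using se[OF that] A_in_place v by blast
      then have "(\<Prod>w\<in>W'. s w ^ e w) \<in> v"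
        using insert.prems by (intro subring_prod[OF place_subring[OF pv]] place_closed(7)[OF pv]) auto
      moreover have "s w ^ e w \<in> v" "s w ^ e w \<notin> max_ideal v"
        using insert.prems se[of w] mem[of w] by (simp_all add: not_max_ideal_power[OF v] place_closed(7)[OF pv])
      ultimately show ?case using insert not_max_ideal_mult[OF v] by simp
    qed
    then show ?thesis unfolding S_def by blast
  qed
  have Sd: "S / d \<in> w" if w: "w \<in> finite_places" "w \<noteq> v" for w
  proof (cases "w \<in> W")
    case True
    note pw = finite_place[OF w(1)]
    have "(\<Prod>w\<in>W - {w}. s w ^ e w) \<in> w"
      using se A_in_place[OF _ w(1)] by (intro subring_prod[OF place_subring[OF pw]] place_closed(7)[OF pw]) auto
    moreover have "s w ^ e w \<in> vball w (int (e w))" using se[OF True] by (intro vball_power[OF pw]) auto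
    ultimately have "S \<in> vball w (int (e w))"
      unfolding S_def prod.remove[OF finW True] by (intro vball_mult_place[OF pw])
    then show ?thesis using vball_quotient[OF pw _ dK] se[OF True] by blast
  next
    case False
    note pw = finite_place[OF w(1)]
    have "inverse d \<in> w" using False w A_in_place[OF d(1) w(1)] by (auto simp: W_def max_ideal_iff[OF pw])
    then show ?thesis using A_in_place[OF SA w(1)] place_closed(6)[OF pw] by (simp add: divide_inverse)
  qed
  obtain r0 where r0: "r0 \<in> A" "1 - S * r0 \<in> max_ideal v" using inverse_mod_prime[OF v SA Sv] by blast
  define h where "h = 1 - S * r0"
  have hA: "h \<in> A" using SA r0 by (auto simp: h_def A_closed)
  obtain N where N: "d \<notin> vball v (int N)" using vball_separated[OF pv d(2)] by blast
  \<comment> \<open>The geometric series improves the inverse \<open>r0\<close> of \<open>S\<close>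
    modulo the prime to one with error \<open>h ^ N\<close>; \<open>N\<close> exceeds the order of
    \<open>d\<close> at \<open>v\<close>.\<close>
  define r where "r = r0 * (\<Sum>i<N. h ^ i)"
  have rA: "r \<in> A" using hA r0 by (auto simp: r_def intro!: A_closed subring_sum[OF A_subring])
  have "S * r = (1 - h) * (\<Sum>i<N. h ^ i)" by (simp add: r_def h_def)
  also have "\<dots> = 1 - h ^ N" by (simp add: one_diff_power_eq)
  finally have Sr: "S * r = 1 - h ^ N" .
  define y where "y = x * S * r"
  have y_eq: "y = d * x * (S / d) * r" using d(2) by (simp add: y_def)
  have "h ^ N / d \<in> v"
    using vball_quotient[OF pv vball_power[OF pv] dK N] r0(2) by (simp add: h_def)
  then have "- (d * x * (h ^ N / d)) \<in> v"
    by (intro place_closed(4)[OF pv] place_closed(6)[OF pv A_in_place[OF d(3) v]])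
  moreover have "y - x = - (d * x * (h ^ N / d))" using d(2) Sr by (simp add: y_def mult.assoc right_diff_distrib)
  ultimately have "y - x \<in> v" by simp
  moreover have "y \<in> w" if "w \<in> finite_places - {v}" for w
  proof -
    have w: "w \<in> finite_places" "w \<noteq> v" using that by auto
    show ?thesis unfolding y_eq
      by (intro place_closed(6)[OF finite_place[OF w(1)]] A_in_place[OF d(3) w(1)] A_in_place[OF rA w(1)] Sd[OF w])
  qed
  moreover have "y \<in> K" using x SA rA by (auto simp: y_def intro!: K_closed intro: A_in_K)
  ultimately show ?thesis by blast
qed

end


section \<open>Quotient modules\<close>

lemma ring_module_simps [simp]:
  "carrier (ring_module h R) = carrier R" "add (ring_module h R) = add R" "zero (ring_module h R) = zero R"
  "smult (ring_module h R) = (\<lambda>a x. h a \<otimes>\<^bsub>R\<^esub> x)"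
  by (simp_all add: ring_module_def)

lemma ring_module_coset [simp]:
  "a_r_coset (ring_module h R) = a_r_coset R" "A_RCOSETS (ring_module h R) = A_RCOSETS R"
  "set_add (ring_module h R) = set_add R"
  by (simp_all add: a_r_coset_def' A_RCOSETS_def' set_add_def' fun_eq_iff)

lemma quotient_module_simps [simp]:
  "carrier (quotient_module M N) = a_rcosets\<^bsub>M\<^esub> N" "add (quotient_module M N) = set_add M"
  "zero (quotient_module M N) = N"
  "smult (quotient_module M N) = (\<lambda>a Y. \<Union>x\<in>Y. N +>\<^bsub>M\<^esub> (a \<odot>\<^bsub>M\<^esub> x))"
  by (simp_all add: quotient_module_def)

text \<open>The union over representatives in \<open>quotient_module\<close> collapses, so scalars
  act on any chosen representative.\<close>

lemma (in ring) coset_mult: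
  assumes N: "additive_subgroup N R" and c: "c \<in> carrier R" "\<And>n. n \<in> N \<Longrightarrow> c \<otimes> n \<in> N" and y: "y \<in> carrier R"
  shows "(\<Union>x\<in>N +> y. N +> (c \<otimes> x)) = N +> (c \<otimes> y)"
proof -
  interpret N: additive_subgroup N R by (rule N)
  interpret N: abelian_subgroup N R
    using abelian_subgroupI3[OF N] abelian_group_axioms by blast
  have "N +> (c \<otimes> x) = N +> (c \<otimes> y)" if "x \<in> N +> y" for x
  proof -
    obtain n where n: "n \<in> N" "x = n \<oplus> y" using \<open>x \<in> N +> y\<close> by (auto simp: a_r_coset_def')
    then have "c \<otimes> x = c \<otimes> n \<oplus> c \<otimes> y" using c y N.a_Hcarr by (simp add: r_distr)
    then have "c \<otimes> x \<in> N +> (c \<otimes> y)" using c(2)[OF n(1)] by (auto simp: a_r_coset_def')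
    then show ?thesis using N.a_repr_independence'[of "c \<otimes> x" "c \<otimes> y"] c(1) y by simp
  qed
  moreover have "y \<in> N +> y" using N.a_rcos_self[OF y] .
  ultimately show ?thesis by blast
qed

context function_field
begin

abbreviation cosetA :: "'c \<Rightarrow> 'c set"
  where "cosetA x \<equiv> A +>\<^bsub>subring_of K\<^esub> x"

lemma ring_K: "ring (subring_of K)"
  using ring.subring_is_ring[OF ring_ambient K_subring] .

lemma A_abelian_subgroup: "abelian_subgroup A (subring_of K)" and A_additive_subgroup: "additive_subgroup A (subring_of K)"
proof -
  interpret ring "subring_of K" by (rule ring_K)
  have inv: "\<ominus>\<^bsub>subring_of K\<^esub> x = - x" if "x \<in> A" for x
    using that A_in_K K_closed(4) by (intro minus_equality) auto
  show "additive_subgroup A (subring_of K)"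
  proof (rule additive_subgroup.intro, rule add.subgroupI)
    show "A \<noteq> {}" using A_closed(1) by blast
  qed (auto simp: inv A_in_K A_closed)
  then show "abelian_subgroup A (subring_of K)" using abelian_subgroupI3 abelian_group_axioms by blast
qed

lemma cosetA_mem: "y \<in> cosetA x \<longleftrightarrow> y - x \<in> A"
  by (auto simp: a_r_coset_def' intro!: bexI[of _ "y - x"])

lemma cosetA_eq_iff: "cosetA x = cosetA y \<longleftrightarrow> x - y \<in> A"
proof
  assume "cosetA x = cosetA y"
  moreover have "x \<in> cosetA x" by (simp add: cosetA_mem A_closed)
  ultimately show "x - y \<in> A" by (simp add: cosetA_mem)
next
  assume H: "x - y \<in> A"
  have "z - x \<in> A \<longleftrightarrow> z - y \<in> A" for z
    using A_closed(3)[of "z - x" "x - y"] A_closed(5)[of "z - y" "x - y"] H by auto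
  then show "cosetA x = cosetA y" by (auto simp: cosetA_mem)
qed

text \<open>Forming a coset uses addition only, so the cosets formed in \<open>subring_of S\<close>
  are those formed in \<open>subring_of K\<close>.\<close>

lemma cosetsA: "a_rcosets\<^bsub>subring_of S\<^esub> A = cosetA ` S"
  by (auto simp: A_RCOSETS_def' a_r_coset_def')

lemma cosetA_add: "x \<in> K \<Longrightarrow> y \<in> K \<Longrightarrow> cosetA x <+>\<^bsub>subring_of K\<^esub> cosetA y = cosetA (x + y)"
  using abelian_subgroup.a_rcos_sum[OF A_abelian_subgroup, of x y] by simp

lemma cosetA_smult:
  assumes "a \<in> A" "x \<in> K"
  shows "(\<Union>z\<in>cosetA x. A +>\<^bsub>subring_of K\<^esub> (a * z)) = cosetA (a * x)"
  using ring.coset_mult[OF ring_K A_additive_subgroup, of a x] assms by (simp add: A_in_K A_closed)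

end


section \<open>Completions\<close>

context function_field
begin

context
  fixes v assumes v: "v \<in> places k K"
begin

lemma null_seq_iff: "range s \<subseteq> K \<Longrightarrow> null_seq v s \<longleftrightarrow> (\<forall>N. \<exists>m. \<forall>i\<ge>m. s i \<in> vball v N)"
proof -
  assume "range s \<subseteq> K"
  then have "s i \<in> K" for i by auto
  then show ?thesis by (simp add: null_seq_def vball_def)
qed

lemma cauchy_seq_iff:
  "range s \<subseteq> K \<Longrightarrow> cauchy_seq v s \<longleftrightarrow> (\<forall>N. \<exists>m. \<forall>i\<ge>m. \<forall>j\<ge>m. s i - s j \<in> vball v N)"
proof -
  assume "range s \<subseteq> K"
  then have "s i - s j \<in> K" for i j by (auto intro: K_closed)
  then show ?thesis by (simp add: cauchy_seq_def vball_def)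
qed

lemma cauchy_mem: "s \<in> carrier (cauchy_ring K v) \<longleftrightarrow>
    range s \<subseteq> K \<and> (\<forall>N. \<exists>m. \<forall>i\<ge>m. \<forall>j\<ge>m. s i - s j \<in> vball v N)"
  using cauchy_seq_iff by (auto simp: cauchy_ring_def)

lemma null_mem: "s \<in> null_seqs K v \<longleftrightarrow> range s \<subseteq> K \<and> (\<forall>N. \<exists>m. \<forall>i\<ge>m. s i \<in> vball v N)"
  using null_seq_iff by (auto simp: null_seqs_def)

lemma cauchy_ring_simps [simp]:
  "s \<oplus>\<^bsub>cauchy_ring K v\<^esub> t = (\<lambda>i. s i + t i)" "s \<otimes>\<^bsub>cauchy_ring K v\<^esub> t = (\<lambda>i. s i * t i)"
  "\<zero>\<^bsub>cauchy_ring K v\<^esub> = (\<lambda>i. 0)" "\<one>\<^bsub>cauchy_ring K v\<^esub> = (\<lambda>i. 1)"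
  by (simp_all add: cauchy_ring_def)

lemma cauchyD: "s \<in> carrier (cauchy_ring K v) \<Longrightarrow> \<exists>m. \<forall>i\<ge>m. \<forall>j\<ge>m. s i - s j \<in> vball v N"
  by (simp add: cauchy_mem)

lemma nullD: "s \<in> null_seqs K v \<Longrightarrow> \<exists>m. \<forall>i\<ge>m. s i \<in> vball v N"
  by (simp add: null_mem)

lemma cauchy_in_K: "s \<in> carrier (cauchy_ring K v) \<Longrightarrow> s i \<in> K"
  by (auto simp: cauchy_ring_def)

lemma cauchy_bounded:
  assumes "s \<in> carrier (cauchy_ring K v)"
  shows "\<exists>m B. \<forall>i\<ge>m. s i \<in> vball v B"
proof -
  obtain m where m: "\<And>i j. i \<ge> m \<Longrightarrow> j \<ge> m \<Longrightarrow> s i - s j \<in> vball v 0"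
    using cauchyD[OF assms, of 0] by blast
  have "s m \<in> K" by (rule cauchy_in_K[OF assms])
  then obtain n where n: "s m \<in> vball v (- int n)" using vball_exhaust[OF v] by blast
  have "s i \<in> vball v (- int n)" if "i \<ge> m" for i
  proof -
    have "s i - s m \<in> vball v (- int n)" using m[OF that order_refl] vball_anti[OF v, of "- int n" 0] by auto
    from vball_closed(2)[OF v this n] show ?thesis by simp
  qed
  then show ?thesis by blast
qed

lemma const_cauchy: "x \<in> K \<Longrightarrow> (\<lambda>i. x) \<in> carrier (cauchy_ring K v)"
  by (auto simp: cauchy_mem vball_closed[OF v])

lemma null_cauchy: "s \<in> null_seqs K v \<Longrightarrow> s \<in> carrier (cauchy_ring K v)"
  unfolding cauchy_mem null_mem using vball_closed(4)[OF v] by meson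

lemma cauchy_add:
  assumes "s \<in> carrier (cauchy_ring K v)" "t \<in> carrier (cauchy_ring K v)"
  shows "(\<lambda>i. s i + t i) \<in> carrier (cauchy_ring K v)"
  unfolding cauchy_mem
proof (intro conjI allI)
  show "range (\<lambda>i. s i + t i) \<subseteq> K" using assms[THEN cauchy_in_K] by (auto simp: K_closed)
  fix N
  obtain m m' where "\<forall>i\<ge>m. \<forall>j\<ge>m. s i - s j \<in> vball v N" "\<forall>i\<ge>m'. \<forall>j\<ge>m'. t i - t j \<in> vball v N"
    using assms[THEN cauchyD] by meson
  then have "\<forall>i\<ge>max m m'. \<forall>j\<ge>max m m'. (s i - s j) + (t i - t j) \<in> vball v N"
    using vball_closed(2)[OF v] by auto
  then show "\<exists>m. \<forall>i\<ge>m. \<forall>j\<ge>m. (s i + t i) - (s j + t j) \<in> vball v N"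
    by (intro exI[of _ "max m m'"]) (simp add: algebra_simps)
qed

lemma cauchy_mult:
  assumes s: "s \<in> carrier (cauchy_ring K v)" and t: "t \<in> carrier (cauchy_ring K v)"
  shows "(\<lambda>i. s i * t i) \<in> carrier (cauchy_ring K v)"
  unfolding cauchy_mem
proof (intro conjI allI)
  show "range (\<lambda>i. s i * t i) \<subseteq> K" using assms[THEN cauchy_in_K] by (auto simp: K_closed)
  fix N
  obtain m B where m: "\<And>i. i \<ge> m \<Longrightarrow> s i \<in> vball v B" using cauchy_bounded[OF s] by blast
  obtain m' B' where m': "\<And>i. i \<ge> m' \<Longrightarrow> t i \<in> vball v B'" using cauchy_bounded[OF t] by blast
  obtain l where l: "\<And>i j. i \<ge> l \<Longrightarrow> j \<ge> l \<Longrightarrow> s i - s j \<in> vball v (N - B')"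
    using cauchyD[OF s] by meson
  obtain l' where l': "\<And>i j. i \<ge> l' \<Longrightarrow> j \<ge> l' \<Longrightarrow> t i - t j \<in> vball v (N - B)"
    using cauchyD[OF t] by meson
  show "\<exists>m. \<forall>i\<ge>m. \<forall>j\<ge>m. s i * t i - s j * t j \<in> vball v N"
  proof (intro exI[of _ "m + m' + l + l'"] allI impI)
    fix i j assume ij: "m + m' + l + l' \<le> i" "m + m' + l + l' \<le> j"
    have "s i * (t i - t j) \<in> vball v (B + (N - B))" using ij by (intro vball_closed(5)[OF v] m l') auto
    moreover have "(s i - s j) * t j \<in> vball v (N - B' + B')" using ij by (intro vball_closed(5)[OF v] m' l) auto
    ultimately have "s i * (t i - t j) + (s i - s j) * t j \<in> vball v N" by (intro vball_closed(2)[OF v]) auto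
    then show "s i * t i - s j * t j \<in> vball v N" by (simp add: algebra_simps)
  qed
qed

lemma null_mult:
  assumes s: "s \<in> null_seqs K v" and t: "t \<in> carrier (cauchy_ring K v)"
  shows "(\<lambda>i. s i * t i) \<in> null_seqs K v"
  unfolding null_mem
proof (intro conjI allI)
  show "range (\<lambda>i. s i * t i) \<subseteq> K"
    using cauchy_in_K[OF null_cauchy[OF s]] cauchy_in_K[OF t] by (auto simp: K_closed)
  fix N
  obtain m' B' where m': "\<And>i. i \<ge> m' \<Longrightarrow> t i \<in> vball v B'" using cauchy_bounded[OF t] by blast
  obtain l where l: "\<And>i. i \<ge> l \<Longrightarrow> s i \<in> vball v (N - B')" using nullD[OF s] by meson
  show "\<exists>m. \<forall>i\<ge>m. s i * t i \<in> vball v N"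
  proof (intro exI[of _ "m' + l"] allI impI)
    fix i assume "m' + l \<le> i"
    then have "s i * t i \<in> vball v (N - B' + B')" by (intro vball_closed(5)[OF v] m' l) auto
    then show "s i * t i \<in> vball v N" by simp
  qed
qed

lemma cauchy_ring_cring: "cring (cauchy_ring K v)"
proof (rule cringI)
  show "abelian_group (cauchy_ring K v)"
  proof (rule abelian_groupI)
    fix s assume s: "s \<in> carrier (cauchy_ring K v)"
    have "(\<lambda>i. (\<lambda>i. - 1) i * s i) \<in> carrier (cauchy_ring K v)"
      by (rule cauchy_mult[OF const_cauchy s]) (auto intro: K_closed)
    then show "\<exists>t\<in>carrier (cauchy_ring K v). t \<oplus>\<^bsub>cauchy_ring K v\<^esub> s = \<zero>\<^bsub>cauchy_ring K v\<^esub>"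
      by (intro bexI[of _ "\<lambda>i. - 1 * s i"]) auto
  qed (auto simp: cauchy_add const_cauchy K_closed add.assoc add.commute)
  show "Group.comm_monoid (cauchy_ring K v)"
    by (rule comm_monoidI) (auto simp: cauchy_mult const_cauchy K_closed algebra_simps)
qed (auto simp: algebra_simps)

lemma cauchy_a_inv:
  assumes s: "s \<in> carrier (cauchy_ring K v)"
  shows "\<ominus>\<^bsub>cauchy_ring K v\<^esub> s = (\<lambda>i. - s i)"
proof -
  interpret cring "cauchy_ring K v" by (rule cauchy_ring_cring)
  have "(\<lambda>i. (\<lambda>i. - 1) i * s i) \<in> carrier (cauchy_ring K v)"
    by (rule cauchy_mult[OF const_cauchy s]) (auto intro: K_closed)
  then show ?thesis using s by (intro minus_equality) auto
qed

lemma null_seqs_ideal: "ideal (null_seqs K v) (cauchy_ring K v)"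
proof -
  interpret cring "cauchy_ring K v" by (rule cauchy_ring_cring)
  show ?thesis
  proof (rule idealI)
    show "subgroup (null_seqs K v) (add_monoid (cauchy_ring K v))"
    proof (rule add.subgroupI)
      show "null_seqs K v \<subseteq> carrier (cauchy_ring K v)" using null_cauchy by auto
      have "(\<lambda>i. 0) \<in> null_seqs K v" by (auto simp: null_mem vball_closed[OF v] K_closed)
      then show "null_seqs K v \<noteq> {}" by blast
    next
      fix s assume s: "s \<in> null_seqs K v"
      then have "(\<lambda>i. - s i) \<in> null_seqs K v"
        unfolding null_mem using vball_closed(3)[OF v] K_closed(4) by (meson image_subset_iff rangeI)
      then show "\<ominus>\<^bsub>cauchy_ring K v\<^esub> s \<in> null_seqs K v"
        using cauchy_a_inv[OF null_cauchy[OF s]] by simp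
    next
      fix s t assume st: "s \<in> null_seqs K v" "t \<in> null_seqs K v"
      have "\<exists>m. \<forall>i\<ge>m. s i + t i \<in> vball v N" for N
      proof -
        obtain m m' where "\<forall>i\<ge>m. s i \<in> vball v N" "\<forall>i\<ge>m'. t i \<in> vball v N"
          using st[THEN nullD] by meson
        then show ?thesis using vball_closed(2)[OF v] by (intro exI[of _ "max m m'"]) auto
      qed
      then show "s \<oplus>\<^bsub>cauchy_ring K v\<^esub> t \<in> null_seqs K v"
        using st by (auto simp: null_mem intro!: K_closed)
    qed
  next
    fix s t assume st: "s \<in> null_seqs K v" "t \<in> carrier (cauchy_ring K v)"
    show "s \<otimes>\<^bsub>cauchy_ring K v\<^esub> t \<in> null_seqs K v" using null_mult[OF st] by simp
    then show "t \<otimes>\<^bsub>cauchy_ring K v\<^esub> s \<in> null_seqs K v" by (simp add: mult.commute)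
  qed (rule ring_axioms)
qed

interpretation C: cring "cauchy_ring K v" by (rule cauchy_ring_cring)
interpretation N: ideal "null_seqs K v" "cauchy_ring K v" by (rule null_seqs_ideal)
interpretation hat: cring "completion K v"
  unfolding completion_def by (rule N.quotient_is_cring[OF cauchy_ring_cring])

abbreviation cls :: "(nat \<Rightarrow> 'c) \<Rightarrow> (nat \<Rightarrow> 'c) set"
  where "cls s \<equiv> null_seqs K v +>\<^bsub>cauchy_ring K v\<^esub> s"

interpretation cls: ring_hom_ring "cauchy_ring K v" "completion K v" cls
  unfolding completion_def by (rule N.rcos_ring_hom_ring)

lemma carrier_completion: "carrier (completion K v) = cls ` carrier (cauchy_ring K v)"
  by (auto simp: completion_def FactRing_def A_RCOSETS_def')

lemma emb_cls: "completion_emb K v x = cls (\<lambda>i. x)"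
  by (simp add: completion_emb_def)

lemma emb_closed: "x \<in> K \<Longrightarrow> completion_emb K v x \<in> carrier (completion K v)"
  by (simp add: emb_cls const_cauchy)

lemma emb_hom:
  assumes "x \<in> K" "y \<in> K"
  shows "completion_emb K v (x + y) = completion_emb K v x \<oplus>\<^bsub>completion K v\<^esub> completion_emb K v y"
    "completion_emb K v (x * y) = completion_emb K v x \<otimes>\<^bsub>completion K v\<^esub> completion_emb K v y"
    "completion_emb K v (x - y) = completion_emb K v x \<ominus>\<^bsub>completion K v\<^esub> completion_emb K v y"
proof -
  note c = const_cauchy[OF assms(1)] const_cauchy[OF assms(2)]
  show "completion_emb K v (x + y) = completion_emb K v x \<oplus>\<^bsub>completion K v\<^esub> completion_emb K v y"
    using cls.hom_add[OF c] by (simp add: emb_cls)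
  show "completion_emb K v (x * y) = completion_emb K v x \<otimes>\<^bsub>completion K v\<^esub> completion_emb K v y"
    using cls.hom_mult[OF c] by (simp add: emb_cls)
  have "(\<lambda>i. x - y) = (\<lambda>i. x) \<oplus>\<^bsub>cauchy_ring K v\<^esub> \<ominus>\<^bsub>cauchy_ring K v\<^esub> (\<lambda>i. y)"
    using c by (simp add: cauchy_a_inv)
  then show "completion_emb K v (x - y) = completion_emb K v x \<ominus>\<^bsub>completion K v\<^esub> completion_emb K v y"
    using c unfolding emb_cls a_minus_def by (metis cls.hom_a_inv cls.hom_add C.a_inv_closed)
qed

lemma cls_mem: "u \<in> cls s \<longleftrightarrow> (\<lambda>i. u i - s i) \<in> null_seqs K v"
proof
  assume "u \<in> cls s"
  then obtain n where "n \<in> null_seqs K v" "u = (\<lambda>i. n i + s i)" by (auto simp: a_r_coset_def')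
  then show "(\<lambda>i. u i - s i) \<in> null_seqs K v" by simp
next
  assume "(\<lambda>i. u i - s i) \<in> null_seqs K v"
  then show "u \<in> cls s" by (auto simp: a_r_coset_def' intro!: bexI[of _ "\<lambda>i. u i - s i"])
qed

text \<open>As an image of sequences under the class map, the valuation ring inherits its subgroup
  structure from \<open>v\<close>.\<close>

lemma completion_ring_image: "completion_ring K v = cls ` {s \<in> carrier (cauchy_ring K v). range s \<subseteq> v}"
proof (intro equalityI subsetI)
  fix Y assume "Y \<in> completion_ring K v"
  then obtain s s' where s: "s \<in> carrier (cauchy_ring K v)" "Y = cls s" "s' \<in> cls s" "range s' \<subseteq> v"
    by (auto simp: completion_ring_def carrier_completion)
  then have "s' \<in> carrier (cauchy_ring K v)"
    using C.a_r_coset_subset_G[OF N.a_subset s(1)] by blast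
  moreover have "cls s = cls s'" using N.a_repr_independence'[OF s(3,1)] .
  ultimately show "Y \<in> cls ` {s \<in> carrier (cauchy_ring K v). range s \<subseteq> v}" using s by blast
next
  fix Y assume "Y \<in> cls ` {s \<in> carrier (cauchy_ring K v). range s \<subseteq> v}"
  then show "Y \<in> completion_ring K v"
    using N.a_rcos_self by (auto simp: completion_ring_def carrier_completion)
qed

text \<open>If \<open>x\<close> is a limit of elements of \<open>v\<close>, some term differs from
  \<open>x\<close> by an element of \<open>vball v 0\<close>, which is \<open>v\<close>
  itself.\<close>

lemma emb_in_completion_ring_iff:
  assumes "x \<in> K"
  shows "completion_emb K v x \<in> completion_ring K v \<longleftrightarrow> x \<in> v"
proof
  assume "x \<in> v"
  then show "completion_emb K v x \<in> completion_ring K v"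
    using const_cauchy[OF assms] by (auto simp: completion_ring_image emb_cls)
next
  assume "completion_emb K v x \<in> completion_ring K v"
  then obtain s where s: "s \<in> carrier (cauchy_ring K v)" "range s \<subseteq> v" "cls (\<lambda>i. x) = cls s"
    by (auto simp: completion_ring_image emb_cls)
  then have "(\<lambda>i. x) \<in> cls s" using N.a_rcos_self[OF const_cauchy[OF assms]] by simp
  then obtain m where "x - s m \<in> vball v 0" unfolding cls_mem using nullD by blast
  then have "x - s m + s m \<in> v" using s(2) vball_place[OF v] place_closed(3)[OF v, of "x - s m" "s m"] by auto
  then show "x \<in> v" by simp
qed

lemma completion_ring_subgroup: "additive_subgroup (completion_ring K v) (completion K v)"
proof -
  have "subgroup {s \<in> carrier (cauchy_ring K v). range s \<subseteq> v} (add_monoid (cauchy_ring K v))"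
  proof (rule C.add.subgroupI)
    have "(\<lambda>i. 0) \<in> {s \<in> carrier (cauchy_ring K v). range s \<subseteq> v}"
      by (auto simp: const_cauchy K_closed place_closed[OF v])
    then show "{s \<in> carrier (cauchy_ring K v). range s \<subseteq> v} \<noteq> {}" by blast
  next
    fix s assume s: "s \<in> {s \<in> carrier (cauchy_ring K v). range s \<subseteq> v}"
    then have "\<ominus>\<^bsub>cauchy_ring K v\<^esub> s = (\<lambda>i. - s i)" using cauchy_a_inv[of s] by simp
    moreover have "\<ominus>\<^bsub>cauchy_ring K v\<^esub> s \<in> carrier (cauchy_ring K v)" using s by simp
    ultimately show "\<ominus>\<^bsub>cauchy_ring K v\<^esub> s \<in> {s \<in> carrier (cauchy_ring K v). range s \<subseteq> v}"
      using s place_closed(4)[OF v] by auto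
  qed (auto simp: cauchy_add place_closed[OF v] image_subset_iff)
  then show ?thesis
    unfolding completion_ring_image by (intro additive_subgroup.intro cls.img_is_add_subgroup)
qed

interpretation O: additive_subgroup "completion_ring K v" "completion K v" by (rule completion_ring_subgroup)
interpretation O: abelian_subgroup "completion_ring K v" "completion K v"
  using abelian_subgroupI3[OF completion_ring_subgroup] hat.abelian_group_axioms by blast

text \<open>The class of \<open>x\<close> in the quotient of the completion by its valuation ring;
  \<open>localize\<close> is the same map on classes modulo \<open>A\<close>.\<close>

definition loc :: "'c \<Rightarrow> (nat \<Rightarrow> 'c) set set"
  where "loc x = completion_ring K v +>\<^bsub>completion K v\<^esub> completion_emb K v x"

lemma loc_eq_iff:
  assumes "x \<in> K" "y \<in> K"
  shows "loc x = loc y \<longleftrightarrow> x - y \<in> v"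
proof -
  have "loc x = loc y \<longleftrightarrow> completion_emb K v x \<ominus>\<^bsub>completion K v\<^esub> completion_emb K v y \<in> completion_ring K v"
  proof
    assume "loc x = loc y"
    then have "completion_emb K v x \<in> loc y" using O.a_rcos_self[OF emb_closed[OF assms(1)]] by (simp add: loc_def)
    then show "completion_emb K v x \<ominus>\<^bsub>completion K v\<^esub> completion_emb K v y \<in> completion_ring K v"
      using O.a_rcos_module_minus[OF hat.ring_axioms, of "completion_emb K v y" "completion_emb K v x"] emb_closed assms by (simp add: loc_def)
  next
    assume "completion_emb K v x \<ominus>\<^bsub>completion K v\<^esub> completion_emb K v y \<in> completion_ring K v"
    then have "completion_emb K v x \<in> loc y"
      using O.a_rcos_module_minus[OF hat.ring_axioms, of "completion_emb K v y" "completion_emb K v x"] emb_closed assms by (simp add: loc_def)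
    then show "loc x = loc y"
      using O.a_repr_independence'[of "completion_emb K v x" "completion_emb K v y"] emb_closed[OF assms(2)]
      by (simp add: loc_def)
  qed
  then show ?thesis using emb_in_completion_ring_iff[of "x - y"] emb_hom(3)[OF assms] assms by (simp add: K_closed)
qed

lemma loc_zero: "loc 0 = completion_ring K v"
proof -
  have "completion_emb K v 0 \<in> completion_ring K v"
    using emb_in_completion_ring_iff place_closed(1)[OF v] K_closed(1) by blast
  then show ?thesis unfolding loc_def by (rule O.a_rcos_const)
qed

lemma loc_eq_zero_iff: "x \<in> K \<Longrightarrow> loc x = completion_ring K v \<longleftrightarrow> x \<in> v"
  using loc_eq_iff[of x 0] by (simp add: loc_zero K_closed)

lemma loc_add: "x \<in> K \<Longrightarrow> y \<in> K \<Longrightarrow> loc x <+>\<^bsub>completion K v\<^esub> loc y = loc (x + y)"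
  using O.a_rcos_sum[OF emb_closed emb_closed] by (simp add: loc_def emb_hom)

lemma loc_smult:
  assumes "a \<in> v" "x \<in> K"
  shows "(\<Union>z\<in>loc x. completion_ring K v +>\<^bsub>completion K v\<^esub> (completion_emb K v a \<otimes>\<^bsub>completion K v\<^esub> z)) = loc (a * x)"
proof -
  have a: "a \<in> K" using assms place_in_K[OF v] by blast
  have "completion_emb K v a \<otimes>\<^bsub>completion K v\<^esub> n \<in> completion_ring K v" if "n \<in> completion_ring K v" for n
  proof -
    obtain s where s: "s \<in> carrier (cauchy_ring K v)" "range s \<subseteq> v" "n = cls s"
      using \<open>n \<in> completion_ring K v\<close> by (auto simp: completion_ring_image)
    have "completion_emb K v a \<otimes>\<^bsub>completion K v\<^esub> n = cls (\<lambda>i. a * s i)"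
      using cls.hom_mult[OF const_cauchy[OF a] s(1)] by (simp add: emb_cls s(3))
    moreover have "(\<lambda>i. a * s i) \<in> carrier (cauchy_ring K v)" using cauchy_mult[OF const_cauchy[OF a] s(1)] by simp
    moreover have "range (\<lambda>i. a * s i) \<subseteq> v" using s(2) assms(1) by (auto intro!: place_closed[OF v])
    ultimately show ?thesis by (auto simp: completion_ring_image)
  qed
  from hat.coset_mult[OF completion_ring_subgroup emb_closed[OF a] this emb_closed[OF assms(2)]]
  show ?thesis by (simp add: loc_def emb_hom[OF a assms(2)])
qed

text \<open>Density of \<open>K\<close>: a Cauchy sequence differs from one of its terms
  \<open>s m\<close>, taken as a constant, by an element of the valuation ring.\<close>

lemma loc_surj: "a_rcosets\<^bsub>completion K v\<^esub> (completion_ring K v) = loc ` K"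
proof (intro equalityI subsetI)
  fix Y assume "Y \<in> a_rcosets\<^bsub>completion K v\<^esub> (completion_ring K v)"
  then obtain s where s: "s \<in> carrier (cauchy_ring K v)" and Y: "Y = completion_ring K v +>\<^bsub>completion K v\<^esub> cls s"
    by (auto simp: A_RCOSETS_def' carrier_completion)
  obtain m where m: "\<And>i. i \<ge> m \<Longrightarrow> s i - s m \<in> vball v 0" using cauchyD[OF s, of 0] by blast
  \<comment> \<open>Zeroing the first \<open>m\<close> terms keeps the class and gives a
    representative with all values in \<open>v\<close>, as \<open>completion_ring\<close>
    demands.\<close>
  define t where "t i = (if i < m then 0 else s i - s m)" for i
  have sK: "s i \<in> K" for i by (rule cauchy_in_K[OF s])
  have tv: "range t \<subseteq> v" using m by (auto simp: t_def vball_place[OF v] place_closed[OF v])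
  have null: "(\<lambda>i. t i - (s i - s m)) \<in> null_seqs K v"
  proof -
    have "\<forall>i\<ge>m. t i - (s i - s m) \<in> vball v N" for N by (auto simp: t_def vball_closed[OF v])
    moreover have "range (\<lambda>i. t i - (s i - s m)) \<subseteq> K"
      using tv place_in_K[OF v] sK by (auto intro!: K_closed)
    ultimately show ?thesis unfolding null_mem by blast
  qed
  have d: "(\<lambda>i. s i - s m) \<in> carrier (cauchy_ring K v)"
    using cauchy_add[OF s const_cauchy[OF K_closed(4)[OF sK[of m]]]] by simp
  have tc: "t \<in> carrier (cauchy_ring K v)" using cauchy_add[OF null_cauchy[OF null] d] by simp
  have "t \<in> cls (\<lambda>i. s i - s m)" using null by (simp add: cls_mem)
  then have eq: "cls (\<lambda>i. s i - s m) = cls t" using N.a_repr_independence'[OF _ d] by blast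
  have "cls s = cls t \<oplus>\<^bsub>completion K v\<^esub> completion_emb K v (s m)"
    using cls.hom_add[OF d const_cauchy[OF sK[of m]]] by (simp add: emb_cls eq)
  moreover have "cls t \<in> completion_ring K v" using tc tv by (auto simp: completion_ring_image)
  ultimately have "cls s \<in> loc (s m)" by (auto simp: loc_def a_r_coset_def')
  then have "Y = loc (s m)"
    unfolding Y loc_def using O.a_repr_independence'[OF _ emb_closed[OF sK]] by blast
  then show "Y \<in> loc ` K" using sK by blast
next
  fix Y assume "Y \<in> loc ` K"
  then show "Y \<in> a_rcosets\<^bsub>completion K v\<^esub> (completion_ring K v)"
    using hat.a_rcosetsI[OF O.a_subset emb_closed] by (auto simp: loc_def)
qed

end

end


section \<open>Twisted polynomials\<close>

context function_field
begin

text \<open>Multiplication by \<open>x\<close> permutes the nonzero constants; comparing their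
  products gives \<open>x ^ (q - 1) = 1\<close>.\<close>

lemma power_q_constant:
  assumes "x \<in> k"
  shows "x ^ q = x"
proof (cases "x = 0")
  case True
  then show ?thesis using q_ge_2 by simp
next
  case False
  let ?S = "k - {0}"
  have "(*) x ` ?S = ?S"
  proof (intro equalityI subsetI)
    fix y assume "y \<in> ?S"
    then show "y \<in> (*) x ` ?S"
      using assms False subfield_closed(3)[OF k_subfield] by (auto intro!: image_eqI[of _ _ "y / x"])
  qed (use assms False subring_closed(6)[OF k_subring] in auto)
  moreover have "inj_on ((*) x) ?S" using False by (auto intro: inj_onI)
  ultimately have "prod (\<lambda>y. y) ?S = prod (\<lambda>y. x * y) ?S"
    using prod.reindex[of "(*) x" ?S "\<lambda>y. y"] by simp
  also have "\<dots> = x ^ card ?S * prod (\<lambda>y. y) ?S" by (simp add: prod.distrib)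
  finally have "x ^ card ?S = 1" using finite_constants by (simp add: prod_zero_iff)
  moreover have "q = Suc (card ?S)"
    unfolding q_def using card_Suc_Diff1[OF finite_constants subring_closed(1)[OF k_subring]] by simp
  ultimately show ?thesis by simp
qed

text \<open>
  The polynomial \<open>(X + 1)\<^sup>q - X\<^sup>q - 1\<close> has degree less than \<open>q\<close> and vanishes on all of \<open>k\<close>, hence it is zero.
\<close>

lemma frobenius_add: "(x + y :: 'c) ^ q = x ^ q + y ^ q"
proof -
  let ?g = "Polynomial.monom 1 q + 1 :: 'c poly"
  define f where "f = [:1, 1:] ^ q - ?g"
  have "degree ?g = q" using q_ge_2 by (simp add: degree_add_eq_left degree_monom_eq)
  moreover have "degree ([:1, 1 :: 'c:] ^ q) = q" by (rule degree_linear_power)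
  moreover have "Polynomial.lead_coeff ([:1, 1 :: 'c:] ^ q) = 1" by (simp add: lead_coeff_power)
  ultimately have "poly.coeff f q = 0" "degree f \<le> q"
    using q_ge_2 by (auto simp: f_def intro: degree_diff_le)
  have "f = 0"
  proof (rule ccontr)
    assume "f \<noteq> 0"
    then have "degree f \<noteq> q" using \<open>poly.coeff f q = 0\<close> by (metis leading_coeff_neq_0)
    have "k \<subseteq> {x. poly f x = 0}"
    proof
      fix x assume x: "x \<in> k"
      then have "1 + x \<in> k" using subring_closed[OF k_subring] by blast
      then show "x \<in> {x. poly f x = 0}"
        using power_q_constant[OF x] power_q_constant[of "1 + x"]
        by (simp add: f_def poly_monom)
    qed
    then have "card k \<le> card {x. poly f x = 0}" by (intro card_mono poly_roots_finite \<open>f \<noteq> 0\<close>)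
    also have "\<dots> \<le> degree f" by (rule card_poly_roots_bound[OF \<open>f \<noteq> 0\<close>])
    finally show False using \<open>degree f \<noteq> q\<close> \<open>degree f \<le> q\<close> by (simp add: q_def)
  qed
  then have "poly ([:1, 1:] ^ q) z = poly ?g z" for z by (simp add: f_def)
  then have 1: "(1 + z) ^ q = z ^ q + 1" for z :: 'c by (simp add: poly_monom)
  show ?thesis
  proof (cases "y = 0")
    case True
    then show ?thesis using q_ge_2 by simp
  next
    case False
    then have "x + y = y * (1 + x / y)" by (simp add: field_simps)
    then have "(x + y) ^ q = y ^ q * (1 + x / y) ^ q" by (simp only: power_mult_distrib)
    also have "\<dots> = x ^ q + y ^ q" unfolding 1 using False by (simp add: power_divide field_simps)
    finally show ?thesis .
  qed
qed

lemma frobenius_power_add: "(x + y :: 'c) ^ (q ^ i) = x ^ (q ^ i) + y ^ (q ^ i)"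
  by (induction i arbitrary: x y) (simp_all add: power_mult frobenius_add)

lemma frobenius_power_sum: "(sum f S :: 'c) ^ (q ^ i) = (\<Sum>s\<in>S. f s ^ (q ^ i))"
  using q_ge_2 by (induction S rule: infinite_finite_induct) (auto simp: frobenius_power_add)

lemma twisted_eval_bound: "degree (P :: 'c poly) \<le> N \<Longrightarrow> twisted_eval q P x = (\<Sum>i\<le>N. poly.coeff P i * x ^ (q ^ i))"
  unfolding twisted_eval_def by (rule sum.mono_neutral_left) (auto simp: coeff_eq_0)

lemma twisted_eval_add: "twisted_eval q P (x + y :: 'c) = twisted_eval q P x + twisted_eval q P y"
  by (simp add: twisted_eval_def frobenius_power_add distrib_left sum.distrib)

lemma twisted_eval_0 [simp]: "twisted_eval q P (0 :: 'c) = 0"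
  using twisted_eval_add[of P 0 0] by (simp only: add_0_left add_cancel_right_right)

lemma twisted_eval_sum: "twisted_eval q P (sum f S :: 'c) = (\<Sum>s\<in>S. twisted_eval q P (f s))"
  by (induction S rule: infinite_finite_induct) (auto simp: twisted_eval_add)

lemma twisted_eval_plus: "twisted_eval q (P + Q) (x :: 'c) = twisted_eval q P x + twisted_eval q Q x"
proof -
  let ?N = "max (degree P) (degree Q)"
  have "degree (P + Q) \<le> ?N" "degree P \<le> ?N" "degree Q \<le> ?N" by (auto intro: degree_add_le)
  then show ?thesis by (simp add: twisted_eval_bound[of _ ?N] sum.distrib distrib_right)
qed

lemma twisted_eval_zero_poly [simp]: "twisted_eval q 0 (x :: 'c) = 0"
  by (simp add: twisted_eval_def)

lemma twisted_eval_monom: "twisted_eval q (Polynomial.monom c n) (x :: 'c) = c * x ^ (q ^ n)"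
proof -
  have "twisted_eval q (Polynomial.monom c n) x = (\<Sum>i\<le>n. (if n = i then c else 0) * x ^ (q ^ i))"
    by (simp add: twisted_eval_bound[OF degree_monom_le])
  also have "\<dots> = (\<Sum>i\<le>n. if n = i then c * x ^ (q ^ i) else 0)" by (rule sum.cong) auto
  finally show ?thesis by simp
qed

lemma twisted_eval_sum_poly: "twisted_eval q (sum f S) (x :: 'c) = (\<Sum>s\<in>S. twisted_eval q (f s) x)"
  by (induction S rule: infinite_finite_induct) (auto simp: twisted_eval_plus)

text \<open>The twist by \<open>q ^ i\<close> in the product is exactly what additivity of Frobenius
  produces when the \<open>i\<close>-th power of \<tau> is moved past a sum.\<close>

lemma twisted_eval_mult: "twisted_eval q (twisted_mult q P Q) (x :: 'c) = twisted_eval q P (twisted_eval q Q x)"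
proof -
  have "twisted_eval q (twisted_mult q P Q) x =
      (\<Sum>i\<le>degree P. \<Sum>j\<le>degree Q. poly.coeff P i * poly.coeff Q j ^ (q ^ i) * x ^ (q ^ (i + j)))"
    by (simp add: twisted_mult_def twisted_eval_sum_poly twisted_eval_monom)
  also have "\<dots> = (\<Sum>i\<le>degree P. poly.coeff P i * (\<Sum>j\<le>degree Q. (poly.coeff Q j * x ^ (q ^ j)) ^ (q ^ i)))"
    unfolding sum_distrib_left
    by (intro sum.cong) (auto simp: power_mult_distrib power_add power_mult[symmetric] mult.commute mult.assoc)
  also have "\<dots> = twisted_eval q P (twisted_eval q Q x)"
    by (simp add: twisted_eval_def frobenius_power_sum)
  finally show ?thesis .
qed

lemma twisted_mult_bound:
  assumes "degree (P :: 'c poly) \<le> N"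
  shows "twisted_mult q P Q =
    (\<Sum>i\<le>N. \<Sum>j\<le>degree Q. Polynomial.monom (poly.coeff P i * poly.coeff Q j ^ (q ^ i)) (i + j))"
  unfolding twisted_mult_def using assms by (intro sum.mono_neutral_left) (auto simp: coeff_eq_0)

lemma twisted_mult_plus: "twisted_mult q (P + P') (Q :: 'c poly) = twisted_mult q P Q + twisted_mult q P' Q"
proof -
  let ?N = "max (degree P) (degree P')"
  have "degree (P + P') \<le> ?N" "degree P \<le> ?N" "degree P' \<le> ?N" by (auto intro: degree_add_le)
  then show ?thesis by (simp add: twisted_mult_bound[of _ ?N] sum.distrib distrib_right add_monom[symmetric])
qed

lemma twisted_mult_monom:
  "twisted_mult q (Polynomial.monom c n) (Q :: 'c poly) =
    (\<Sum>j\<le>degree Q. Polynomial.monom (c * poly.coeff Q j ^ (q ^ n)) (n + j))"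
proof -
  have "twisted_mult q (Polynomial.monom c n) Q = (\<Sum>i\<le>n. \<Sum>j\<le>degree Q.
      Polynomial.monom (poly.coeff (Polynomial.monom c n) i * poly.coeff Q j ^ (q ^ i)) (i + j))"
    by (rule twisted_mult_bound[OF degree_monom_le])
  also have "\<dots> = (\<Sum>i\<le>n. if n = i then \<Sum>j\<le>degree Q. Polynomial.monom (c * poly.coeff Q j ^ (q ^ i)) (i + j) else 0)"
    by (rule sum.cong) auto
  finally show ?thesis by simp
qed

lemma twisted_mult_zero [simp]: "twisted_mult q 0 (Q :: 'c poly) = 0"
  by (simp add: twisted_mult_def)

lemma twisted_mult_one: "twisted_mult q 1 (Q :: 'c poly) = Q"
  using twisted_mult_monom[of 1 0 Q] by (simp add: poly_as_sum_of_monoms monom_0 pCons_one)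

lemma coeff_twisted_mult:
  "poly.coeff (twisted_mult q P (Q :: 'c poly)) l =
    (\<Sum>i\<le>degree P. \<Sum>j\<le>degree Q. if i + j = l then poly.coeff P i * poly.coeff Q j ^ (q ^ i) else 0)"
  by (simp add: twisted_mult_def coeff_sum)

text \<open>Only the two top terms reach the top degree, and the Frobenius power of a nonzero
  coefficient is nonzero.\<close>

lemma twisted_mult_lead:
  assumes "P \<noteq> 0" "(Q :: 'c poly) \<noteq> 0"
  shows "degree (twisted_mult q P Q) = degree P + degree Q"
    and "Polynomial.lead_coeff (twisted_mult q P Q) =
      Polynomial.lead_coeff P * Polynomial.lead_coeff Q ^ (q ^ degree P)"
proof -
  have le: "degree (twisted_mult q P Q) \<le> degree P + degree Q"
    by (rule degree_le) (auto simp: coeff_twisted_mult intro!: sum.neutral)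
  have "poly.coeff (twisted_mult q P Q) (degree P + degree Q) = (\<Sum>i\<le>degree P. \<Sum>j\<le>degree Q.
      if i = degree P then if j = degree Q then poly.coeff P i * poly.coeff Q j ^ (q ^ i) else 0 else 0)"
    unfolding coeff_twisted_mult by (intro sum.cong refl) auto
  also have "\<dots> = (\<Sum>i\<le>degree P. if i = degree P then \<Sum>j\<le>degree Q.
      if j = degree Q then poly.coeff P i * poly.coeff Q j ^ (q ^ i) else 0 else 0)"
    by (intro sum.cong refl) auto
  also have "\<dots> = Polynomial.lead_coeff P * Polynomial.lead_coeff Q ^ (q ^ degree P)" by simp
  finally have c: "poly.coeff (twisted_mult q P Q) (degree P + degree Q) =
    Polynomial.lead_coeff P * Polynomial.lead_coeff Q ^ (q ^ degree P)" .
  moreover have "\<dots> \<noteq> 0" using assms by simp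
  ultimately show "degree (twisted_mult q P Q) = degree P + degree Q"
    using le le_degree[of "twisted_mult q P Q" "degree P + degree Q"] by simp
  then show "Polynomial.lead_coeff (twisted_mult q P Q) =
    Polynomial.lead_coeff P * Polynomial.lead_coeff Q ^ (q ^ degree P)" using c by simp
qed

context
  fixes L :: "'c set" assumes L: "subfield L ambient"
begin

lemmas L_closed = subring_closed[OF subfield_closed(1)[OF L]] subfield_closed(2,3)[OF L]

lemma twisted_ring_simps [simp]:
  "carrier (twisted_ring q L) = polys_over L" "x \<otimes>\<^bsub>twisted_ring q L\<^esub> y = twisted_mult q x y"
  "\<zero>\<^bsub>twisted_ring q L\<^esub> = 0" "x \<oplus>\<^bsub>twisted_ring q L\<^esub> y = x + y"
  by (simp_all add: twisted_ring_def polys_over_def)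

lemma twisted_mult_closed:
  assumes "P \<in> polys_over L" "Q \<in> polys_over L"
  shows "twisted_mult q P Q \<in> polys_over L"
  unfolding polys_over_iff coeff_twisted_mult
  using assms by (auto intro!: subring_sum[OF subfield_closed(1)[OF L]] simp: polys_over_iff L_closed)

lemmas L_polys = polys_over_closed[OF subfield_closed(1)[OF L]]

lemma twisted_ring_abelian_group: "abelian_group (twisted_ring q L)"
proof (rule abelian_groupI)
  fix P assume "P \<in> carrier (twisted_ring q L)"
  then show "\<exists>R\<in>carrier (twisted_ring q L). R \<oplus>\<^bsub>twisted_ring q L\<^esub> P = \<zero>\<^bsub>twisted_ring q L\<^esub>"
    by (intro bexI[of _ "- P"]) (auto simp: L_polys)
qed (auto simp: L_polys)

lemma twisted_ring_a_inv: "P \<in> polys_over L \<Longrightarrow> \<ominus>\<^bsub>twisted_ring q L\<^esub> P = - P"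
proof -
  interpret abelian_group "twisted_ring q L" by (rule twisted_ring_abelian_group)
  show "P \<in> polys_over L \<Longrightarrow> ?thesis" by (rule minus_equality) (auto simp: L_polys)
qed

lemma left_ideal_iff:
  "left_ideal J (twisted_ring q L) \<longleftrightarrow> J \<subseteq> polys_over L \<and> 0 \<in> J \<and>
     (\<forall>P\<in>J. \<forall>Q\<in>J. P + Q \<in> J) \<and> (\<forall>P\<in>polys_over L. \<forall>Q\<in>J. twisted_mult q P Q \<in> J)"
proof
  assume J: "left_ideal J (twisted_ring q L)"
  then interpret additive_subgroup J "twisted_ring q L" by (simp add: left_ideal_def)
  show "J \<subseteq> polys_over L \<and> 0 \<in> J \<and>
     (\<forall>P\<in>J. \<forall>Q\<in>J. P + Q \<in> J) \<and> (\<forall>P\<in>polys_over L. \<forall>Q\<in>J. twisted_mult q P Q \<in> J)"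
    using J a_subset zero_closed a_closed by (simp add: left_ideal_def)
next
  assume J: "J \<subseteq> polys_over L \<and> 0 \<in> J \<and>
     (\<forall>P\<in>J. \<forall>Q\<in>J. P + Q \<in> J) \<and> (\<forall>P\<in>polys_over L. \<forall>Q\<in>J. twisted_mult q P Q \<in> J)"
  interpret abelian_group "twisted_ring q L" by (rule twisted_ring_abelian_group)
  have "- P \<in> J" if "P \<in> J" for P
  proof -
    \<comment> \<open>Negation is left multiplication by the constant \<open>-1\<close>.\<close>
    have "twisted_mult q (Polynomial.monom (- 1) 0) P \<in> J"
      using J that L_polys(6)[of "- 1" 0] L_closed by blast
    also have "twisted_mult q (Polynomial.monom (- 1) 0) P = - P"
      unfolding twisted_mult_monom by (simp add: minus_monom[symmetric] sum_negf poly_as_sum_of_monoms)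
    finally show ?thesis .
  qed
  then have "additive_subgroup J (twisted_ring q L)"
    using J by (intro additive_subgroup.intro add.subgroupI) (auto simp: twisted_ring_a_inv subset_iff)
  then show "left_ideal J (twisted_ring q L)" using J by (simp add: left_ideal_def)
qed

lemma gen_left_ideal_is_left_ideal:
  assumes "S \<subseteq> polys_over L"
  shows "left_ideal (gen_left_ideal (twisted_ring q L) S) (twisted_ring q L)"
proof -
  have "left_ideal (polys_over L) (twisted_ring q L)"
    unfolding left_ideal_iff by (auto simp: L_polys twisted_mult_closed)
  then have "gen_left_ideal (twisted_ring q L) S \<subseteq> polys_over L" using assms by (auto simp: gen_left_ideal_def)
  then show ?thesis unfolding left_ideal_iff by (auto simp: gen_left_ideal_def left_ideal_iff)
qed

text \<open>Division with remainder on the right, by an element of minimal degree.\<close>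

lemma left_ideal_principal:
  assumes J: "left_ideal J (twisted_ring q L)" and ex: "\<exists>P\<in>J. P \<noteq> 0"
  shows "\<exists>!P. P \<in> polys_over L \<and> Polynomial.lead_coeff P = 1 \<and> J = (\<lambda>Q. twisted_mult q Q P) ` polys_over L"
proof -
  note JD = J[unfolded left_ideal_iff]
  obtain P0 where P0: "P0 \<in> J" "P0 \<noteq> 0" "\<And>P. P \<in> J \<Longrightarrow> P \<noteq> 0 \<Longrightarrow> degree P0 \<le> degree P"
    using ex_has_least_nat[of "\<lambda>P. P \<in> J \<and> P \<noteq> 0" _ degree] ex by blast
  define c where "c = Polynomial.lead_coeff P0"
  have c: "c \<noteq> 0" "c \<in> L" using P0(1,2) JD by (auto simp: c_def polys_over_iff)
  define P where "P = twisted_mult q (Polynomial.monom (inverse c) 0) P0"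
  have "Polynomial.monom (inverse c) 0 \<noteq> 0" using c by simp
  note lead = twisted_mult_lead[OF this P0(2)]
  have P: "P \<in> J" "Polynomial.lead_coeff P = 1" "degree P = degree P0"
    using JD P0(1) L_polys(6)[of "inverse c" 0] L_closed(8)[OF c(2)] lead c(1)
    by (auto simp: P_def c_def degree_monom_eq)
  have Pne: "P \<noteq> 0" using P(2) by auto
  have min: "degree P \<le> degree Q" if "Q \<in> J" "Q \<noteq> 0" for Q using P0(3)[OF that] P(3) by simp
  have div: "F \<in> J \<Longrightarrow> \<exists>Q\<in>polys_over L. F = twisted_mult q Q P" for F
  \<comment> \<open>Zero has degree 0 just as nonzero constants do; the measure places it strictly
    below them.\<close>
  proof (induction "if F = 0 then 0 else Suc (degree F)" arbitrary: F rule: less_induct)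
    case less
    show ?case
    proof (cases "F = 0")
      case True
      then show ?thesis by (intro bexI[of _ 0]) (auto simp: L_polys)
    next
      case False
      define n where "n = degree F - degree P"
      define b where "b = Polynomial.lead_coeff F"
      have b: "b \<noteq> 0" "b \<in> L" using False less.prems JD by (auto simp: b_def polys_over_iff)
      \<comment> \<open>\<open>P\<close> is monic, so the leading coefficient of \<open>M P\<close>
        is \<open>b\<close> and this one term cancels that of \<open>F\<close>.\<close>
      define M where "M = Polynomial.monom b n"
      have M: "M \<in> polys_over L" "M \<noteq> 0" "degree M = n" "Polynomial.lead_coeff M = b"
        using b by (auto simp: M_def L_polys degree_monom_eq)
      have deg: "degree F = n + degree P" using min[OF less.prems False] by (simp add: n_def)
      have mult: "degree (twisted_mult q M P) = degree F" "Polynomial.lead_coeff (twisted_mult q M P) = b"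
        using twisted_mult_lead[OF M(2) Pne] M(3,4) P(2) deg by auto
      define F' where "F' = F - twisted_mult q M P"
      have "- twisted_mult q M P = twisted_mult q (- M) P"
        using twisted_mult_plus[of M "- M" P] by (simp add: eq_neg_iff_add_eq_0 add.commute neg_eq_iff_add_eq_0)
      moreover have "twisted_mult q (- M) P \<in> J" using JD P(1) L_polys(3)[OF M(1)] by blast
      ultimately have "F + - twisted_mult q M P \<in> J" using JD less.prems by metis
      then have F': "F' \<in> J" by (simp add: F'_def)
      have "(if F' = 0 then 0 else Suc (degree F')) < (if F = 0 then 0 else Suc (degree F))"
      proof (cases "F' = 0")
        case False
        have "degree F' \<le> degree F" unfolding F'_def using mult(1) by (intro degree_diff_le) auto
        moreover have "poly.coeff F' (degree F) = 0" using mult by (simp add: F'_def b_def)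
        then have "degree F' \<noteq> degree F" using False by (metis leading_coeff_neq_0)
        ultimately show ?thesis using \<open>F \<noteq> 0\<close> False by simp
      qed (use \<open>F \<noteq> 0\<close> in simp)
      from less.hyps[OF this F'] obtain Q where "Q \<in> polys_over L" "F' = twisted_mult q Q P" by blast
      then show ?thesis using M(1)
        by (intro bexI[of _ "Q + M"]) (auto simp: twisted_mult_plus F'_def L_polys algebra_simps)
    qed
  qed
  show ?thesis
  proof (rule ex1I[of _ P])
    show "P \<in> polys_over L \<and> Polynomial.lead_coeff P = 1 \<and> J = (\<lambda>Q. twisted_mult q Q P) ` polys_over L"
      using P JD div by blast
  next
    fix R assume R: "R \<in> polys_over L \<and> Polynomial.lead_coeff R = 1 \<and> J = (\<lambda>Q. twisted_mult q Q R) ` polys_over L"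
    have "1 \<in> polys_over L" by (rule L_polys)
    then have "R \<in> J" using R twisted_mult_one by (metis image_eqI)
    then obtain Q where Q: "R = twisted_mult q Q P" using div by blast
    obtain Q' where Q': "P = twisted_mult q Q' R" using R P(1) by blast
    have Rne: "R \<noteq> 0" using R by auto
    have ne: "Q \<noteq> 0" "Q' \<noteq> 0" using Q Q' Rne Pne by auto
    \<comment> \<open>\<open>R\<close> and \<open>P\<close> are left multiples of each other and
      degrees add, so both cofactors are constants.\<close>
    have "degree Q = 0"
      using twisted_mult_lead(1)[OF ne(1) Pne] twisted_mult_lead(1)[OF ne(2) Rne]
      unfolding Q[symmetric] Q'[symmetric] by simp
    moreover have "Polynomial.lead_coeff Q = 1" using twisted_mult_lead(2)[OF ne(1) Pne] R P(2)
      unfolding Q[symmetric] by simp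
    ultimately have "Q = 1" by (auto elim!: degree_eq_zeroE simp: pCons_one)
    then show "R = P" using Q by (simp add: twisted_mult_one)
  qed
qed

lemma annihilator_left_ideal:
  "left_ideal {P \<in> polys_over L. twisted_eval q P z = 0} (twisted_ring q L)"
  unfolding left_ideal_iff by (auto simp: L_polys twisted_eval_plus twisted_eval_mult twisted_mult_closed)

end

end

context drinfeld_setting
begin

text \<open>The annihilator of \<open>z\<close> is a left ideal containing all
  \<open>\<Phi> a\<close>, hence also the generator. The nonzero \<open>a\<close> makes the
  generated left ideal nonzero, so that the description in \<open>ideal_generator\<close>
  denotes.\<close>

lemma torsionI:
  assumes \<Phi>: "drinfeld_module n \<Phi>" and I: "I \<subseteq> A" "a \<in> I" "a \<noteq> 0"
    and z: "z \<in> Lbar" "\<And>a. a \<in> I \<Longrightarrow> twisted_eval q (\<Phi> a) z = 0"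
  shows "z \<in> torsion \<Phi> I"
proof -
  note tw = twisted_ring_simps[OF L_subfield]
  have hom: "\<Phi> a \<in> polys_over L" if "a \<in> A" for a
    using \<Phi> that by (auto simp: drinfeld_module_def ring_hom_def Pi_iff tw)
  have sub: "\<Phi> ` I \<subseteq> polys_over L" using hom I(1) by blast
  let ?J = "gen_left_ideal (twisted_ring q L) (\<Phi> ` I)"
  have "poly.coeff (\<Phi> a) 0 = a" using \<Phi> I by (auto simp: drinfeld_module_def)
  then have "\<Phi> a \<noteq> 0" using I(3) by auto
  moreover have "\<Phi> a \<in> ?J" using I(2) by (auto simp: gen_left_ideal_def)
  ultimately have "\<exists>P\<in>?J. P \<noteq> 0" by blast
  from theI'[OF left_ideal_principal[OF L_subfield gen_left_ideal_is_left_ideal[OF L_subfield sub] this]]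
  have G: "ideal_generator \<Phi> I \<in> polys_over L" "?J = (\<lambda>Q. twisted_mult q Q (ideal_generator \<Phi> I)) ` polys_over L"
    unfolding ideal_generator_def tw by blast+
  have one: "1 \<in> polys_over L" by (rule polys_over_closed[OF subfield_closed(1)[OF L_subfield]])
  then have "ideal_generator \<Phi> I \<in> ?J" unfolding G(2) using twisted_mult_one by (metis image_eqI)
  moreover have "?J \<subseteq> {P \<in> polys_over L. twisted_eval q P z = 0}"
    using annihilator_left_ideal[OF L_subfield, of z] z(2) sub unfolding gen_left_ideal_def by blast
  ultimately show ?thesis using z(1) by (auto simp: torsion_def)
qed

lemma Lbar_subring: "subring Lbar ambient"
proof -
  interpret field "ambient :: 'c ring" by (rule field_ambient)
  show ?thesis using subfield_closed(1)[OF subfield_of_algebraics[OF L_subfield]]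
    by (simp add: Lbar_def over_def)
qed

lemma L_subset_Lbar: "L \<subseteq> Lbar"
proof -
  interpret field "ambient :: 'c ring" by (rule field_ambient)
  show ?thesis using algebraic_self[OF subfieldE(1)[OF L_subfield]] by (auto simp: Lbar_def over_def)
qed

end


section \<open>Identification of classes\<close>

lemma equivclp_map:
  assumes "\<And>a b. R a b \<Longrightarrow> S (f a) (f b)" "equivclp R x y"
  shows "equivclp S (f x) (f y)"
  using assms(2)
proof (induction rule: equivclp_induct)
  case base
  then show ?case by simp
next
  case (step y z)
  then have "S (f y) (f z) \<or> S (f z) (f y)" using assms(1) by blast
  with step show ?case by (metis equivclp_trans r_into_equivclp equivclp_sym)
qed

lemma equiv_equivclp: "equiv D {(x, y). x \<in> D \<and> y \<in> D \<and> equivclp r x y}"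
  by (intro equivI refl_onI symI transI) (auto intro: equivclp_trans equivclp_sym)

text \<open>Since \<open>g\<close> preserves and reflects the relations, it also matches the
  equivalences they generate and maps classes onto classes. A single corresponding pair then decides
  between classes, because they are disjoint.\<close>

lemma identified_viaI:
  assumes g: "bij_betw g D1 D2"
    and r: "\<And>x y. x \<in> D1 \<Longrightarrow> y \<in> D1 \<Longrightarrow> r1 x y \<longleftrightarrow> r2 (g x) (g y)"
    and c: "\<And>x y. x \<in> D1 \<Longrightarrow> y \<in> D2 \<Longrightarrow> c x y \<longleftrightarrow> y = g x"
  shows "identified_via c (equiv_classes D1 r1) (equiv_classes D2 r2)"
proof -
  define R1 where "R1 = (\<lambda>a b. a \<in> D1 \<and> b \<in> D1 \<and> r1 a b)"
  define R2 where "R2 = (\<lambda>a b. a \<in> D2 \<and> b \<in> D2 \<and> r2 a b)"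
  define E1 where "E1 = {(x, y). x \<in> D1 \<and> y \<in> D1 \<and> equivclp R1 x y}"
  define E2 where "E2 = {(x, y). x \<in> D2 \<and> y \<in> D2 \<and> equivclp R2 x y}"
  have E: "equiv D1 E1" "equiv D2 E2" unfolding E1_def E2_def by (rule equiv_equivclp)+
  have eq: "equiv_classes D1 r1 = D1 // E1" "equiv_classes D2 r2 = D2 // E2"
    by (simp_all add: equiv_classes_def E1_def E2_def R1_def R2_def)
  have gD: "g x \<in> D2" if "x \<in> D1" for x using that g bij_betwE by blast
  define g' where "g' = inv_into D1 g"
  have g': "g' y \<in> D1" "g (g' y) = y" if "y \<in> D2" for y
    using that g by (auto simp: g'_def bij_betw_def f_inv_into_f inv_into_into)
  have g'g: "g' (g x) = x" if "x \<in> D1" for x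
    using that g by (simp add: g'_def bij_betw_def inv_into_f_f)
  have R12: "R2 (g a) (g b)" if "R1 a b" for a b using that r gD by (auto simp: R1_def R2_def)
  have R21: "R1 (g' a) (g' b)" if "R2 a b" for a b using that r g' by (auto simp: R1_def R2_def)
  have E_iff: "(g x, g y) \<in> E2 \<longleftrightarrow> (x, y) \<in> E1" if "x \<in> D1" "y \<in> D1" for x y
  proof
    assume "(x, y) \<in> E1"
    then show "(g x, g y) \<in> E2" using equivclp_map[of R1 R2 g, OF R12] gD by (auto simp: E1_def E2_def)
  next
    assume "(g x, g y) \<in> E2"
    then have "equivclp R1 (g' (g x)) (g' (g y))"
      using equivclp_map[of R2 R1 g', OF R21] by (auto simp: E2_def)
    then show "(x, y) \<in> E1" using that g'g by (simp add: E1_def)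
  qed
  have img: "g ` (E1 `` {x}) = E2 `` {g x}" if x: "x \<in> D1" for x
  proof (intro equalityI subsetI)
    fix z assume "z \<in> g ` (E1 `` {x})"
    then obtain y where "z = g y" "(x, y) \<in> E1" by auto
    then show "z \<in> E2 `` {g x}" using E_iff x by (auto simp: E1_def)
  next
    fix z assume "z \<in> E2 `` {g x}"
    then have z: "(g x, z) \<in> E2" "z \<in> D2" by (auto simp: E2_def)
    then have "(x, g' z) \<in> E1" using E_iff[OF x g'(1)[OF z(2)]] g'(2) by simp
    then show "z \<in> g ` (E1 `` {x})" using g'(2)[OF z(2)] by (intro image_eqI[of _ _ "g' z"]) auto
  qed
  have "bij_betw ((`) g) (D1 // E1) (D2 // E2)"
  proof (rule bij_betw_imageI)
    show "inj_on ((`) g) (D1 // E1)"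
    proof (rule inj_onI)
      fix W Y assume "W \<in> D1 // E1" "Y \<in> D1 // E1" "g ` W = g ` Y"
      moreover have "W \<subseteq> D1" "Y \<subseteq> D1" using calculation(1,2) E(1) by (auto simp: quotient_def E1_def)
      ultimately show "W = Y" using g inj_on_image_eq_iff[of g D1 W Y] by (simp add: bij_betw_def)
    qed
    show "(`) g ` (D1 // E1) = D2 // E2"
    proof (intro equalityI subsetI)
      fix Z assume "Z \<in> (`) g ` (D1 // E1)"
      then obtain x where "x \<in> D1" "Z = g ` (E1 `` {x})" by (auto simp: quotient_def)
      then show "Z \<in> D2 // E2" using img gD by (auto simp: quotient_def)
    next
      fix Z assume "Z \<in> D2 // E2"
      then obtain z where z: "z \<in> D2" "Z = E2 `` {z}" by (auto simp: quotient_def)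
      then have "Z = g ` (E1 `` {g' z})" using img g' by simp
      then show "Z \<in> (`) g ` (D1 // E1)" using g'(1)[OF z(1)] by (auto simp: quotient_def)
    qed
  qed
  moreover have "g ` C = D \<longleftrightarrow> (\<exists>x\<in>C. \<exists>y\<in>D. c x y)" if C: "C \<in> D1 // E1" and D: "D \<in> D2 // E2" for C D
  proof -
    obtain x0 where x0: "x0 \<in> D1" "C = E1 `` {x0}" using C by (auto simp: quotient_def)
    obtain y0 where y0: "y0 \<in> D2" "D = E2 `` {y0}" using D by (auto simp: quotient_def)
    have sub: "C \<subseteq> D1" "D \<subseteq> D2" by (auto simp: x0 y0 E1_def E2_def)
    show ?thesis
    proof
      assume "g ` C = D"
      moreover have "x0 \<in> C" using x0 by (simp add: E1_def)
      ultimately show "\<exists>x\<in>C. \<exists>y\<in>D. c x y" using c sub by blast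
    next
      assume "\<exists>x\<in>C. \<exists>y\<in>D. c x y"
      then obtain x where x: "x \<in> C" "g x \<in> D" using c sub by blast
      have "g ` C \<in> D2 // E2" using img[OF x0(1)] gD[OF x0(1)] by (auto simp: x0(2) quotient_def)
      then show "g ` C = D" using quotient_disj[OF E(2) _ D] x by blast
    qed
  qed
  ultimately show ?thesis unfolding identified_via_def eq by (intro exI[of _ "(`) g"]) blast
qed


section \<open>Level structures and Tate modules\<close>

locale nonconstant_drinfeld_setting =
  drinfeld_setting k K Oinf nrm L + nonconstant_function_field k K Oinf t
  for k K Oinf :: "'c::field set" and nrm :: "'c \<Rightarrow> real" and L :: "'c set" and t :: 'c
begin

lemma local_quotient_carrier: "v \<in> finite_places \<Longrightarrow> carrier (local_quotient v) = loc v ` K"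
  by (simp add: local_quotient_def loc_surj finite_place)

lemma local_quotient_add:
  "v \<in> finite_places \<Longrightarrow> x \<in> K \<Longrightarrow> y \<in> K \<Longrightarrow> loc v x \<oplus>\<^bsub>local_quotient v\<^esub> loc v y = loc v (x + y)"
  by (simp add: local_quotient_def loc_add finite_place)

lemma local_quotient_smult:
  "v \<in> finite_places \<Longrightarrow> a \<in> A \<Longrightarrow> x \<in> K \<Longrightarrow> a \<odot>\<^bsub>local_quotient v\<^esub> loc v x = loc v (a * x)"
  by (simp add: local_quotient_def loc_smult finite_place A_in_place)

lemma localize_cosetA:
  assumes v: "v \<in> finite_places" and x: "x \<in> K"
  shows "localize v (cosetA x) = loc v x"
proof -
  have eq: "loc v y = loc v x" if "y \<in> cosetA x" for y
  proof -
    have d: "y - x \<in> A" using that by (simp add: cosetA_mem)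
    then have "y - x + x \<in> K" using x A_in_K by (intro K_closed(3)) auto
    then have "y \<in> K" by simp
    then show ?thesis using loc_eq_iff[OF finite_place[OF v], of y x] x A_in_place[OF d v] by simp
  qed
  have "(\<Union>y\<in>cosetA x. loc v y) = (\<Union>y\<in>cosetA x. loc v x)" by (rule SUP_cong[OF refl eq])
  moreover have "x \<in> cosetA x" by (simp add: cosetA_mem A_closed)
  ultimately show ?thesis unfolding localize_def loc_def[OF finite_place[OF v], symmetric] by auto
qed

section \<open>From local homomorphisms to homomorphisms on \<open>K / A\<close>\<close>

definition poles :: "'c \<Rightarrow> 'c set set"
  where "poles x = {v \<in> finite_places. x \<notin> v}"

lemma poles_finite: "x \<in> K \<Longrightarrow> finite (poles x)"
  unfolding poles_def by (rule finite_poles)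

lemma localize_poles:
  assumes "x \<in> K"
  shows "{v \<in> finite_places. localize v (cosetA x) \<noteq> completion_ring K v} = poles x"
proof -
  have "localize v (cosetA x) = completion_ring K v \<longleftrightarrow> x \<in> v" if "v \<in> finite_places" for v
    using localize_cosetA[OF that assms] loc_eq_zero_iff[OF finite_place[OF that] assms] by simp
  then show ?thesis by (auto simp: poles_def)
qed

text \<open>
  As \<open>loc v\<close> maps \<open>K\<close> onto \<open>K\<^sub>v / A\<^sub>v\<close>, conditions on the homomorphisms from \<open>K\<^sub>v / A\<^sub>v\<close> need to be
  stated for elements of \<open>K\<close> only.
\<close>

definition local_hom :: "('c \<Rightarrow> 'c poly) \<Rightarrow> 'c set \<Rightarrow> 'c set \<Rightarrow> ((nat \<Rightarrow> 'c) set set \<Rightarrow> 'c) \<Rightarrow> bool"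
  where "local_hom \<Phi> S v h \<longleftrightarrow> h \<in> extensional (carrier (local_quotient v)) \<and>
    (\<forall>x\<in>K. h (loc v x) \<in> S) \<and> (\<forall>x\<in>K. \<forall>y\<in>K. h (loc v (x + y)) = h (loc v x) + h (loc v y)) \<and>
    (\<forall>a\<in>A. \<forall>x\<in>K. h (loc v (a * x)) = twisted_eval q (\<Phi> a) (h (loc v x)))"

lemma local_tate_module_iff:
  assumes "v \<in> finite_places"
  shows "h \<in> local_tate_module \<Phi> v \<longleftrightarrow> local_hom \<Phi> (place_torsion \<Phi> v) v h"
  using assms
  by (simp add: local_tate_module_def module_hom_def local_hom_def local_quotient_carrier PiE_def Pi_iff
      points_def local_quotient_add local_quotient_smult cong: ball_cong) blast

lemma local_hom_zero:
  assumes "local_hom \<Phi> S v h" "v \<in> finite_places" "x \<in> v"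
  shows "h (loc v x) = 0"
proof -
  note pv = finite_place[OF assms(2)]
  have "loc v x = loc v 0" using loc_eq_iff[OF pv, of x 0] assms(3) place_in_K[OF pv] K_closed(1) by simp
  moreover have "h (loc v (0 + 0)) = h (loc v 0) + h (loc v 0)"
    using assms(1) K_closed(1) unfolding local_hom_def by blast
  ultimately show ?thesis by (simp only: add_0_left add_cancel_right_right)
qed

text \<open>The homomorphism on \<open>K / A\<close> assembled from a family of local ones through
  partial fractions.\<close>

definition local_sum :: "('c set \<Rightarrow> (nat \<Rightarrow> 'c) set set \<Rightarrow> 'c) \<Rightarrow> 'c \<Rightarrow> 'c"
  where "local_sum h x = (\<Sum>v\<in>poles x. h v (loc v x))"

text \<open>Regular places contribute zero, so sums for different elements may share one finite
  index set.\<close>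

lemma local_sum_superset:
  assumes h: "\<And>v. v \<in> finite_places \<Longrightarrow> local_hom \<Phi> (S v) v (h v)"
    and F: "finite F" "poles x \<subseteq> F" "F \<subseteq> finite_places"
  shows "local_sum h x = (\<Sum>v\<in>F. h v (loc v x))"
  unfolding local_sum_def
proof (rule sum.mono_neutral_left[OF F(1,2)], rule ballI)
  fix v assume v: "v \<in> F - poles x"
  then show "h v (loc v x) = 0"
    using F(3) by (intro local_hom_zero[OF h]) (auto simp: poles_def)
qed

lemma local_sum_add:
  assumes h: "\<And>v. v \<in> finite_places \<Longrightarrow> local_hom \<Phi> (S v) v (h v)" and xy: "x \<in> K" "y \<in> K"
  shows "local_sum h (x + y) = local_sum h x + local_sum h y"
proof -
  let ?F = "poles x \<union> poles y"
  have F: "finite ?F" "?F \<subseteq> finite_places" using poles_finite xy by (auto simp: poles_def)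
  have "poles (x + y) \<subseteq> ?F" using place_closed(3)[OF finite_place] by (auto simp: poles_def)
  then have "local_sum h (x + y) = (\<Sum>v\<in>?F. h v (loc v (x + y)))" using F by (intro local_sum_superset[OF h])
  also have "\<dots> = (\<Sum>v\<in>?F. h v (loc v x) + h v (loc v y))"
    using h F(2) xy unfolding local_hom_def by (intro sum.cong) auto
  also have "\<dots> = local_sum h x + local_sum h y"
    unfolding sum.distrib using F by (subst (1 2) local_sum_superset[OF h, of ?F]) auto
  finally show ?thesis .
qed

lemma local_sum_smult:
  assumes h: "\<And>v. v \<in> finite_places \<Longrightarrow> local_hom \<Phi> (S v) v (h v)" and xy: "a \<in> A" "x \<in> K"
  shows "local_sum h (a * x) = twisted_eval q (\<Phi> a) (local_sum h x)"
proof -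
  let ?F = "poles x"
  have F: "finite ?F" "?F \<subseteq> finite_places" using poles_finite xy by (auto simp: poles_def)
  have "poles (a * x) \<subseteq> ?F" using place_closed(6)[OF finite_place] A_in_place xy(1) by (auto simp: poles_def)
  then have "local_sum h (a * x) = (\<Sum>v\<in>?F. h v (loc v (a * x)))" using F by (intro local_sum_superset[OF h])
  also have "\<dots> = (\<Sum>v\<in>?F. twisted_eval q (\<Phi> a) (h v (loc v x)))"
    using h F(2) xy unfolding local_hom_def by (intro sum.cong) auto
  finally show ?thesis by (simp add: twisted_eval_sum local_sum_def)
qed

text \<open>
  The elements regular outside \<open>v\<close> and infinity represent all classes at \<open>v\<close>; modulo \<open>A\<close> they form the
  summand \<open>K\<^sub>v / A\<^sub>v\<close> of \<open>K / A\<close>.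
\<close>

definition apart :: "'c set \<Rightarrow> 'c \<Rightarrow> bool"
  where "apart v y \<longleftrightarrow> y \<in> K \<and> (\<forall>w\<in>finite_places - {v}. y \<in> w)"

lemma apart_exists:
  assumes "v \<in> finite_places" "x \<in> K"
  shows "\<exists>y. apart v y \<and> loc v y = loc v x"
  using approximation_at_place[OF assms] loc_eq_iff[OF finite_place[OF assms(1)]] assms(2)
  by (auto simp: apart_def)

text \<open>Only \<open>v\<close> can be a pole of \<open>y\<close>. This is how a local
  homomorphism is recovered from the global sum.\<close>

lemma local_sum_apart:
  assumes h: "\<And>v. v \<in> finite_places \<Longrightarrow> local_hom \<Phi> (S v) v (h v)" and v: "v \<in> finite_places" "apart v y"
  shows "local_sum h y = h v (loc v y)"
  using local_sum_superset[OF h, of "{v}" y] v by (auto simp: apart_def poles_def)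


section \<open>Homomorphisms on powers of \<open>K / A\<close>, in terms of representatives\<close>

definition tuple :: "nat \<Rightarrow> (nat \<Rightarrow> 'c) \<Rightarrow> nat \<Rightarrow> 'c set"
  where "tuple n x = (\<lambda>i\<in>{..<n}. cosetA (x i))"

lemma tuple_exists:
  assumes "W \<in> {..<n} \<rightarrow>\<^sub>E cosetA ` M"
  shows "\<exists>x. (\<forall>i<n. x i \<in> M) \<and> W = tuple n x"
proof -
  have "\<forall>i. \<exists>y. i < n \<longrightarrow> y \<in> M \<and> W i = cosetA y" using assms by (auto simp: PiE_iff)
  then obtain x where "\<And>i. i < n \<Longrightarrow> x i \<in> M \<and> W i = cosetA (x i)" by metis
  then show ?thesis using assms
    by (intro exI[of _ x] conjI extensionalityI[of _ "{..<n}"]) (auto simp: tuple_def PiE_iff)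
qed

lemma global_carrier: "carrier (global_quotient_power n) = {..<n} \<rightarrow>\<^sub>E cosetA ` K"
  by (simp add: global_quotient_power_def power_module_def cosetsA)

lemma tuple_mem: "(\<And>i. i < n \<Longrightarrow> x i \<in> K) \<Longrightarrow> tuple n x \<in> carrier (global_quotient_power n)"
  by (auto simp: global_carrier tuple_def)

lemma global_ball:
  "(\<forall>W\<in>carrier (global_quotient_power n). P W) \<longleftrightarrow> (\<forall>x. (\<forall>i<n. x i \<in> K) \<longrightarrow> P (tuple n x))"
  using tuple_exists[of _ n K] tuple_mem[of n] unfolding global_carrier by metis

lemma tuple_add:
  assumes "\<And>i. i < n \<Longrightarrow> x i \<in> K" "\<And>i. i < n \<Longrightarrow> y i \<in> K"
  shows "tuple n x \<oplus>\<^bsub>global_quotient_power n\<^esub> tuple n y = tuple n (\<lambda>i. x i + y i)"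
  using assms by (auto simp: global_quotient_power_def power_module_def tuple_def cosetA_add intro!: restrict_ext)

lemma tuple_smult:
  assumes "\<And>i. i < n \<Longrightarrow> x i \<in> K" "a \<in> A"
  shows "a \<odot>\<^bsub>global_quotient_power n\<^esub> tuple n x = tuple n (\<lambda>i. a * x i)"
  using assms by (simp add: global_quotient_power_def power_module_def tuple_def cosetA_smult cong: restrict_cong)

text \<open>The common extension of all \<open>level_of n \<zeta> I\<close> to the full power of
  \<open>K / A\<close>.\<close>

definition level :: "nat \<Rightarrow> (nat \<Rightarrow> 'c set \<Rightarrow> (nat \<Rightarrow> 'c) set set \<Rightarrow> 'c) \<Rightarrow> (nat \<Rightarrow> 'c set) \<Rightarrow> 'c"
  where "level n \<zeta> = (\<lambda>W\<in>carrier (global_quotient_power n).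
    \<Sum>i<n. \<Sum>v\<in>{v \<in> finite_places. localize v (W i) \<noteq> completion_ring K v}. \<zeta> i v (localize v (W i)))"

lemma level_tuple:
  assumes "\<And>i. i < n \<Longrightarrow> x i \<in> K"
  shows "level n \<zeta> (tuple n x) = (\<Sum>i<n. local_sum (\<zeta> i) (x i))"
proof -
  have "(\<Sum>v\<in>{v \<in> finite_places. localize v (tuple n x i) \<noteq> completion_ring K v}. \<zeta> i v (localize v (tuple n x i)))
    = local_sum (\<zeta> i) (x i)" if i: "i < n" for i
  proof -
    have "tuple n x i = cosetA (x i)" using i by (simp add: tuple_def)
    then show ?thesis unfolding local_sum_def using localize_poles[OF assms[OF i]] localize_cosetA[OF _ assms[OF i]]
      by (simp add: poles_def)
  qed
  then show ?thesis using tuple_mem[of n x, OF assms] by (simp add: level_def)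
qed

lemma cring_A: "cring (subring_of A)"
proof -
  interpret ring "subring_of A" using ring.subring_is_ring[OF ring_ambient A_subring] .
  show ?thesis
    by (rule cringI[OF is_abelian_group]) (auto intro!: comm_monoidI simp: A_closed algebra_simps)
qed

text \<open>A tuple with common denominator \<open>D\<close> lies in the part belonging to the
  principal ideal of \<open>D\<close>, so the conditions for all \<open>I\<close> together reach
  every argument.\<close>

lemma level_of_exhausts:
  assumes "\<rho> \<in> extensional (carrier (global_quotient_power n))"
  shows "(\<forall>I. ideal I (subring_of A) \<and> I \<noteq> {0} \<longrightarrow> restrict \<rho> (ideal_quotient_power n I) = level_of n \<zeta> I) \<longleftrightarrow>
    \<rho> = level n \<zeta>"
proof
  have sub: "ideal_quotient_power n I \<subseteq> carrier (global_quotient_power n)" for I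
    unfolding ideal_quotient_power_def global_carrier cosetsA by (intro PiE_mono) auto
  {
    assume "\<rho> = level n \<zeta>"
    then show "\<forall>I. ideal I (subring_of A) \<and> I \<noteq> {0} \<longrightarrow> restrict \<rho> (ideal_quotient_power n I) = level_of n \<zeta> I"
      using sub by (auto simp: level_def level_of_def restrict_def fun_eq_iff)
  next
    assume H: "\<forall>I. ideal I (subring_of A) \<and> I \<noteq> {0} \<longrightarrow> restrict \<rho> (ideal_quotient_power n I) = level_of n \<zeta> I"
    have "\<rho> W = level n \<zeta> W" if W: "W \<in> carrier (global_quotient_power n)" for W
    proof -
      obtain x where x: "\<And>i. i < n \<Longrightarrow> x i \<in> K" "W = tuple n x"
        using W tuple_exists unfolding global_carrier by blast
      have "\<forall>i. \<exists>d. i < n \<longrightarrow> d \<in> A \<and> d \<noteq> 0 \<and> d * x i \<in> A" using fraction x(1) by blast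
      then obtain d where d: "\<And>i. i < n \<Longrightarrow> d i \<in> A \<and> d i \<noteq> 0 \<and> d i * x i \<in> A" by metis
      define D where "D = prod d {..<n}"
      have D: "D \<in> A" "D \<noteq> 0" using d by (auto simp: D_def intro!: subring_prod[OF A_subring])
      have Dx: "D * x i \<in> A" if "i < n" for i
      proof -
        have "D * x i = prod d ({..<n} - {i}) * (d i * x i)"
          using that by (simp add: D_def prod.remove[of "{..<n}" i] algebra_simps)
        also have "\<dots> \<in> A"
          by (rule A_closed(6)[OF subring_prod[OF A_subring]]) (use d that in auto)
        finally show ?thesis .
      qed
      interpret cring "subring_of A" by (rule cring_A)
      let ?I = "PIdl\<^bsub>subring_of A\<^esub> D"
      have I: "ideal ?I (subring_of A)" using D(1) by (intro cgenideal_ideal) simp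
      have Imem: "?I = {a * D | a. a \<in> A}" by (simp add: cgenideal_def)
      have "1 * D \<in> ?I" unfolding Imem using A_closed(2) by blast
      then have "?I \<noteq> {0}" using D(2) by auto
      moreover have "W \<in> ideal_quotient_power n ?I"
        unfolding ideal_quotient_power_def cosetsA x(2)
      proof (rule PiE_I)
        fix i assume "i \<in> {..<n}"
        then have i: "i < n" by simp
        have "x i * b \<in> A" if "b \<in> ?I" for b
        proof -
          obtain a where "a \<in> A" "b = a * D" using \<open>b \<in> ?I\<close> unfolding Imem by blast
          then show ?thesis using A_closed(6)[of a "D * x i"] Dx[OF i] by (simp add: algebra_simps)
        qed
        then have "x i \<in> {x \<in> K. \<forall>a\<in>?I. x * a \<in> A}" using x(1)[OF i] by blast
        then show "tuple n x i \<in> cosetA ` {x \<in> K. \<forall>a\<in>?I. x * a \<in> A}" using i by (simp add: tuple_def)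
      qed (simp add: tuple_def)
      ultimately have "\<rho> W = level_of n \<zeta> ?I W" using H I by (metis restrict_apply')
      also have "\<dots> = level n \<zeta> W"
        using \<open>W \<in> ideal_quotient_power n ?I\<close> W by (simp add: level_of_def level_def)
      finally show ?thesis .
    qed
    then show "\<rho> = level n \<zeta>"
      using assms by (intro extensionalityI[of _ "carrier (global_quotient_power n)"]) (auto simp: level_def)
  }
qed

definition level_hom :: "nat \<Rightarrow> ('c \<Rightarrow> 'c poly) \<Rightarrow> 'c set \<Rightarrow> ((nat \<Rightarrow> 'c set) \<Rightarrow> 'c) \<Rightarrow> bool"
  where "level_hom n \<Phi> S \<rho> \<longleftrightarrow> \<rho> \<in> extensional (carrier (global_quotient_power n)) \<and>
    (\<forall>x. (\<forall>i<n. x i \<in> K) \<longrightarrow> \<rho> (tuple n x) \<in> S) \<and>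
    (\<forall>x y. (\<forall>i<n. x i \<in> K) \<longrightarrow> (\<forall>i<n. y i \<in> K) \<longrightarrow>
       \<rho> (tuple n (\<lambda>i. x i + y i)) = \<rho> (tuple n x) + \<rho> (tuple n y)) \<and>
    (\<forall>a\<in>A. \<forall>x. (\<forall>i<n. x i \<in> K) \<longrightarrow> \<rho> (tuple n (\<lambda>i. a * x i)) = twisted_eval q (\<Phi> a) (\<rho> (tuple n x)))"

lemma level_hom_add:
  assumes "level_hom n \<Phi> S \<rho>" "\<And>i. i < n \<Longrightarrow> x i \<in> K" "\<And>i. i < n \<Longrightarrow> y i \<in> K"
  shows "\<rho> (tuple n (\<lambda>i. x i + y i)) = \<rho> (tuple n x) + \<rho> (tuple n y)"
  using assms by (simp add: level_hom_def)

lemma level_hom_iff: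
  "\<rho> \<in> module_hom (subring_of A) (global_quotient_power n) (points \<Phi> S) \<longleftrightarrow> level_hom n \<Phi> S \<rho>"
proof -
  have "\<rho> \<in> module_hom (subring_of A) (global_quotient_power n) (points \<Phi> S) \<longleftrightarrow>
    \<rho> \<in> extensional (carrier (global_quotient_power n)) \<and> (\<forall>W\<in>carrier (global_quotient_power n). \<rho> W \<in> S) \<and>
    (\<forall>W\<in>carrier (global_quotient_power n). \<forall>Y\<in>carrier (global_quotient_power n).
       \<rho> (W \<oplus>\<^bsub>global_quotient_power n\<^esub> Y) = \<rho> W + \<rho> Y) \<and>
    (\<forall>a\<in>A. \<forall>W\<in>carrier (global_quotient_power n).
       \<rho> (a \<odot>\<^bsub>global_quotient_power n\<^esub> W) = twisted_eval q (\<Phi> a) (\<rho> W))"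
    by (auto simp: module_hom_def PiE_def Pi_iff points_def)
  also have "\<dots> \<longleftrightarrow> level_hom n \<Phi> S \<rho>"
    unfolding global_ball level_hom_def by (simp add: tuple_add tuple_smult)
  finally show ?thesis .
qed

definition unit_tuple :: "nat \<Rightarrow> 'c \<Rightarrow> nat \<Rightarrow> 'c"
  where "unit_tuple i y = (\<lambda>j. if j = i then y else 0)"

lemma unit_tuple_in_K: "y \<in> K \<Longrightarrow> unit_tuple i y j \<in> K"
  by (simp add: unit_tuple_def K_closed)

lemma level_unit_tuple:
  assumes "i < n" "y \<in> K"
  shows "level n \<zeta> (tuple n (unit_tuple i y)) = local_sum (\<zeta> i) y"
proof -
  have "poles 0 = {}" using place_closed(1)[OF finite_place] by (auto simp: poles_def)
  then have 0: "local_sum h 0 = 0" for h by (simp add: local_sum_def)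
  have "level n \<zeta> (tuple n (unit_tuple i y)) = (\<Sum>j<n. local_sum (\<zeta> j) (unit_tuple i y j))"
    using unit_tuple_in_K[OF assms(2)] by (intro level_tuple)
  also have "\<dots> = (\<Sum>j<n. if j = i then local_sum (\<zeta> j) y else 0)"
    by (intro sum.cong) (auto simp: unit_tuple_def 0)
  finally show ?thesis using assms(1) by simp
qed

section \<open>From a level structure back to the Tate module\<close>

context
  fixes n \<Phi> S \<rho>
  assumes \<rho>: "level_hom n \<Phi> S \<rho>"
begin

text \<open>The restriction of \<open>\<rho>\<close> to the \<open>i\<close>-th summand, pulled back
  from \<open>K / A\<close> to \<open>K\<close>.\<close>

definition component :: "nat \<Rightarrow> 'c \<Rightarrow> 'c"
  where "component i y = \<rho> (tuple n (unit_tuple i y))"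

lemma component_mem: "y \<in> K \<Longrightarrow> component i y \<in> S"
  using \<rho> unit_tuple_in_K by (simp add: level_hom_def component_def)

lemma component_add: "x \<in> K \<Longrightarrow> y \<in> K \<Longrightarrow> component i (x + y) = component i x + component i y"
proof -
  assume xy: "x \<in> K" "y \<in> K"
  have "unit_tuple i (x + y) = (\<lambda>j. unit_tuple i x j + unit_tuple i y j)" by (auto simp: unit_tuple_def)
  then show ?thesis using \<rho> unit_tuple_in_K xy by (simp add: level_hom_def component_def)
qed

lemma component_smult: "a \<in> A \<Longrightarrow> x \<in> K \<Longrightarrow> component i (a * x) = twisted_eval q (\<Phi> a) (component i x)"
proof -
  assume ax: "a \<in> A" "x \<in> K"
  have "unit_tuple i (a * x) = (\<lambda>j. a * unit_tuple i x j)" by (auto simp: unit_tuple_def)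
  then show ?thesis using \<rho> unit_tuple_in_K ax by (simp add: level_hom_def component_def)
qed

lemma component_zero: "x \<in> A \<Longrightarrow> component i x = 0"
proof -
  assume x: "x \<in> A"
  have "tuple n (unit_tuple i x) = tuple n (unit_tuple i 0)"
    unfolding tuple_def by (rule restrict_ext) (use x in \<open>simp add: unit_tuple_def cosetA_eq_iff A_closed\<close>)
  moreover have "component i (0 + 0) = component i 0 + component i 0" by (rule component_add) (simp_all add: K_closed)
  then have "component i 0 = 0" by (simp only: add_0_left add_cancel_right_right)
  ultimately show ?thesis by (simp add: component_def)
qed

lemma component_sum: "(\<And>v. v \<in> F \<Longrightarrow> f v \<in> K) \<Longrightarrow> component i (sum f F) = (\<Sum>v\<in>F. component i (f v))"
proof (induction F rule: infinite_finite_induct)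
  case (insert v F)
  then show ?case by (simp add: component_add subring_sum[OF K_subring])
qed (simp_all add: component_zero A_closed)

lemma component_cong:
  assumes "x \<in> K" "y \<in> K" "x - y \<in> A"
  shows "component i x = component i y"
  using component_add[of "x - y" y i] component_zero[OF assms(3)] assms by (simp add: A_in_K)

lemma level_hom_components:
  assumes "\<And>i. i < n \<Longrightarrow> x i \<in> K"
  shows "\<rho> (tuple n x) = (\<Sum>i<n. component i (x i))"
proof -
  \<comment> \<open>Coordinates are switched on one at a time, each adding one unit tuple.\<close>
  have "\<rho> (tuple n (\<lambda>i. if i < m then x i else 0)) = (\<Sum>i<m. component i (x i))" if "m \<le> n" for m
    using that
  proof (induction m)
    case 0
    have "(\<lambda>i. if i < 0 then x i else 0) = unit_tuple 0 0" by (auto simp: unit_tuple_def)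
    then show ?case using component_zero[OF A_closed(1), of 0] by (simp add: component_def)
  next
    case (Suc m)
    have "(\<lambda>i. if i < Suc m then x i else 0) = (\<lambda>i. (if i < m then x i else 0) + unit_tuple m (x m) i)"
      by (auto simp: unit_tuple_def less_Suc_eq)
    moreover have "\<rho> (tuple n (\<lambda>i. (if i < m then x i else 0) + unit_tuple m (x m) i)) =
        \<rho> (tuple n (\<lambda>i. if i < m then x i else 0)) + \<rho> (tuple n (unit_tuple m (x m)))"
    proof -
      have "\<forall>i<n. (if i < m then x i else 0) \<in> K" using assms by (simp add: K_closed)
      moreover have "\<forall>i<n. unit_tuple m (x m) i \<in> K" using assms Suc.prems by (simp add: unit_tuple_in_K)
      ultimately show ?thesis by (intro level_hom_add[OF \<rho>]) blast+
    qed
    ultimately show ?case using Suc by (simp add: component_def)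
  qed
  from this[of n] have "\<rho> (tuple n (\<lambda>i. if i < n then x i else 0)) = (\<Sum>i<n. component i (x i))" by simp
  moreover have "tuple n (\<lambda>i. if i < n then x i else 0) = tuple n x"
    unfolding tuple_def by (rule restrict_ext) simp
  ultimately show ?thesis by simp
qed

text \<open>Embeds the local quotient at \<open>v\<close> into \<open>K / A\<close> through
  representatives regular at the other finite places. The choice is harmless: two such
  representatives differ by an element of \<open>A\<close>.\<close>

definition tate_components :: "nat \<Rightarrow> 'c set \<Rightarrow> (nat \<Rightarrow> 'c) set set \<Rightarrow> 'c"
  where "tate_components = (\<lambda>i\<in>{..<n}. \<lambda>v\<in>finite_places. \<lambda>Y\<in>carrier (local_quotient v).
    component i (SOME y. apart v y \<and> loc v y = Y))"

lemma tate_components_apart: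
  assumes "i < n" "v \<in> finite_places" "apart v y"
  shows "tate_components i v (loc v y) = component i y"
proof -
  note pv = finite_place[OF assms(2)]
  define z where "z = (SOME z. apart v z \<and> loc v z = loc v y)"
  have z: "apart v z \<and> loc v z = loc v y"
    unfolding z_def by (rule someI[of _ y]) (simp add: assms)
  have "z \<in> K" "y \<in> K" using z assms(3) by (auto simp: apart_def)
  then have "z - y \<in> v" using z loc_eq_iff[OF pv] by simp
  moreover have "z - y \<in> w" if "w \<in> finite_places" "w \<noteq> v" for w
    using that z assms(3) by (auto simp: apart_def intro!: place_closed(5)[OF finite_place])
  ultimately have "z - y \<in> A" using \<open>z \<in> K\<close> \<open>y \<in> K\<close> by (metis A_I K_closed(5))
  then have "component i z = component i y" using \<open>z \<in> K\<close> \<open>y \<in> K\<close> by (rule component_cong[rotated 2])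
  then show ?thesis using assms(1,2) \<open>y \<in> K\<close> by (simp add: tate_components_def local_quotient_carrier z_def)
qed

text \<open>Elements regular away from \<open>v\<close> are closed under addition and under
  multiplication by \<open>A\<close>, so chosen representatives can be combined. \<open>T\<close>
  will be the torsion at \<open>v\<close>.\<close>

lemma tate_components_local_hom:
  assumes "i < n" "v \<in> finite_places" and T: "\<And>y. apart v y \<Longrightarrow> component i y \<in> T"
  shows "local_hom \<Phi> T v (tate_components i v)"
proof -
  note pv = finite_place[OF assms(2)]
  note val = tate_components_apart[OF assms(1,2)]
  show ?thesis
    unfolding local_hom_def
  proof (intro conjI ballI)
    show "tate_components i v \<in> extensional (carrier (local_quotient v))"
      using assms by (simp add: tate_components_def)
  next
    fix x assume "x \<in> K"
    then show "tate_components i v (loc v x) \<in> T" using apart_exists[OF assms(2), of x] val T by metis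
  next
    fix x y assume xy: "x \<in> K" "y \<in> K"
    obtain x' y' where x': "apart v x'" "loc v x' = loc v x" and y': "apart v y'" "loc v y' = loc v y"
      using apart_exists[OF assms(2)] xy by meson
    have K: "x' \<in> K" "y' \<in> K" using x' y' by (auto simp: apart_def)
    have s: "apart v (x' + y')"
      using x' y' place_closed(3)[OF finite_place] by (auto simp: apart_def K_closed)
    have "loc v (x + y) = loc v (x' + y')"
      using local_quotient_add[OF assms(2) xy] local_quotient_add[OF assms(2) K] x' y' by simp
    then have "tate_components i v (loc v (x + y)) = component i x' + component i y'"
      using val[OF s] component_add[OF K] by simp
    then show "tate_components i v (loc v (x + y)) = tate_components i v (loc v x) + tate_components i v (loc v y)"
      using val[OF x'(1)] val[OF y'(1)] x' y' by simp
  next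
    fix a x assume ax: "a \<in> A" "x \<in> K"
    obtain x' where x': "apart v x'" "loc v x' = loc v x"
      using apart_exists[OF assms(2)] ax by meson
    have K: "x' \<in> K" using x' by (auto simp: apart_def)
    have s: "apart v (a * x')"
      using x' place_closed(6)[OF finite_place] A_in_place[OF ax(1)] by (auto simp: apart_def K_closed A_in_K ax)
    have "loc v (a * x) = loc v (a * x')"
      using local_quotient_smult[OF assms(2) ax] local_quotient_smult[OF assms(2) ax(1) K] x' by simp
    then show "tate_components i v (loc v (a * x)) = twisted_eval q (\<Phi> a) (tate_components i v (loc v x))"
      using val[OF s] component_smult[OF ax(1) K] val[OF x'(1)] x' by simp
  qed
qed

text \<open>Partial fractions: subtracting from \<open>y\<close> one representative for each pole
  leaves an element regular at all finite places, on which the components vanish.\<close>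

lemma level_tate_components: "level n tate_components = \<rho>"
proof (rule extensionalityI[of _ "carrier (global_quotient_power n)"])
  fix W assume "W \<in> carrier (global_quotient_power n)"
  then obtain x where x: "\<And>i. i < n \<Longrightarrow> x i \<in> K" "W = tuple n x"
    using tuple_exists unfolding global_carrier by blast
  have "local_sum (tate_components i) y = component i y" if i: "i < n" and y: "y \<in> K" for i y
  proof -
    have "\<forall>v. \<exists>z. v \<in> finite_places \<longrightarrow> apart v z \<and> loc v z = loc v y" using apart_exists y by blast
    then obtain z where z: "\<And>v. v \<in> finite_places \<Longrightarrow> apart v (z v) \<and> loc v (z v) = loc v y" by metis
    have P: "poles y \<subseteq> finite_places" by (auto simp: poles_def)
    have zK: "z v \<in> K" if "v \<in> poles y" for v using z P that by (auto simp: apart_def)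
    have sK: "sum z (poles y) \<in> K" using zK by (rule subring_sum[OF K_subring])
    \<comment> \<open>At \<open>w\<close> only the summand \<open>z w\<close> can have a pole, and
      it agrees there with \<open>y\<close> modulo \<open>w\<close>.\<close>
    have "y - sum z (poles y) \<in> A"
    proof (rule A_I)
      show "y - sum z (poles y) \<in> K" using y sK by (rule K_closed)
    next
      fix w assume w: "w \<in> finite_places"
      note pw = finite_place[OF w]
      have other: "sum z (poles y - {w}) \<in> w"
        using z P w by (intro subring_sum[OF place_subring[OF pw]]) (auto simp: apart_def)
      show "y - sum z (poles y) \<in> w"
      proof (cases "w \<in> poles y")
        case True
        have "sum z (poles y) = z w + sum z (poles y - {w})" using sum.remove[OF poles_finite[OF y] True] .
        moreover have "y - z w \<in> w" using z[OF w] loc_eq_iff[OF pw y zK[OF True]] by simp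
        then have "y - z w - sum z (poles y - {w}) \<in> w" using other by (rule place_closed[OF pw])
        ultimately show ?thesis by (simp add: algebra_simps)
      next
        case False
        then have "y \<in> w" using w by (simp add: poles_def)
        then show ?thesis using other False place_closed(5)[OF pw] by simp
      qed
    qed
    then have "component i y = component i (sum z (poles y))" using y sK by (rule component_cong[rotated 2])
    also have "\<dots> = (\<Sum>v\<in>poles y. component i (z v))" using zK by (rule component_sum)
    also have "\<dots> = (\<Sum>v\<in>poles y. tate_components i v (loc v y))"
      using tate_components_apart[OF i, of _ "z _"] z P by (intro sum.cong) (auto, metis subsetD)
    finally show ?thesis by (simp add: local_sum_def)
  qed
  then show "level n tate_components W = \<rho> W"
    using x level_tuple[of n x tate_components] level_hom_components[of x] by simp
qed (use \<rho> in \<open>auto simp: level_def level_hom_def\<close>)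

end

text \<open>The inclusion lets elements of the power cancel a pole of order at most \<open>m\<close>
  at \<open>v\<close>; the nonzero element is the one \<open>torsionI\<close> asks for.\<close>

lemma place_ideal_power_props:
  assumes v: "v \<in> finite_places"
  shows "place_ideal_power v m \<subseteq> A \<inter> vball v (int m)" "\<exists>a\<in>place_ideal_power v m. a \<noteq> 0"
proof -
  note pv = finite_place[OF v]
  define f where "f = (\<lambda>J. ideal_prod (subring_of A) (max_ideal v \<inter> A) J)"
  show "place_ideal_power v m \<subseteq> A \<inter> vball v (int m)"
    unfolding place_ideal_power_def f_def[symmetric]
  proof (induction m)
    case 0
    then show ?case using A_in_place[OF _ v] by (auto simp: vball_place[OF pv])
  next
    case (Suc m)
    have "s \<in> A \<inter> vball v (int (Suc m))" if "s \<in> ideal_prod (subring_of A) (max_ideal v \<inter> A) ((f ^^ m) A)" for s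
      using that
    proof (induction s rule: ideal_prod.induct)
      case (prod i j)
      then have "j \<in> A" "j \<in> vball v (int m)" "i \<in> A" "i \<in> vball v 1"
        using Suc by (auto simp: vball_max_ideal[OF pv])
      then show ?case using vball_closed(5)[OF pv, of i 1 j "int m"] by (simp add: A_closed)
    next
      case (sum s1 s2)
      then show ?case by (simp add: A_closed vball_closed[OF pv])
    qed
    then show ?case by (auto simp: f_def)
  qed
  obtain d where d: "d \<in> A" "d \<noteq> 0" "d \<in> max_ideal v" using nonzero_in_prime[OF v] by blast
  have "d ^ m \<in> (f ^^ m) A"
  proof (induction m)
    case 0
    then show ?case by (simp add: A_closed)
  next
    case (Suc m)
    then show ?case using d ideal_prod.prod[of d "max_ideal v \<inter> A" "d ^ m" "(f ^^ m) A" "subring_of A"]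
      by (simp add: f_def)
  qed
  then show "\<exists>a\<in>place_ideal_power v m. a \<noteq> 0"
    using d(2) unfolding place_ideal_power_def f_def[symmetric] by (intro bexI[of _ "d ^ m"]) auto
qed

text \<open>If the only finite pole of \<open>y\<close> is at \<open>v\<close>, of order at most
  \<open>m\<close>, then the \<open>m\<close>-th power of the prime multiplies \<open>y\<close> into
  \<open>A\<close>, where components vanish. So the value is killed by that power.\<close>

lemma component_torsion:
  assumes \<Phi>: "drinfeld_module n \<Phi>" and \<rho>: "level_hom n \<Phi> S \<rho>" and S: "S \<subseteq> Lbar"
    and v: "v \<in> finite_places" and y: "apart v y"
  shows "component n \<rho> i y \<in> place_torsion \<Phi> v"
proof -
  note pv = finite_place[OF v]
  have yK: "y \<in> K" using y by (simp add: apart_def)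
  obtain m where m: "y \<in> vball v (- int m)" using vball_exhaust[OF pv yK] by blast
  have ay: "a * y \<in> A" if a: "a \<in> place_ideal_power v m" for a
  proof (rule A_I)
    have aA: "a \<in> A" and "a \<in> vball v (int m)" using place_ideal_power_props(1)[OF v] a by auto
    then show "a * y \<in> K" using yK by (simp add: K_closed A_in_K)
    fix w assume w: "w \<in> finite_places"
    show "a * y \<in> w"
    proof (cases "w = v")
      case True
      show ?thesis using vball_closed(5)[OF pv \<open>a \<in> vball v (int m)\<close> m] by (simp add: vball_place[OF pv] True)
    next
      case False
      then show ?thesis using y w A_in_place[OF aA w] place_closed(6)[OF finite_place[OF w]] by (simp add: apart_def)
    qed
  qed
  obtain a where a: "a \<in> place_ideal_power v m" "a \<noteq> 0" using place_ideal_power_props(2)[OF v] by blast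
  have "component n \<rho> i y \<in> torsion \<Phi> (place_ideal_power v m)"
  proof (rule torsionI[OF \<Phi> _ a])
    show "place_ideal_power v m \<subseteq> A" using place_ideal_power_props(1)[OF v] by blast
    show "component n \<rho> i y \<in> Lbar" using component_mem[OF \<rho> yK] S by blast
    fix b assume b: "b \<in> place_ideal_power v m"
    then have "b \<in> A" using place_ideal_power_props(1)[OF v] by blast
    then show "twisted_eval q (\<Phi> b) (component n \<rho> i y) = 0"
      using component_smult[OF \<rho> _ yK, of b i] component_zero[OF \<rho> ay[OF b]] by simp
  qed
  then show ?thesis by (auto simp: place_torsion_def)
qed

text \<open>Common form of \<open>pointed\<close> (for \<open>S = Lbar\<close>) and
  \<open>rational_pointed\<close> (for \<open>S = L\<close>).\<close>

definition pointed_in :: "nat \<Rightarrow> 'c set \<Rightarrow> 'c pointed_datum set"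
  where "pointed_in n S = {(\<Phi>, \<zeta>) \<in> pointed n.
    \<forall>i<n. \<forall>v\<in>finite_places. \<forall>x\<in>carrier (local_quotient v). \<zeta> i v x \<in> S}"

lemma pointed_local_hom:
  assumes "(\<Phi>, \<zeta>) \<in> pointed n" "i < n" "v \<in> finite_places"
  shows "local_hom \<Phi> (place_torsion \<Phi> v) v (\<zeta> i v)"
  using assms local_tate_module_iff[OF assms(3)]
  by (auto simp: pointed_def tate_module_def PiE_iff)

lemma pointed_in_Lbar: "pointed_in n Lbar = pointed n"
  using pointed_local_hom
  by (fastforce simp: pointed_in_def local_hom_def local_quotient_carrier place_torsion_def torsion_def)

lemma level_level_hom:
  assumes D: "(\<Phi>, \<zeta>) \<in> pointed_in n S" and S: "subring S ambient"
  shows "level_hom n \<Phi> S (level n \<zeta>)"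
proof -
  have p: "(\<Phi>, \<zeta>) \<in> pointed n" using D by (simp add: pointed_in_def)
  have mem: "\<zeta> i v (loc v y) \<in> S" if "i < n" "v \<in> finite_places" "y \<in> K" for i v y
    using D that by (auto simp: pointed_in_def local_quotient_carrier)
  show ?thesis
    unfolding level_hom_def
  proof (intro conjI allI impI ballI)
    show "level n \<zeta> \<in> extensional (carrier (global_quotient_power n))" by (simp add: level_def)
  next
    fix x assume x: "\<forall>i<n. x i \<in> K"
    have "(\<Sum>i<n. local_sum (\<zeta> i) (x i)) \<in> S"
      unfolding local_sum_def using x mem by (intro subring_sum[OF S]) (auto simp: poles_def)
    then show "level n \<zeta> (tuple n x) \<in> S" using x by (simp add: level_tuple)
  next
    fix x y assume xy: "\<forall>i<n. x i \<in> K" "\<forall>i<n. y i \<in> K"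
    have "(\<Sum>i<n. local_sum (\<zeta> i) (x i + y i)) = (\<Sum>i<n. local_sum (\<zeta> i) (x i) + local_sum (\<zeta> i) (y i))"
      using xy by (intro sum.cong local_sum_add[OF pointed_local_hom[OF p]]) auto
    then show "level n \<zeta> (tuple n (\<lambda>i. x i + y i)) = level n \<zeta> (tuple n x) + level n \<zeta> (tuple n y)"
      using xy by (simp add: level_tuple K_closed sum.distrib)
  next
    fix a x assume ax: "a \<in> A" "\<forall>i<n. x i \<in> K"
    have "(\<Sum>i<n. local_sum (\<zeta> i) (a * x i)) = (\<Sum>i<n. twisted_eval q (\<Phi> a) (local_sum (\<zeta> i) (x i)))"
      using ax by (intro sum.cong local_sum_smult[OF pointed_local_hom[OF p]]) auto
    then show "level n \<zeta> (tuple n (\<lambda>i. a * x i)) = twisted_eval q (\<Phi> a) (level n \<zeta> (tuple n x))"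
      using ax by (simp add: level_tuple K_closed A_in_K twisted_eval_sum)
  qed
qed

text \<open>Gives injectivity of the passage to level structures and the converse half of
  \<open>commensurable_iff\<close>.\<close>

lemma pointed_determined:
  assumes p: "(\<Phi>, \<zeta>) \<in> pointed n" and iv: "i < n" "v \<in> finite_places" and y: "apart v y"
  shows "\<zeta> i v (loc v y) = level n \<zeta> (tuple n (unit_tuple i y))"
proof -
  have "y \<in> K" using y by (simp add: apart_def)
  then show ?thesis
    using level_unit_tuple[OF iv(1)] local_sum_apart[OF pointed_local_hom[OF p iv(1)] iv(2) y] by simp
qed

lemma pointed_extensional:
  assumes "(\<Phi>, \<zeta>) \<in> pointed n"
  shows "\<zeta> \<in> extensional {..<n}" "i < n \<Longrightarrow> \<zeta> i \<in> extensional finite_places"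
  using assms by (auto simp: pointed_def tate_module_def PiE_iff)

text \<open>Surjectivity uses \<open>tate_components\<close>; the inclusion of \<open>S\<close> in
  \<open>Lbar\<close> is what makes the values torsion points by
  \<open>component_torsion\<close>.\<close>

lemma level_bij:
  assumes S: "subring S ambient" "S \<subseteq> Lbar"
  shows "bij_betw (\<lambda>(\<Phi>, \<zeta>). (\<Phi>, level n \<zeta>)) (pointed_in n S) (level_data n S)"
proof (rule bij_betw_imageI)
  show "inj_on (\<lambda>(\<Phi>, \<zeta>). (\<Phi>, level n \<zeta>)) (pointed_in n S)"
  proof (rule inj_onI)
    fix x y assume xy: "x \<in> pointed_in n S" "y \<in> pointed_in n S"
      "(case x of (\<Phi>, \<zeta>) \<Rightarrow> (\<Phi>, level n \<zeta>)) = (case y of (\<Phi>, \<zeta>) \<Rightarrow> (\<Phi>, level n \<zeta>))"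
    obtain \<Phi> \<zeta> \<Psi> \<eta> where x: "x = (\<Phi>, \<zeta>)" and y: "y = (\<Psi>, \<eta>)" by (cases x; cases y)
    have \<Psi>: "\<Psi> = \<Phi>" and eq: "level n \<zeta> = level n \<eta>" using xy(3) by (simp_all add: x y)
    have p: "(\<Phi>, \<zeta>) \<in> pointed n" "(\<Phi>, \<eta>) \<in> pointed n" using xy(1,2) by (auto simp: x y \<Psi> pointed_in_def)
    have "\<zeta> i v Y = \<eta> i v Y" if iv: "i < n" "v \<in> finite_places" and "Y \<in> carrier (local_quotient v)" for i v Y
    proof -
      obtain y where "apart v y" "Y = loc v y"
        using apart_exists[OF iv(2)] \<open>Y \<in> carrier (local_quotient v)\<close> local_quotient_carrier[OF iv(2)] by (metis imageE)
      then show ?thesis using pointed_determined[OF p(1) iv] pointed_determined[OF p(2) iv] eq by simp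
    qed
    then have "\<zeta> i v = \<eta> i v" if "i < n" "v \<in> finite_places" for i v
      using that pointed_local_hom[OF p(1) that] pointed_local_hom[OF p(2) that]
      by (intro extensionalityI[of _ "carrier (local_quotient v)"]) (auto simp: local_hom_def)
    then have "\<zeta> i = \<eta> i" if "i < n" for i
      using that pointed_extensional(2)[OF p(1)] pointed_extensional(2)[OF p(2)]
      by (intro extensionalityI[of _ finite_places]) auto
    then have "\<zeta> = \<eta>"
      using pointed_extensional(1)[OF p(1)] pointed_extensional(1)[OF p(2)]
      by (intro extensionalityI[of _ "{..<n}"]) auto
    then show "x = y" by (simp add: x y \<Psi>)
  qed
  show "(\<lambda>(\<Phi>, \<zeta>). (\<Phi>, level n \<zeta>)) ` pointed_in n S = level_data n S"
  proof (intro equalityI subsetI)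
    fix z assume "z \<in> (\<lambda>(\<Phi>, \<zeta>). (\<Phi>, level n \<zeta>)) ` pointed_in n S"
    then obtain \<Phi> \<zeta> where z: "(\<Phi>, \<zeta>) \<in> pointed_in n S" "z = (\<Phi>, level n \<zeta>)" by auto
    then show "z \<in> level_data n S"
      using level_level_hom[OF z(1) S(1)] by (auto simp: level_data_def level_hom_iff pointed_in_def pointed_def)
  next
    fix z assume "z \<in> level_data n S"
    then obtain \<Phi> \<rho> where z: "z = (\<Phi>, \<rho>)" and \<Phi>: "drinfeld_module n \<Phi>" and \<rho>: "level_hom n \<Phi> S \<rho>"
      by (auto simp: level_data_def level_hom_iff)
    define \<zeta> where "\<zeta> = tate_components n \<rho>"
    have "\<zeta> i v \<in> local_tate_module \<Phi> v" if "i < n" "v \<in> finite_places" for i v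
      unfolding local_tate_module_iff[OF that(2)] \<zeta>_def
      using component_torsion[OF \<Phi> \<rho> S(2) that(2)] by (intro tate_components_local_hom[OF \<rho> that])
    then have "(\<Phi>, \<zeta>) \<in> pointed n"
      using \<Phi> by (auto simp: pointed_def tate_module_def PiE_iff) (auto simp: \<zeta>_def tate_components_def[OF \<rho>])
    moreover have "\<zeta> i v Y \<in> S" if iv: "i < n" "v \<in> finite_places" and Y: "Y \<in> carrier (local_quotient v)" for i v Y
    proof -
      obtain y where y: "apart v y" "Y = loc v y"
        using apart_exists[OF iv(2)] Y local_quotient_carrier[OF iv(2)] by (metis imageE)
      then have "y \<in> K" by (simp add: apart_def)
      then show ?thesis using tate_components_apart[OF \<rho> iv y(1)] component_mem[OF \<rho>] y(2) by (simp add: \<zeta>_def)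
    qed
    ultimately have "(\<Phi>, \<zeta>) \<in> pointed_in n S" by (simp add: pointed_in_def)
    moreover have "level n \<zeta> = \<rho>" unfolding \<zeta>_def by (rule level_tate_components[OF \<rho>])
    ultimately show "z \<in> (\<lambda>(\<Phi>, \<zeta>). (\<Phi>, level n \<zeta>)) ` pointed_in n S"
      unfolding z by (intro image_eqI[of _ _ "(\<Phi>, \<zeta>)"]) auto
  qed
qed

text \<open>The same \<open>P\<close> serves on both sides: additive polynomials commute with the
  sums over poles and coordinates, and evaluation at unit tuples leads back.\<close>

lemma commensurable_iff:
  assumes p: "(\<Phi>, \<zeta>) \<in> pointed n" "(\<Psi>, \<eta>) \<in> pointed n"
  shows "commensurable n (\<Phi>, \<zeta>) (\<Psi>, \<eta>) \<longleftrightarrow> level_isogenous n (\<Phi>, level n \<zeta>) (\<Psi>, level n \<eta>)"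
proof -
  have "(\<forall>i<n. \<forall>v\<in>finite_places. \<eta> i v = tate_map P v (\<zeta> i v)) \<longleftrightarrow>
    (\<forall>W\<in>carrier (global_quotient_power n). level n \<eta> W = twisted_eval q P (level n \<zeta> W))" for P
  proof
    assume H: "\<forall>i<n. \<forall>v\<in>finite_places. \<eta> i v = tate_map P v (\<zeta> i v)"
    show "\<forall>W\<in>carrier (global_quotient_power n). level n \<eta> W = twisted_eval q P (level n \<zeta> W)"
      unfolding global_ball
    proof (intro allI impI)
      fix x assume x: "\<forall>i<n. x i \<in> K"
      have "local_sum (\<eta> i) (x i) = twisted_eval q P (local_sum (\<zeta> i) (x i))" if "i < n" for i
        unfolding local_sum_def twisted_eval_sum using H that x
        by (intro sum.cong) (auto simp: poles_def tate_map_def local_quotient_carrier)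
      then show "level n \<eta> (tuple n x) = twisted_eval q P (level n \<zeta> (tuple n x))"
        using x by (simp add: level_tuple twisted_eval_sum)
    qed
  next
    assume H: "\<forall>W\<in>carrier (global_quotient_power n). level n \<eta> W = twisted_eval q P (level n \<zeta> W)"
    show "\<forall>i<n. \<forall>v\<in>finite_places. \<eta> i v = tate_map P v (\<zeta> i v)"
    proof (intro allI impI ballI)
      fix i v assume iv: "i < n" "v \<in> finite_places"
      show "\<eta> i v = tate_map P v (\<zeta> i v)"
      proof (rule extensionalityI[of _ "carrier (local_quotient v)"])
        show "\<eta> i v \<in> extensional (carrier (local_quotient v))"
          using pointed_local_hom[OF p(2) iv] by (simp add: local_hom_def)
        show "tate_map P v (\<zeta> i v) \<in> extensional (carrier (local_quotient v))" by (simp add: tate_map_def)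
        fix Y assume Y: "Y \<in> carrier (local_quotient v)"
        then obtain y where y: "apart v y" "Y = loc v y"
          using apart_exists[OF iv(2)] local_quotient_carrier[OF iv(2)] by (metis imageE)
        have "y \<in> K" using y by (simp add: apart_def)
        then have "tuple n (unit_tuple i y) \<in> carrier (global_quotient_power n)"
          by (intro tuple_mem unit_tuple_in_K)
        then show "\<eta> i v Y = tate_map P v (\<zeta> i v) Y"
          using H Y pointed_determined[OF p(1) iv y(1)] pointed_determined[OF p(2) iv y(1)]
          by (simp add: tate_map_def y(2))
      qed
    qed
  qed
  then show ?thesis by (simp add: commensurable_def level_isogenous_def)
qed

lemma pointed_level_identified:
  assumes S: "subring S ambient" "S \<subseteq> Lbar"
  shows "identified_via (corresponds n) (equiv_classes (pointed_in n S) (commensurable n))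
    (equiv_classes (level_data n S) (level_isogenous n))"
proof (rule identified_viaI[OF level_bij[OF S]])
  fix x y assume "x \<in> pointed_in n S" "y \<in> pointed_in n S"
  then show "commensurable n x y \<longleftrightarrow>
      level_isogenous n (case x of (\<Phi>, \<zeta>) \<Rightarrow> (\<Phi>, level n \<zeta>)) (case y of (\<Phi>, \<zeta>) \<Rightarrow> (\<Phi>, level n \<zeta>))"
    by (cases x; cases y) (simp add: pointed_in_def commensurable_iff)
next
  fix x y assume xy: "x \<in> pointed_in n S" "y \<in> level_data n S"
  obtain \<Phi> \<zeta> \<Psi> \<rho> where eq: "x = (\<Phi>, \<zeta>)" "y = (\<Psi>, \<rho>)" by (cases x; cases y)
  have "\<rho> \<in> extensional (carrier (global_quotient_power n))"
    using xy(2) by (auto simp: eq level_data_def level_hom_iff level_hom_def)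
  then show "corresponds n x y \<longleftrightarrow> y = (case x of (\<Phi>, \<zeta>) \<Rightarrow> (\<Phi>, level n \<zeta>))"
    using level_of_exhausts by (auto simp: eq corresponds_def)
qed

end

section \<open>A nonconstant function from a Drinfeld module, and the conclusion\<close>

context drinfeld_setting
begin

text \<open>Nontriviality provides some \<open>t\<close> with \<open>\<Phi> t\<close> different from
  \<open>[:t:]\<close>, whereas constants \<open>c\<close> are sent to \<open>[:c:]\<close>.\<close>

lemma drinfeld_nonconstant:
  assumes "drinfeld_module n \<Phi>"
  shows "\<exists>t. nonconstant_drinfeld_setting k K Oinf nrm L t"
proof -
  obtain t where "t \<in> A" "\<Phi> t \<noteq> [:t:]" using assms by (auto simp: drinfeld_module_def)
  moreover from this have "t \<notin> k" using assms by (auto simp: drinfeld_module_def)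
  ultimately have "nonconstant_drinfeld_setting k K Oinf nrm L t" by unfold_locales
  then show ?thesis by blast
qed

text \<open>If there is no Drinfeld module of rank \<open>n\<close>, no nonconstant function is at
  hand, but then all sets of data are empty and the identification is trivial.\<close>

lemma pointed_level_classes:
  "identified_via (corresponds n) (equiv_classes (pointed n) (commensurable n))
     (equiv_classes (level_data n Lbar) (level_isogenous n)) \<and>
   identified_via (corresponds n) (equiv_classes (rational_pointed n) (commensurable n))
     (equiv_classes (level_data n L) (level_isogenous n))"
proof (cases "\<exists>\<Phi>. drinfeld_module n \<Phi>")
  case True
  then obtain t where "nonconstant_drinfeld_setting k K Oinf nrm L t" using drinfeld_nonconstant by blast
  then interpret nonconstant_drinfeld_setting k K Oinf nrm L t .
  have "rational_pointed n = pointed_in n L" by (simp add: rational_pointed_def pointed_in_def)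
  then show ?thesis
    using pointed_level_identified[OF Lbar_subring order_refl, of n] pointed_in_Lbar[of n]
      pointed_level_identified[OF subfield_closed(1)[OF L_subfield] L_subset_Lbar, of n] by simp
next
  case False
  then have "pointed n = {}" "rational_pointed n = {}" "level_data n S = {}" for S
    by (auto simp: pointed_def rational_pointed_def level_data_def)
  then show ?thesis
    using identified_viaI[of undefined "{}" "{}"] by (simp add: bij_betw_def)
qed

end

theorem corollary2p5:
  fixes k K Oinf L :: "'c::field set" and nrm :: "'c \<Rightarrow> real" and n :: nat
  assumes "drinfeld_setting k K Oinf nrm L" and "n \<ge> 1"
  shows
    "identified_via (drinfeld_setting.corresponds k K Oinf n)
       (equiv_classes (drinfeld_setting.pointed k K Oinf L n)
          (drinfeld_setting.commensurable k K Oinf L n))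
       (equiv_classes (drinfeld_setting.level_data k K Oinf L n (drinfeld_setting.Lbar L))
          (drinfeld_setting.level_isogenous k K Oinf L n)) \<and>
     identified_via (drinfeld_setting.corresponds k K Oinf n)
       (equiv_classes (drinfeld_setting.rational_pointed k K Oinf L n)
          (drinfeld_setting.commensurable k K Oinf L n))
       (equiv_classes (drinfeld_setting.level_data k K Oinf L n L)
          (drinfeld_setting.level_isogenous k K Oinf L n))"
  using drinfeld_setting.pointed_level_classes[OF assms(1)] .


end
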